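(* Let $p$ be a prime, let $q$ be an odd prime that divides $p-1$, and let $n>q$ be an integer. Then there exists a finite solvable group $G$ with $\mathrm{dl}(G)=4$, Fitting height $3$, and $$\mathrm{cd}(G)=\{1,\ q,\ (p^q-1)_{q'}(p-1)_q\,q,\ p^n q\}.$$
   Context: $\mathrm{cd}(G)$ is the set of degrees of irreducible complex characters of $G$, and $\mathrm{dl}(G)$ is the derived length of $G$. For a positive integer $N$ and a prime $q$, $N_q$ denotes the largest power of $q$ dividing $N$, and $N_{q'}=N/N_q$. *)

theory Defs
  imports "HOL-Algebra.Algebra" "HOL-Computational_Algebra.Primes" "Jordan_Normal_Form.Matrix"
begin

definition ppart :: "nat \<Rightarrow> nat \<Rightarrow> nat" where
  "ppart q N = q ^ multiplicity q N"

definition pprime_part :: "nat \<Rightarrow> nat \<Rightarrow> nat" where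
  "pprime_part q N = N div ppart q N"

definition is_rep :: "('a, 'b) monoid_scheme \<Rightarrow> nat \<Rightarrow> ('a \<Rightarrow> complex mat) \<Rightarrow> bool" where
  "is_rep G n \<rho> \<longleftrightarrow>
     (\<forall>g \<in> carrier G. \<rho> g \<in> carrier_mat n n) \<and>
     \<rho> \<one>\<^bsub>G\<^esub> = 1\<^sub>m n \<and>
     (\<forall>g \<in> carrier G. \<forall>h \<in> carrier G. \<rho> (g \<otimes>\<^bsub>G\<^esub> h) = \<rho> g * \<rho> h)"

definition is_subspace :: "nat \<Rightarrow> complex vec set \<Rightarrow> bool" where
  "is_subspace n W \<longleftrightarrow> W \<subseteq> carrier_vec n \<and> 0\<^sub>v n \<in> W \<and>
     (\<forall>v \<in> W. \<forall>w \<in> W. v + w \<in> W) \<and> (\<forall>c. \<forall>v \<in> W. c \<cdot>\<^sub>v v \<in> W)"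

definition irr_rep :: "('a, 'b) monoid_scheme \<Rightarrow> nat \<Rightarrow> ('a \<Rightarrow> complex mat) \<Rightarrow> bool" where
  "irr_rep G n \<rho> \<longleftrightarrow> is_rep G n \<rho> \<and> n > 0 \<and>
     (\<forall>W. is_subspace n W \<and> (\<forall>g \<in> carrier G. \<forall>w \<in> W. \<rho> g *\<^sub>v w \<in> W)
          \<longrightarrow> W = {0\<^sub>v n} \<or> W = carrier_vec n)"

text \<open>cd(G): degrees of irreducible complex characters = degrees of irreducible complex representations.\<close>
definition cd :: "('a, 'b) monoid_scheme \<Rightarrow> nat set" where
  "cd G = {n. \<exists>\<rho>. irr_rep G n \<rho>}"

definition derived_length :: "('a, 'b) monoid_scheme \<Rightarrow> nat" where
  "derived_length G = (LEAST n. (derived G ^^ n) (carrier G) = {\<one>\<^bsub>G\<^esub>})"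

fun lower_central :: "('a, 'b) monoid_scheme \<Rightarrow> nat \<Rightarrow> 'a set" where
  "lower_central G 0 = carrier G"
| "lower_central G (Suc i) = generate G
     {x \<otimes>\<^bsub>G\<^esub> y \<otimes>\<^bsub>G\<^esub> inv\<^bsub>G\<^esub> x \<otimes>\<^bsub>G\<^esub> inv\<^bsub>G\<^esub> y | x y. x \<in> lower_central G i \<and> y \<in> carrier G}"

definition nilpotent :: "('a, 'b) monoid_scheme \<Rightarrow> bool" where
  "nilpotent G \<longleftrightarrow> (\<exists>c. lower_central G c = {\<one>\<^bsub>G\<^esub>})"

definition fitting_height :: "('a, 'b) monoid_scheme \<Rightarrow> nat" where
  "fitting_height G = (LEAST h. \<exists>F :: nat \<Rightarrow> 'a set.
     F 0 = {\<one>\<^bsub>G\<^esub>} \<and> F h = carrier G \<and>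
     (\<forall>i \<le> h. F i \<lhd> G) \<and>
     (\<forall>i < h. F i \<subseteq> F (Suc i) \<and> nilpotent ((G\<lparr>carrier := F (Suc i)\<rparr>) Mod (F i))))"

end

(*
  Let F = GF(p^q) with generator w of its unit group, M = p^q - 1, and let h_j(x) = w^j x^(p^j).
  Since q divides p - 1, the maps h_j for j mod M form a group H, which acts regularly on F - {0};
  the h_j with q dvd j form an abelian normal subgroup C of index q. Let H act on X = F x D, where
  D = GF(p)^(n-q) with trivial action, and let z be a primitive q-th root of unity mod p. G is the group of
  all permutations (x, s) |-> (h_j x + a, z^j s + f x) of X x GF(p) with a in X and f affine.

  Let P be the normal subgroup j = 0, N the group of affine functions f, and Z the constants. P has
  class 2 with P' = Z, C centralizes Z, and H/C acts faithfully on it. An irreducible representation that is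
  nontrivial on Z is induced from NC and has degree p^n q. One that is trivial on Z but not on F and its dual is
  induced from P and has degree |H| = M, because H acts freely on the characters of F and of its dual; for the
  dual this uses that z lies in the subgroup C of the unit group of F, as q^2 divides M. All others factor through
  a group with an abelian normal subgroup of index q. Finally M is the third degree, because the q-part of M
  exceeds that of p - 1 by exactly one factor q.

  Both directions of each degree computation rest on a single configuration: a subgroup A, a vector (or a linear
  character) of weight mu under A, and a normal subgroup N <= A whose elements separate mu from its conjugates
  outside A. Then the conjugates of mu span independent lines, so the degree is the index of A.
*)
theory Submission
  imports Defs "Jordan_Normal_Form.VS_Connect" "HOL-Number_Theory.Number_Theory"
    "HOL-Computational_Algebra.Polynomial"
begin

section \<open>Sums of vectors and eigenvectors of periodic matrices\<close>

text \<open>The factor \<open>z^j\<close> makes H/C move the central characters; without it they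
  would be H-invariant and the factor q in p^n q would be lost. The price is a twist on the dual of
  F: a functional u fixed by h_j satisfies u(h_j x) = z^j u(x). Because multiplication by z is
  itself some h_s with q dvd s, such a u vanishes on all differences of h_j x and h_(sj) x, and for
  nontrivial h_j these fill F. Freeness also yields the two heights. Every element of F and of its
  dual is a commutator with any given nontrivial element of H. So both survive in G' and G'', their
  pairing keeps G''' nontrivial, and a subgroup that contains F and a nontrivial rotation is not
  nilpotent. H is not nilpotent because M has a prime divisor that divides neither p - 1 nor q; this
  excludes Fitting height 2. The field is taken as GF(p)[X]/(X^q - a) with a not a q-th power,
  because there the Frobenius map is the substitution of zX for X.\<close>

definition vsum :: "nat \<Rightarrow> 's set \<Rightarrow> ('s \<Rightarrow> complex vec) \<Rightarrow> complex vec" where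
  "vsum d S f = vec d (\<lambda>r. \<Sum>s\<in>S. f s $ r)"

lemma vsum_carrier [simp]: "vsum d S f \<in> carrier_vec d"
  by (simp add: vsum_def)

lemma vsum_index [simp]: "r < d \<Longrightarrow> vsum d S f $ r = (\<Sum>s\<in>S. f s $ r)"
  by (simp add: vsum_def)

lemma vsum_dim [simp]: "dim_vec (vsum d S f) = d"
  by (simp add: vsum_def)

lemma smult_vec_index: "v \<in> carrier_vec d \<Longrightarrow> r < d \<Longrightarrow> (c \<cdot>\<^sub>v v) $ r = c * v $ r"
  by auto

lemma mult_mat_vec_zero [simp]: "A \<in> carrier_mat d d \<Longrightarrow> A *\<^sub>v 0\<^sub>v d = 0\<^sub>v d"
  by (rule eq_vecI) auto

lemma vsum_empty: "vsum d {} f = 0\<^sub>v d"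
  by (rule eq_vecI) auto

lemma vsum_insert:
  "finite S \<Longrightarrow> s \<notin> S \<Longrightarrow> f s \<in> carrier_vec d \<Longrightarrow> vsum d (insert s S) f = f s + vsum d S f"
  by (rule eq_vecI) auto

lemma vsum_cong: "(\<And>s. s \<in> S \<Longrightarrow> f s = g s) \<Longrightarrow> vsum d S f = vsum d S g"
  by (simp add: vsum_def)

lemma vsum_smult:
  assumes "\<And>s. s \<in> S \<Longrightarrow> f s \<in> carrier_vec d"
  shows "c \<cdot>\<^sub>v vsum d S f = vsum d S (\<lambda>s. c \<cdot>\<^sub>v f s)"
  using assms by (intro eq_vecI) (auto simp: sum_distrib_left smult_vec_index[of _ d] intro!: sum.cong)

lemma mult_mat_vsum:
  assumes "A \<in> carrier_mat d d" "finite S" "\<And>s. s \<in> S \<Longrightarrow> f s \<in> carrier_vec d"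
  shows "A *\<^sub>v vsum d S f = vsum d S (\<lambda>s. A *\<^sub>v f s)"
  using assms(2,3)
proof (induction S)
  case empty
  show ?case using assms(1) by (simp add: vsum_empty)
next
  case (insert s S)
  then show ?case using assms(1)
    by (simp add: vsum_insert mult_add_distrib_mat_vec[of A d d])
qed

lemma is_subspaceD:
  assumes "is_subspace d W"
  shows "W \<subseteq> carrier_vec d" "0\<^sub>v d \<in> W"
    "v \<in> W \<Longrightarrow> w \<in> W \<Longrightarrow> v + w \<in> W" "v \<in> W \<Longrightarrow> c \<cdot>\<^sub>v v \<in> W"
  using assms by (auto simp: is_subspace_def)

lemma subspace_vsum:
  assumes "is_subspace d W" "finite S" "\<And>s. s \<in> S \<Longrightarrow> f s \<in> W"
  shows "vsum d S f \<in> W"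
  using assms(2,3)
proof (induction S)
  case empty
  then show ?case using is_subspaceD[OF assms(1)] by (simp add: vsum_empty)
next
  case (insert s S)
  have "f s \<in> carrier_vec d" using insert is_subspaceD(1)[OF assms(1)] by auto
  then show ?case using insert is_subspaceD(3)[OF assms(1)] by (simp add: vsum_insert)
qed

lemma smult_vec_zero_iff:
  assumes "(v :: complex vec) \<in> carrier_vec d" "c \<cdot>\<^sub>v v = 0\<^sub>v d"
  shows "c = 0 \<or> v = 0\<^sub>v d"
proof (rule disjCI)
  assume "v \<noteq> 0\<^sub>v d"
  then obtain i where i: "i < d" "v $ i \<noteq> 0" using assms(1) by (auto simp: vec_eq_iff)
  have "(c \<cdot>\<^sub>v v) $ i = 0" using assms(2) i by simp
  then show "c = 0" using i assms(1) by simp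
qed

text \<open>Geometric series: for \<open>0 < j < N\<close> the ratio is an \<open>N\<close>-th root
  of unity, and it is not 1 because \<open>j / N\<close> is not an integer.\<close>

lemma root_of_unity_sum:
  assumes "N > 0" "j < N"
  shows "(\<Sum>i<N. cis (2 * pi / real N) ^ (i * j)) = (if j = 0 then of_nat N else 0)"
proof (cases "j = 0")
  case False
  let ?u = "cis (2 * pi / real N) ^ j"
  have e: "?u = cis (2 * pi * (real j / real N))" by (simp add: DeMoivre algebra_simps)
  have "?u \<noteq> 1"
  proof
    assume "?u = 1"
    then obtain k where k: "2 * pi * (real j / real N) = 2 * pi * of_int k"
      unfolding e by (metis Complex_eq_1 cis.code complex_of_real_def cos_one_2pi_int complex.sel(1) cis.sel(1) one_complex.sel(1) mult.commute mult.left_commute)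
    then have "real j / real N = of_int k" by (simp only: mult_cancel_left) auto
    then have "real j = of_int k * real N" using assms by (simp add: field_simps)
    then have "int j = k * int N" by (metis of_int_eq_iff of_int_mult of_int_of_nat_eq)
    moreover have "int j > 0" "int j < int N" using assms False by auto
    ultimately have "0 < k * int N" "k * int N < 1 * int N" by auto
    then have "0 < k" "k < 1" using assms(1)
      by (simp_all only: zero_less_mult_iff mult_less_cancel_right) auto
    then show False by simp
  qed
  moreover have "?u ^ N = 1"
  proof -
    have "?u ^ N = cis (2 * pi * real j)" unfolding e using assms by (simp add: DeMoivre)
    then show ?thesis by (simp add: cis_multiple_2pi)
  qed
  ultimately have "(\<Sum>i<N. ?u ^ i) = 0" by (simp add: geometric_sum)
  then show ?thesis using False
    by (simp only: mult.commute[of _ j] power_mult if_False)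
qed simp

text \<open>The eigenvectors are the discrete Fourier transform of the periodic orbit of \<open>w\<close>; they
  sum up to a multiple of \<open>w\<close>, so one of them is nonzero.\<close>
lemma periodic_eigenvector:
  assumes A: "A \<in> carrier_mat d d" and W: "is_subspace d W" and inv: "\<And>v. v \<in> W \<Longrightarrow> A *\<^sub>v v \<in> W"
    and w: "w \<in> W" "w \<noteq> 0\<^sub>v d" and N: "N > 0" "((\<lambda>v. A *\<^sub>v v) ^^ N) w = w"
  obtains c v where "v \<in> W" "v \<noteq> 0\<^sub>v d" "A *\<^sub>v v = c \<cdot>\<^sub>v v"
proof -
  define f where "f j = ((\<lambda>v. A *\<^sub>v v) ^^ j) w" for j
  have fW: "f j \<in> W" for j by (induction j) (auto simp: f_def w inv)
  have fc: "f j \<in> carrier_vec d" for j using fW is_subspaceD(1)[OF W] by auto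
  have fS: "A *\<^sub>v f j = f (Suc j)" for j by (simp add: f_def)
  have fN: "f N = f 0" using N by (simp add: f_def)
  define \<omega> where "\<omega> = cis (2 * pi / real N)"
  have \<omega>: "\<omega> \<noteq> 0" by (simp add: \<omega>_def)
  have \<omega>N: "\<omega> ^ N = 1" using N by (simp add: \<omega>_def DeMoivre)
  define u where "u i = vsum d {..<N} (\<lambda>j. (\<omega> ^ (i * j)) \<cdot>\<^sub>v f j)" for i
  have uW: "u i \<in> W" for i
    unfolding u_def using fW is_subspaceD(4)[OF W] by (intro subspace_vsum[OF W]) auto
  have eig: "A *\<^sub>v u i = inverse (\<omega> ^ i) \<cdot>\<^sub>v u i" for i
  proof (rule eq_vecI)
    fix r assume "r < dim_vec (inverse (\<omega> ^ i) \<cdot>\<^sub>v u i)"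
    then have r: "r < d" by (simp add: u_def)
    have sm: "A *\<^sub>v (c \<cdot>\<^sub>v f j) = c \<cdot>\<^sub>v f (Suc j)" for c j
      using A fc[of j] by (simp add: mult_mat_vec fS)
    have "(A *\<^sub>v u i) $ r = (\<Sum>j<N. \<omega> ^ (i * j) * f (Suc j) $ r)"
      unfolding u_def using r A fc by (subst mult_mat_vsum) (auto simp: sm smult_vec_index[of _ d] intro!: sum.cong) 
    also have "\<dots> = inverse (\<omega> ^ i) * (\<Sum>j<N. \<omega> ^ (i * Suc j) * f (Suc j) $ r)"
      using \<omega> by (simp add: sum_distrib_left power_add field_simps)
    \<comment> \<open>The shift permutes the terms cyclically: the term at \<open>N\<close> equals
      the term at \<open>0\<close>.\<close>
    also have "(\<Sum>j<N. \<omega> ^ (i * Suc j) * f (Suc j) $ r) = (\<Sum>j<N. \<omega> ^ (i * j) * f j $ r)"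
    proof -
      have "(\<Sum>j<N. \<omega> ^ (i * Suc j) * f (Suc j) $ r) + \<omega> ^ (i * 0) * f 0 $ r =
            (\<Sum>j<N. \<omega> ^ (i * j) * f j $ r) + \<omega> ^ (i * N) * f N $ r"
        using sum.lessThan_Suc_shift[of "\<lambda>j. \<omega> ^ (i * j) * f j $ r" N]
              sum.lessThan_Suc[of "\<lambda>j. \<omega> ^ (i * j) * f j $ r" N] by simp
      moreover have "\<omega> ^ (i * N) = 1" by (metis \<omega>N mult.commute power_mult power_one)
      ultimately show ?thesis using fN by simp
    qed
    also have "inverse (\<omega> ^ i) * (\<Sum>j<N. \<omega> ^ (i * j) * f j $ r) = (inverse (\<omega> ^ i) \<cdot>\<^sub>v u i) $ r"
      using r fc by (auto simp: u_def smult_vec_index[of _ d] intro!: sum.cong)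
    finally show "(A *\<^sub>v u i) $ r = (inverse (\<omega> ^ i) \<cdot>\<^sub>v u i) $ r" .
  qed (use A in \<open>auto simp: u_def\<close>)
  have "\<exists>i<N. u i \<noteq> 0\<^sub>v d"
  proof (rule ccontr)
    assume H: "\<not> (\<exists>i<N. u i \<noteq> 0\<^sub>v d)"
    have "w $ r = 0" if r: "r < d" for r
    proof -
      have "0 = (\<Sum>i<N. u i $ r)" using H r by simp
      also have "\<dots> = (\<Sum>i<N. \<Sum>j<N. \<omega> ^ (i * j) * f j $ r)"
        using r fc by (simp add: u_def smult_vec_index[of _ d])
      also have "\<dots> = (\<Sum>j<N. (\<Sum>i<N. \<omega> ^ (i * j)) * f j $ r)"
        by (subst sum.swap) (simp add: sum_distrib_right)
      also have "\<dots> = (\<Sum>j<N. if j = 0 then of_nat N * f j $ r else 0)"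
        using N by (intro sum.cong) (auto simp: \<omega>_def root_of_unity_sum)
      also have "\<dots> = of_nat N * f 0 $ r" using N by simp
      finally show ?thesis using N by (simp add: f_def)
    qed
    then show False using w is_subspaceD(1)[OF W] by (auto simp: vec_eq_iff)
  qed
  then show ?thesis using that uW eig by blast
qed

section \<open>Weights of representations\<close>

lemma rep_carrier: "is_rep G d \<rho> \<Longrightarrow> g \<in> carrier G \<Longrightarrow> \<rho> g \<in> carrier_mat d d"
  by (simp add: is_rep_def)

lemma rep_one: "is_rep G d \<rho> \<Longrightarrow> v \<in> carrier_vec d \<Longrightarrow> \<rho> \<one>\<^bsub>G\<^esub> *\<^sub>v v = v"
  by (simp add: is_rep_def)

lemma rep_mult:
  assumes "is_rep G d \<rho>" "g \<in> carrier G" "h \<in> carrier G" "v \<in> carrier_vec d"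
  shows "\<rho> (g \<otimes>\<^bsub>G\<^esub> h) *\<^sub>v v = \<rho> g *\<^sub>v (\<rho> h *\<^sub>v v)"
  using assms assoc_mult_mat_vec[of "\<rho> g" d d "\<rho> h" d v] by (simp add: is_rep_def)

lemma rep_vec_carrier [simp]:
  "is_rep G d \<rho> \<Longrightarrow> g \<in> carrier G \<Longrightarrow> v \<in> carrier_vec d \<Longrightarrow> \<rho> g *\<^sub>v v \<in> carrier_vec d"
  by (rule mult_mat_vec_carrier[OF rep_carrier])

lemma rep_smult:
  assumes "is_rep G d \<rho>" "g \<in> carrier G" "v \<in> carrier_vec d"
  shows "\<rho> g *\<^sub>v (c \<cdot>\<^sub>v v) = c \<cdot>\<^sub>v (\<rho> g *\<^sub>v v)"
  using mult_mat_vec[of "\<rho> g" d d v c] rep_carrier[OF assms(1,2)] assms(3) by simp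

text \<open>Every \<open>g\<close> has finite order, so the orbit of a vector under
  \<open>\<rho> g\<close> is periodic, with the group order as a period. No characteristic
  polynomial is involved.\<close>

lemma rep_eigenvector:
  assumes G: "group G" "finite (carrier G)" and rep: "is_rep G d \<rho>" and g: "g \<in> carrier G"
    and W: "is_subspace d W" "W \<noteq> {0\<^sub>v d}" and inv: "\<And>v. v \<in> W \<Longrightarrow> \<rho> g *\<^sub>v v \<in> W"
  obtains c v where "v \<in> W" "v \<noteq> 0\<^sub>v d" "\<rho> g *\<^sub>v v = c \<cdot>\<^sub>v v"
proof -
  interpret group G by fact
  obtain w where w: "w \<in> W" "w \<noteq> 0\<^sub>v d" using W is_subspaceD(2) by blast
  have wc: "w \<in> carrier_vec d" using w is_subspaceD(1)[OF W(1)] by auto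
  have pw: "((\<lambda>v. \<rho> g *\<^sub>v v) ^^ j) w = \<rho> (g [^]\<^bsub>G\<^esub> j) *\<^sub>v w" for j
  proof (induction j)
    case 0
    then show ?case using rep_one[OF rep wc] by simp
  next
    case (Suc j)
    have "g [^]\<^bsub>G\<^esub> Suc j = g \<otimes>\<^bsub>G\<^esub> g [^]\<^bsub>G\<^esub> j" using g by (metis nat_pow_Suc2)
    then show ?case using Suc rep_mult[OF rep g _ wc] g by simp
  qed
  have "((\<lambda>v. \<rho> g *\<^sub>v v) ^^ card (carrier G)) w = w"
    unfolding pw using pow_order_eq_1[OF g] rep_one[OF rep wc] by (simp add: Coset.order_def)
  moreover have "card (carrier G) > 0" using G(2) by (auto simp: card_gt_0_iff)
  ultimately show ?thesis
    using that by (elim periodic_eigenvector[OF rep_carrier[OF rep g] W(1) inv w, rotated 2])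
qed

lemma eigenspace_subspace:
  assumes "A \<in> carrier_mat d d" "is_subspace d W"
  shows "is_subspace d {v \<in> W. A *\<^sub>v v = c \<cdot>\<^sub>v v}"
  unfolding is_subspace_def
proof (intro conjI ballI allI)
  show "{v \<in> W. A *\<^sub>v v = c \<cdot>\<^sub>v v} \<subseteq> carrier_vec d" using is_subspaceD(1)[OF assms(2)] by auto
  show "0\<^sub>v d \<in> {v \<in> W. A *\<^sub>v v = c \<cdot>\<^sub>v v}" using assms is_subspaceD(2)[OF assms(2)] by (auto intro!: eq_vecI)
next
  fix v w assume "v \<in> {v \<in> W. A *\<^sub>v v = c \<cdot>\<^sub>v v}" "w \<in> {v \<in> W. A *\<^sub>v v = c \<cdot>\<^sub>v v}"
  then show "v + w \<in> {v \<in> W. A *\<^sub>v v = c \<cdot>\<^sub>v v}"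
    using assms is_subspaceD(1,3)[OF assms(2)]
    by (auto simp: mult_add_distrib_mat_vec[of A d d] smult_add_distrib_vec[of _ d] subset_iff)
next
  fix a v assume v: "v \<in> {v \<in> W. A *\<^sub>v v = c \<cdot>\<^sub>v v}"
  then have "v \<in> carrier_vec d" using is_subspaceD(1)[OF assms(2)] by auto
  then show "a \<cdot>\<^sub>v v \<in> {v \<in> W. A *\<^sub>v v = c \<cdot>\<^sub>v v}"
    using v assms is_subspaceD(4)[OF assms(2)]
    by (auto simp: mult_mat_vec[of A d d] smult_smult_assoc mult.commute)
qed

text \<open>Commuting operators preserve each other's eigenspaces, so the induction over
  \<open>S\<close> replaces \<open>W\<close> by an eigenspace at every step.\<close>

lemma common_eigenvector:
  assumes G: "group G" "finite (carrier G)" and rep: "is_rep G d \<rho>"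
    and "finite S" "S \<subseteq> carrier G" "is_subspace d W" "W \<noteq> {0\<^sub>v d}"
    and "\<And>s v. s \<in> S \<Longrightarrow> v \<in> W \<Longrightarrow> \<rho> s *\<^sub>v v \<in> W"
    and "\<And>s t v. s \<in> S \<Longrightarrow> t \<in> S \<Longrightarrow> v \<in> W \<Longrightarrow> \<rho> s *\<^sub>v (\<rho> t *\<^sub>v v) = \<rho> t *\<^sub>v (\<rho> s *\<^sub>v v)"
  shows "\<exists>v\<in>W. v \<noteq> 0\<^sub>v d \<and> (\<forall>s\<in>S. \<exists>c. \<rho> s *\<^sub>v v = c \<cdot>\<^sub>v v)"
  using assms(4-)
proof (induction S arbitrary: W)
  case empty
  then show ?case using is_subspaceD(2) by blast
next
  case (insert s S)
  have s: "s \<in> carrier G" using insert.prems by simp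
  obtain c w where w: "w \<in> W" "w \<noteq> 0\<^sub>v d" "\<rho> s *\<^sub>v w = c \<cdot>\<^sub>v w"
    using rep_eigenvector[OF G rep s insert.prems(2,3)] insert.prems(4) by (metis insertI1)
  let ?W = "{v \<in> W. \<rho> s *\<^sub>v v = c \<cdot>\<^sub>v v}"
  have "\<exists>v\<in>?W. v \<noteq> 0\<^sub>v d \<and> (\<forall>s\<in>S. \<exists>c. \<rho> s *\<^sub>v v = c \<cdot>\<^sub>v v)"
  proof (rule insert.IH)
    show "is_subspace d ?W" by (rule eigenspace_subspace[OF rep_carrier[OF rep s] insert.prems(2)])
    show "?W \<noteq> {0\<^sub>v d}" using w by blast
    show "S \<subseteq> carrier G" using insert.prems by simp
    fix t v assume t: "t \<in> S" and v: "v \<in> ?W"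
    have vc: "v \<in> carrier_vec d" using v is_subspaceD(1)[OF insert.prems(2)] by auto
    have "\<rho> s *\<^sub>v (\<rho> t *\<^sub>v v) = \<rho> t *\<^sub>v (c \<cdot>\<^sub>v v)" using insert.prems(5)[of s t v] t v by simp
    also have "\<dots> = c \<cdot>\<^sub>v (\<rho> t *\<^sub>v v)" using rep_smult[OF rep _ vc] insert.prems(1) t by blast
    finally show "\<rho> t *\<^sub>v v \<in> ?W" using insert.prems(4)[of t v] t v by simp
  qed (use insert.prems(5) in auto)
  then show ?case using w by auto
qed

lemma whole_subspace: "is_subspace d (carrier_vec d)"
  by (simp add: is_subspace_def)

lemma irr_repD:
  assumes "irr_rep G d \<rho>"
  shows "is_rep G d \<rho>" "d > 0" "is_subspace d W \<Longrightarrow> (\<And>g w. g \<in> carrier G \<Longrightarrow> w \<in> W \<Longrightarrow> \<rho> g *\<^sub>v w \<in> W)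
    \<Longrightarrow> v \<in> W \<Longrightarrow> v \<noteq> 0\<^sub>v d \<Longrightarrow> W = carrier_vec d"
proof -
  show "is_rep G d \<rho>" "d > 0" using assms by (simp_all add: irr_rep_def)
  assume "is_subspace d W" "\<And>g w. g \<in> carrier G \<Longrightarrow> w \<in> W \<Longrightarrow> \<rho> g *\<^sub>v w \<in> W"
  then have "W = {0\<^sub>v d} \<or> W = carrier_vec d" using assms by (simp add: irr_rep_def)
  moreover assume "v \<in> W" "v \<noteq> 0\<^sub>v d"
  ultimately show "W = carrier_vec d" by auto
qed

lemma whole_nonzero: "d > 0 \<Longrightarrow> carrier_vec d \<noteq> {0\<^sub>v d :: complex vec}"
proof
  assume d: "d > 0" and eq: "carrier_vec d = {0\<^sub>v d :: complex vec}"
  have "unit_vec d 0 = (0\<^sub>v d :: complex vec)" using eq unit_vec_carrier by blast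
  then have "unit_vec d 0 $ 0 = (0::complex)" using d by simp
  then show False using d by simp
qed

text \<open>The vectors fixed by a normal subgroup form an invariant subspace, and \<open>u\<close>
  shows that it is not the whole space. This is how a weight vector is seen to have a nontrivial
  weight on \<open>K\<close> once \<open>K\<close> acts nontrivially.\<close>

lemma irr_rep_no_fixed_vector:
  fixes G (structure)
  assumes "group G" "irr_rep G d \<rho>" "K \<lhd> G" "k \<in> K" "u \<in> carrier_vec d" "\<rho> k *\<^sub>v u \<noteq> u"
    and v: "v \<in> carrier_vec d" "\<And>x. x \<in> K \<Longrightarrow> \<rho> x *\<^sub>v v = v"
  shows "v = 0\<^sub>v d"
proof (rule ccontr)
  assume nz: "v \<noteq> 0\<^sub>v d"
  interpret group G by fact
  interpret K: normal K G by fact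
  note rep = irr_repD(1)[OF assms(2)]
  have Kc: "x \<in> carrier G" if "x \<in> K" for x using that K.subset by auto
  define W where "W = {w \<in> carrier_vec d. \<forall>x\<in>K. \<rho> x *\<^sub>v w = w}"
  have "is_subspace d W"
    unfolding is_subspace_def W_def
    using rep_carrier[OF rep Kc] 
    by (auto simp: mult_add_distrib_mat_vec[of _ d d] rep_smult[OF rep Kc])
  moreover have "\<rho> g *\<^sub>v w \<in> W" if g: "g \<in> carrier G" and w: "w \<in> W" for g w
  proof -
    have wc: "w \<in> carrier_vec d" using w by (simp add: W_def)
    have "\<rho> x *\<^sub>v (\<rho> g *\<^sub>v w) = \<rho> g *\<^sub>v w" if x: "x \<in> K" for x
    proof -
      have y: "inv g \<otimes> x \<otimes> g \<in> K" using K.inv_op_closed1[OF g x] .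
      have "x \<otimes> g = g \<otimes> (inv g \<otimes> x \<otimes> g)" using g Kc[OF x] by (simp add: m_assoc[symmetric])
      then have "\<rho> x *\<^sub>v (\<rho> g *\<^sub>v w) = \<rho> g *\<^sub>v (\<rho> (inv g \<otimes> x \<otimes> g) *\<^sub>v w)"
        using rep_mult[OF rep Kc[OF x] g wc] rep_mult[OF rep g Kc[OF y] wc] by simp
      then show ?thesis using w y by (simp add: W_def)
    qed
    then show ?thesis using rep g wc by (simp add: W_def)
  qed
  moreover have "v \<in> W" using v by (simp add: W_def)
  ultimately have "W = carrier_vec d" using irr_repD(3)[OF assms(2)] nz by blast
  then show False using assms(4-6) by (auto simp: W_def)
qed

section \<open>Weights separated by a normal subgroup, and monomial representations\<close>

definition transversal :: "('a, 'b) monoid_scheme \<Rightarrow> 'a set \<Rightarrow> 'a set \<Rightarrow> bool" where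
  "transversal G A R \<longleftrightarrow> R \<subseteq> carrier G \<and>
     (\<forall>g\<in>carrier G. \<exists>!r. r \<in> R \<and> inv\<^bsub>G\<^esub> r \<otimes>\<^bsub>G\<^esub> g \<in> A)"

text \<open>The equation \<open>x \<otimes> g = g \<otimes> y\<close> expresses conjugation by
  \<open>g\<close> without an inverse. The condition means that the stabilizer of the restriction of
  \<open>\<mu>\<close> to \<open>N\<close> is contained in \<open>A\<close>.\<close>

definition separated :: "('a, 'b) monoid_scheme \<Rightarrow> 'a set \<Rightarrow> 'a set \<Rightarrow> ('a \<Rightarrow> complex) \<Rightarrow> bool" where
  "separated G A N \<mu> \<longleftrightarrow>
     (\<forall>g\<in>carrier G - A. \<exists>x\<in>N. \<exists>y\<in>N. x \<otimes>\<^bsub>G\<^esub> g = g \<otimes>\<^bsub>G\<^esub> y \<and> \<mu> x \<noteq> \<mu> y)"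

text \<open>The element that separates at \<open>inv r \<otimes> s\<close>, conjugated back by
  \<open>r\<close>, is the witness. So the conjugates of \<open>\<mu>\<close> along different cosets
  of \<open>A\<close> are different on \<open>N\<close>.\<close>

lemma separated_cosets:
  fixes G (structure)
  assumes "group G" "N \<lhd> G" "separated G A N \<mu>" "r \<in> carrier G" "s \<in> carrier G" "inv r \<otimes> s \<notin> A"
  shows "\<exists>x\<in>N. \<mu> (inv r \<otimes> x \<otimes> r) \<noteq> \<mu> (inv s \<otimes> x \<otimes> s)"
proof -
  interpret group G by fact
  interpret N: normal N G by fact
  obtain x y where xy: "x \<in> N" "y \<in> N" "x \<otimes> (inv r \<otimes> s) = (inv r \<otimes> s) \<otimes> y" "\<mu> x \<noteq> \<mu> y"
    using assms(3-6) unfolding separated_def by blast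
  have c: "x \<in> carrier G" "y \<in> carrier G" using xy N.subset by auto
  have "inv r \<otimes> (r \<otimes> x \<otimes> inv r) \<otimes> r = x" using c assms(4) 
    by (simp add: m_assoc inv_solve_left')
  moreover have "inv s \<otimes> (r \<otimes> x \<otimes> inv r) \<otimes> s = y"
  proof -
    have "inv s \<otimes> (r \<otimes> x \<otimes> inv r) \<otimes> s = inv s \<otimes> r \<otimes> (x \<otimes> (inv r \<otimes> s))"
      using c assms(4,5) by (simp add: m_assoc)
    also have "\<dots> = inv s \<otimes> r \<otimes> ((inv r \<otimes> s) \<otimes> y)" using xy by simp
    also have "\<dots> = inv s \<otimes> (r \<otimes> inv r) \<otimes> s \<otimes> y" using c assms(4,5) by (simp only: m_assoc inv_closed m_closed)
    also have "\<dots> = y" using c assms(4,5) by simp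
    finally show ?thesis .
  qed
  moreover have "r \<otimes> x \<otimes> inv r \<in> N" using N.inv_op_closed2[OF assms(4) xy(1)] .
  ultimately show ?thesis using xy(4) by metis
qed

text \<open>As for eigenvectors with distinct eigenvalues: if \<open>x\<close> tells
  \<open>s\<close> from \<open>s0\<close>, then applying \<open>\<rho> x\<close> to the relation and
  subtracting \<open>\<omega> s0 x\<close> times the relation removes the term \<open>s0\<close> but
  not the term \<open>s\<close>.\<close>

lemma distinct_weights_independent:
  assumes rep: "is_rep G d \<rho>" and "N \<subseteq> carrier G"
    and v: "\<And>s. s \<in> S \<Longrightarrow> v s \<in> carrier_vec d" "\<And>s. s \<in> S \<Longrightarrow> v s \<noteq> 0\<^sub>v d"
    and eig: "\<And>s x. s \<in> S \<Longrightarrow> x \<in> N \<Longrightarrow> \<rho> x *\<^sub>v v s = \<omega> s x \<cdot>\<^sub>v v s"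
    and dist: "\<And>s t. s \<in> S \<Longrightarrow> t \<in> S \<Longrightarrow> s \<noteq> t \<Longrightarrow> \<exists>x\<in>N. \<omega> s x \<noteq> \<omega> t x"
    and "finite S" "vsum d S (\<lambda>s. c s \<cdot>\<^sub>v v s) = 0\<^sub>v d" "s \<in> S"
  shows "c s = 0"
  using assms(7,8,9) v eig dist
proof (induction S arbitrary: c s)
  case (insert s0 S)
  note vc = insert.prems(3)
  have comb: "c s0 \<cdot>\<^sub>v v s0 + vsum d S (\<lambda>s. c s \<cdot>\<^sub>v v s) = 0\<^sub>v d"
    using insert.hyps insert.prems(1) vc[of s0] by (simp add: vsum_insert)
  have comp: "c s0 * v s0 $ i + (\<Sum>s\<in>S. c s * v s $ i) = 0" if "i < d" for i
  proof -
    have "(c s0 \<cdot>\<^sub>v v s0 + vsum d S (\<lambda>s. c s \<cdot>\<^sub>v v s)) $ i = 0" using comb that by simp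
    moreover have "(\<Sum>s\<in>S. (c s \<cdot>\<^sub>v v s) $ i) = (\<Sum>s\<in>S. c s * v s $ i)"
      using vc that by (intro sum.cong) (auto simp: smult_vec_index[of _ d])
    ultimately show ?thesis using that vc[of s0] by (simp add: smult_vec_index[of _ d])
  qed
  have z: "c s = 0" if s: "s \<in> S" for s
  proof -
    have "s \<noteq> s0" using s insert.hyps by auto
    then obtain x where x: "x \<in> N" "\<omega> s x \<noteq> \<omega> s0 x"
      using insert.prems(6)[of s s0] s by auto
    have "vsum d S (\<lambda>s. (c s * (\<omega> s x - \<omega> s0 x)) \<cdot>\<^sub>v v s) = 0\<^sub>v d"
    proof (rule eq_vecI)
      fix i assume "i < dim_vec (0\<^sub>v d :: complex vec)"
      then have i: "i < d" by simp
      have xG: "x \<in> carrier G" using x assms(2) by auto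
      have "\<rho> x *\<^sub>v vsum d (insert s0 S) (\<lambda>s. c s \<cdot>\<^sub>v v s) = 0\<^sub>v d"
        using insert.prems(1) rep_carrier[OF rep xG] by simp
      moreover have "\<rho> x *\<^sub>v vsum d (insert s0 S) (\<lambda>s. c s \<cdot>\<^sub>v v s) =
          vsum d (insert s0 S) (\<lambda>s. (c s * \<omega> s x) \<cdot>\<^sub>v v s)"
        using insert.hyps vc insert.prems(5)[OF _ x(1)] rep_smult[OF rep xG]
        by (subst mult_mat_vsum[OF rep_carrier[OF rep xG]])
           (auto intro!: vsum_cong simp: smult_smult_assoc)
      ultimately have "vsum d (insert s0 S) (\<lambda>s. (c s * \<omega> s x) \<cdot>\<^sub>v v s) $ i = 0" using i by simp
      then have a: "c s0 * \<omega> s0 x * v s0 $ i + (\<Sum>s\<in>S. c s * \<omega> s x * v s $ i) = 0"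
        using i vc insert.hyps by (simp add: smult_vec_index[of _ d])
      have "(\<Sum>s\<in>S. c s * (\<omega> s x - \<omega> s0 x) * v s $ i) =
          (c s0 * \<omega> s0 x * v s0 $ i + (\<Sum>s\<in>S. c s * \<omega> s x * v s $ i)) -
          \<omega> s0 x * (c s0 * v s0 $ i + (\<Sum>s\<in>S. c s * v s $ i))"
        by (simp add: algebra_simps sum_subtractf sum_distrib_left)
      then have "(\<Sum>s\<in>S. c s * (\<omega> s x - \<omega> s0 x) * v s $ i) = 0" using a comp[OF i] by simp
      then show "vsum d S (\<lambda>s. (c s * (\<omega> s x - \<omega> s0 x)) \<cdot>\<^sub>v v s) $ i = 0\<^sub>v d $ i"
        using i vc by (simp add: smult_vec_index[of _ d])
    qed simp
    then have "c s * (\<omega> s x - \<omega> s0 x) = 0"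
      using insert.prems(3-6) s
      by (intro insert.IH[of "\<lambda>s. c s * (\<omega> s x - \<omega> s0 x)" s]) auto
    then show ?thesis using x by simp
  qed
  have "vsum d S (\<lambda>s. c s \<cdot>\<^sub>v v s) = 0\<^sub>v d"
    using z vc by (intro eq_vecI) (auto simp: smult_vec_index[of _ d])
  then have "c s0 \<cdot>\<^sub>v v s0 = 0\<^sub>v d" using comb vc[of s0] by simp
  then have "c s0 = 0" using smult_vec_zero_iff[OF vc[of s0]] insert.prems(4)[of s0] by auto
  then show ?case using z insert.prems(2) by auto
qed simp

text \<open>The translates \<open>w r\<close> of \<open>v\<close> form a basis. They are independent
  by their weights on \<open>N\<close>. Their span is invariant because \<open>g \<otimes> r\<close>
  is \<open>s \<otimes> a\<close> for a representative \<open>s\<close> and some \<open>a\<close> in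
  \<open>A\<close>, so that \<open>\<rho> g\<close> permutes the lines; irreducibility makes it the
  whole space.\<close>

theorem irr_rep_dim_eq_index:
  fixes G (structure)
  assumes G: "group G" "finite (carrier G)" and irr: "irr_rep G d \<rho>"
    and A: "subgroup A G" "transversal G A R" and N: "N \<lhd> G" "N \<subseteq> A" and sep: "separated G A N \<mu>"
    and v: "v \<in> carrier_vec d" "v \<noteq> 0\<^sub>v d" "\<And>a. a \<in> A \<Longrightarrow> \<rho> a *\<^sub>v v = \<mu> a \<cdot>\<^sub>v v"
  shows "d = card R"
proof -
  interpret group G by fact
  interpret N: normal N G by fact
  interpret A: subgroup A G by fact
  note rep = irr_repD(1)[OF irr]
  have R: "R \<subseteq> carrier G" and R1: "\<And>g. g \<in> carrier G \<Longrightarrow> \<exists>!r. r \<in> R \<and> inv r \<otimes> g \<in> A"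
    using A(2) by (auto simp: transversal_def)
  have finR: "finite R" using R G(2) finite_subset by blast
  define w where "w r = \<rho> r *\<^sub>v v" for r
  have wc: "w r \<in> carrier_vec d" if "r \<in> R" for r using that R rep v by (auto simp: w_def)
  have w0: "w r \<noteq> 0\<^sub>v d" if "r \<in> R" for r
  proof
    assume a: "w r = 0\<^sub>v d"
    have r: "r \<in> carrier G" using that R by auto
    have "v = \<rho> (inv r \<otimes> r) *\<^sub>v v" using r rep_one[OF rep v(1)] by simp
    also have "\<dots> = 0\<^sub>v d" using r rep_mult[OF rep _ r v(1), of "inv r"] a rep_carrier[OF rep] 
      by (simp add: w_def del: l_inv)
    finally show False using v by simp
  qed
  have eig: "\<rho> x *\<^sub>v w r = \<mu> (inv r \<otimes> x \<otimes> r) \<cdot>\<^sub>v w r" if "r \<in> R" "x \<in> N" for r x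
  proof -
    have c: "r \<in> carrier G" "x \<in> carrier G" using that R N.subset by auto
    have y: "inv r \<otimes> x \<otimes> r \<in> N" using N.inv_op_closed1[OF c(1) that(2)] .
    then have yA: "inv r \<otimes> x \<otimes> r \<in> A" using N(2) by auto
    have "x \<otimes> r = r \<otimes> (inv r \<otimes> x \<otimes> r)" using c by (simp add: m_assoc[symmetric])
    then have "\<rho> x *\<^sub>v w r = \<rho> r *\<^sub>v (\<rho> (inv r \<otimes> x \<otimes> r) *\<^sub>v v)"
      unfolding w_def using rep_mult[OF rep c(2,1) v(1)] rep_mult[OF rep c(1) _ v(1), of "inv r \<otimes> x \<otimes> r"] c
      by simp
    also have "\<dots> = \<mu> (inv r \<otimes> x \<otimes> r) \<cdot>\<^sub>v w r"
      using v(3)[OF yA] rep_smult[OF rep c(1) v(1)] by (simp add: w_def)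
    finally show ?thesis .
  qed
  have dist: "\<exists>x\<in>N. \<mu> (inv r \<otimes> x \<otimes> r) \<noteq> \<mu> (inv s \<otimes> x \<otimes> s)" if "r \<in> R" "s \<in> R" "r \<noteq> s" for r s
  proof -
    have c: "r \<in> carrier G" "s \<in> carrier G" using that R by auto
    have "inv s \<otimes> s \<in> A" using c by simp
    then have "inv r \<otimes> s \<notin> A" using R1[OF c(2)] that by blast
    then show ?thesis by (rule separated_cosets[OF G(1) N(1) sep c])
  qed
  note Nc = N.subset
  have indep: "c s = 0" if "vsum d R (\<lambda>s. c s \<cdot>\<^sub>v w s) = 0\<^sub>v d" "s \<in> R" for c s
    by (rule distinct_weights_independent[OF rep Nc wc w0 eig dist finR that])
  \<comment> \<open>The basis will be the image of \<open>R\<close> under \<open>w\<close>, whose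
    cardinality must be that of \<open>R\<close>. Two equal translates would give a relation with
    coefficients 1 and -1.\<close>
  have inj: "inj_on w R"
  proof (rule inj_onI, rule ccontr)
    fix r s assume rs: "r \<in> R" "s \<in> R" "w r = w s" "r \<noteq> s"
    let ?c = "\<lambda>x. if x = r then 1 else if x = s then -1 else (0::complex)"
    have "vsum d R (\<lambda>s. ?c s \<cdot>\<^sub>v w s) = 0\<^sub>v d"
    proof (rule eq_vecI)
      fix i assume "i < dim_vec (0\<^sub>v d :: complex vec)"
      then have i: "i < d" by simp
      have "vsum d R (\<lambda>s. ?c s \<cdot>\<^sub>v w s) $ i = (\<Sum>x\<in>R. ?c x * w x $ i)"
        using i wc by (auto simp: smult_vec_index[of _ d] intro!: sum.cong)
      also have "\<dots> = (\<Sum>x\<in>{r,s}. ?c x * w x $ i)"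
        using rs(1,2) finR by (intro sum.mono_neutral_right) auto
      also have "\<dots> = 0" using rs(3,4) by simp
      finally show "vsum d R (\<lambda>s. ?c s \<cdot>\<^sub>v w s) $ i = 0\<^sub>v d $ i" using i by simp
    qed simp
    from indep[OF this rs(1)] show False by simp
  qed
  define W where "W = {vsum d R (\<lambda>s. c s \<cdot>\<^sub>v w s) | c. True}"
  have WI: "vsum d R (\<lambda>s. c s \<cdot>\<^sub>v w s) \<in> W" for c by (auto simp: W_def)
  have W: "is_subspace d W"
    unfolding is_subspace_def
  proof (intro conjI ballI allI)
    show "W \<subseteq> carrier_vec d" by (auto simp: W_def)
    have "0\<^sub>v d = vsum d R (\<lambda>s. 0 \<cdot>\<^sub>v w s)" using wc
      by (intro eq_vecI) (auto simp: smult_vec_index[of _ d])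
    then show "0\<^sub>v d \<in> W" by (simp only: WI)
  next
    fix x y assume "x \<in> W" "y \<in> W"
    then obtain a b where ab: "x = vsum d R (\<lambda>s. a s \<cdot>\<^sub>v w s)" "y = vsum d R (\<lambda>s. b s \<cdot>\<^sub>v w s)"
      by (auto simp: W_def)
    have "x + y = vsum d R (\<lambda>s. (a s + b s) \<cdot>\<^sub>v w s)" using wc unfolding ab
      by (intro eq_vecI) (auto simp: smult_vec_index[of _ d] algebra_simps sum.distrib)
    then show "x + y \<in> W" by (simp only: WI)
  next
    fix k x assume "x \<in> W"
    then obtain a where a: "x = vsum d R (\<lambda>s. a s \<cdot>\<^sub>v w s)" by (auto simp: W_def)
    have "k \<cdot>\<^sub>v x = vsum d R (\<lambda>s. (k * a s) \<cdot>\<^sub>v w s)" using wc unfolding a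
      by (subst vsum_smult) (auto simp: smult_smult_assoc)
    then show "k \<cdot>\<^sub>v x \<in> W" by (simp only: WI)
  qed
  have wW: "w r \<in> W" if r: "r \<in> R" for r
  proof -
    have "w r = vsum d R (\<lambda>s. (if s = r then 1 else 0) \<cdot>\<^sub>v w s)"
    proof (rule eq_vecI)
      fix i assume "i < dim_vec (vsum d R (\<lambda>s. (if s = r then 1 else 0) \<cdot>\<^sub>v w s))"
      then have i: "i < d" by simp
      have "vsum d R (\<lambda>s. (if s = r then 1 else 0) \<cdot>\<^sub>v w s) $ i = (\<Sum>s\<in>R. if s = r then w s $ i else 0)"
        using i wc by (auto simp: smult_vec_index[of _ d] intro!: sum.cong)
      then show "w r $ i = vsum d R (\<lambda>s. (if s = r then 1 else 0) \<cdot>\<^sub>v w s) $ i"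
        using finR r by simp
    qed (use wc[OF r] in auto)
    then show ?thesis by (metis WI)
  qed
  have inv: "\<rho> g *\<^sub>v x \<in> W" if g: "g \<in> carrier G" and x: "x \<in> W" for g x
  proof -
    obtain a where a: "x = vsum d R (\<lambda>s. a s \<cdot>\<^sub>v w s)" using x by (auto simp: W_def)
    have gw: "\<rho> g *\<^sub>v w r \<in> W" if r: "r \<in> R" for r
    proof -
      have rc: "r \<in> carrier G" using r R by auto
      obtain s where s: "s \<in> R" "inv s \<otimes> (g \<otimes> r) \<in> A" using R1[of "g \<otimes> r"] g rc by blast
      have sc: "s \<in> carrier G" using s R by auto
      have "g \<otimes> r = s \<otimes> (inv s \<otimes> (g \<otimes> r))" using g rc sc by (simp add: m_assoc[symmetric])
      then have "\<rho> g *\<^sub>v w r = \<rho> s *\<^sub>v (\<rho> (inv s \<otimes> (g \<otimes> r)) *\<^sub>v v)"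
        unfolding w_def using rep_mult[OF rep g rc v(1)] rep_mult[OF rep sc _ v(1), of "inv s \<otimes> (g \<otimes> r)"] g rc sc
        by simp
      also have "\<dots> = \<mu> (inv s \<otimes> (g \<otimes> r)) \<cdot>\<^sub>v w s"
        using v(3)[OF s(2)] rep_smult[OF rep sc v(1)] by (simp add: w_def)
      finally show ?thesis using is_subspaceD(4)[OF W] wW[OF s(1)] by simp
    qed
    have "\<rho> g *\<^sub>v x = vsum d R (\<lambda>s. a s \<cdot>\<^sub>v (\<rho> g *\<^sub>v w s))"
      unfolding a using wc finR
      by (subst mult_mat_vsum[OF rep_carrier[OF rep g]]) (auto intro!: vsum_cong simp: rep_smult[OF rep g])
    then show ?thesis using gw is_subspaceD(4)[OF W] by (auto intro!: subspace_vsum[OF W finR])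
  qed
  obtain r0 where r0: "r0 \<in> R" using R1[OF one_closed] by blast
  have full: "W = carrier_vec d" by (rule irr_repD(3)[OF irr W inv wW[OF r0] w0[OF r0]])
  interpret V: vec_space "TYPE(complex)" d .
  have wRc: "w ` R \<subseteq> carrier_vec d" using wc by auto
  have lin: "V.lincomb b (w ` R) = vsum d R (\<lambda>s. b (w s) \<cdot>\<^sub>v w s)" for b
  proof (rule eq_vecI)
    fix i assume "i < dim_vec (vsum d R (\<lambda>s. b (w s) \<cdot>\<^sub>v w s))"
    then have i: "i < d" by simp
    show "V.lincomb b (w ` R) $ i = vsum d R (\<lambda>s. b (w s) \<cdot>\<^sub>v w s) $ i"
      using i wc by (subst V.lincomb_index[OF i wRc]) (auto simp: sum.reindex[OF inj] smult_vec_index[of _ d])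
  qed (use finR wRc V.lincomb_dim in auto)
  have "V.lin_indpt (w ` R)"
  proof (rule V.finite_lin_indpt2)
    fix b assume "V.lincomb b (w ` R) = 0\<^sub>v d"
    then have "vsum d R (\<lambda>s. b (w s) \<cdot>\<^sub>v w s) = 0\<^sub>v d" by (simp add: lin)
    from indep[OF this] show "\<forall>v\<in>w ` R. b v = 0" by auto
  qed (use finR wRc in auto)
  moreover have "V.span (w ` R) = carrier_vec d"
  proof
    show "V.span (w ` R) \<subseteq> carrier_vec d" using V.span_is_subset2[of "w ` R"] wRc by auto
    show "carrier_vec d \<subseteq> V.span (w ` R)"
    proof
      fix x :: "complex vec" assume "x \<in> carrier_vec d"
      then obtain a where a: "x = vsum d R (\<lambda>s. a s \<cdot>\<^sub>v w s)" using full by (auto simp: W_def)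
      have "x = V.lincomb (\<lambda>u. a (the_inv_into R w u)) (w ` R)"
        unfolding a lin by (intro vsum_cong) (simp add: the_inv_into_f_f[OF inj])
      then show "x \<in> V.span (w ` R)"
        unfolding V.span_def using finR by (auto simp: class_ring_simps)
    qed
  qed
  ultimately have "V.basis (w ` R)" using wRc by (simp add: V.basis_def)
  then have "d = card (w ` R)" using V.dim_basis finR V.dim_is_n by simp
  then show ?thesis using card_image[OF inj] by simp
qed

lemma transversal_unique:
  fixes G (structure)
  assumes "transversal G A R" "r \<in> R" "s \<in> R" "g \<in> carrier G" "inv r \<otimes> g \<in> A" "inv s \<otimes> g \<in> A"
  shows "r = s"
  using assms unfolding transversal_def by blast

text \<open>The induced representation, written in monomial matrices. \<open>N\<close> acts
  diagonally, and by \<open>separated_cosets\<close> the diagonal characters are pairwise different.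
  A common eigenvector of \<open>N\<close> in an invariant subspace is therefore a multiple of a
  unit vector, and \<open>G\<close> carries it to all the others.\<close>

theorem induced_irr_rep:
  fixes G (structure)
  assumes G: "group G" "finite (carrier G)"
    and A: "subgroup A G" "transversal G A R" and N: "N \<lhd> G" "N \<subseteq> A" and sep: "separated G A N \<mu>"
    and \<mu>1: "\<mu> \<one> = 1" and \<mu>m: "\<And>a b. a \<in> A \<Longrightarrow> b \<in> A \<Longrightarrow> \<mu> (a \<otimes> b) = \<mu> a * \<mu> b"
  shows "\<exists>\<rho>. irr_rep G (card R) \<rho>"
proof -
  interpret group G by fact
  interpret N: normal N G by fact
  interpret A: subgroup A G by fact
  have R: "R \<subseteq> carrier G" and R1: "\<And>g. g \<in> carrier G \<Longrightarrow> \<exists>!r. r \<in> R \<and> inv r \<otimes> g \<in> A"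
    using A(2) by (auto simp: transversal_def)
  have finR: "finite R" using R G(2) finite_subset by blast
  define k where "k = card R"
  obtain rs where rs: "bij_betw rs {0..<k} R" using ex_bij_betw_nat_finite[OF finR] k_def by auto
  have rsR: "rs i \<in> R" if "i < k" for i using rs that by (auto simp: bij_betw_def)
  then have rsc: "rs i \<in> carrier G" if "i < k" for i using that R by auto
  have rs_eq: "i = j" if "i < k" "j < k" "inv (rs i) \<otimes> rs j \<in> A" for i j
  proof -
    have "rs i = rs j" using that rsc[of j] rsR
      by (intro transversal_unique[OF A(2), of _ _ "rs j"]) auto
    then show ?thesis using rs that by (auto simp: bij_betw_def inj_on_def)
  qed
  \<comment> \<open>Extension by zero: column \<open>j\<close> of \<open>\<rho> g\<close> can be
    nonzero only in the row whose coset contains \<open>g \<otimes> rs j\<close>.\<close>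
  define m where "m x = (if x \<in> A then \<mu> x else 0)" for x
  have m_mult: "m (x \<otimes> a) = m x * \<mu> a" if "x \<in> carrier G" "a \<in> A" for x a
  proof -
    have "x \<otimes> a \<in> A \<longleftrightarrow> x \<in> A"
    proof
      assume "x \<otimes> a \<in> A"
      then have "x \<otimes> a \<otimes> inv a \<in> A" by (rule A.m_closed[OF _ A.m_inv_closed[OF that(2)]])
      then show "x \<in> A" using that A.mem_carrier[OF that(2)] by (simp add: m_assoc)
    qed (use that in auto)
    then show ?thesis using that \<mu>m by (auto simp: m_def)
  qed
  define \<rho> where "\<rho> g = mat k k (\<lambda>(i, j). m (inv (rs i) \<otimes> g \<otimes> rs j))" for g
  have rep: "is_rep G k \<rho>"
    unfolding is_rep_def
  proof (intro conjI ballI)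
    show "\<rho> \<one> = 1\<^sub>m k"
    proof (rule eq_matI)
      fix i j assume ij: "i < dim_row (1\<^sub>m k :: complex mat)" "j < dim_col (1\<^sub>m k :: complex mat)"
      have "m (inv (rs i) \<otimes> rs j) = (if i = j then 1 else 0)"
      proof (cases "i = j")
        case True
        then show ?thesis using ij rsc[of i] \<mu>1 by (simp add: m_def)
      next
        case False
        then show ?thesis using rs_eq[of i j] ij by (auto simp: m_def)
      qed
      then show "\<rho> \<one> $$ (i, j) = 1\<^sub>m k $$ (i, j)"
        using ij rsc[of i] by (simp add: \<rho>_def)
    qed (auto simp: \<rho>_def)
  next
    fix g h assume g: "g \<in> carrier G" and h: "h \<in> carrier G"
    show "\<rho> (g \<otimes> h) = \<rho> g * \<rho> h"
    proof (rule eq_matI)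
      fix i l assume "i < dim_row (\<rho> g * \<rho> h)" "l < dim_col (\<rho> g * \<rho> h)"
      then have il: "i < k" "l < k" by (auto simp: \<rho>_def)
      note ci = rsc[OF il(1)] note cl = rsc[OF il(2)]
      obtain r where r: "r \<in> R" "inv r \<otimes> (h \<otimes> rs l) \<in> A" using R1[of "h \<otimes> rs l"] h cl by blast
      obtain j where j: "j < k" "r = rs j" using r rs by (auto simp: bij_betw_def)
      note cj = rsc[OF j(1)]
      have ja: "inv (rs j) \<otimes> h \<otimes> rs l \<in> A" using r j h cl cj by (simp add: m_assoc)
      have z: "m (inv (rs j') \<otimes> h \<otimes> rs l) = 0" if "j' < k" "j' \<noteq> j" for j'
      proof -
        have "inv (rs j') \<otimes> h \<otimes> rs l \<notin> A"
        proof
          assume "inv (rs j') \<otimes> h \<otimes> rs l \<in> A"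
          then have "inv (rs j') \<otimes> (h \<otimes> rs l) \<in> A" using rsc[OF that(1)] h cl by (simp add: m_assoc)
          then have "rs j' = rs j"
            using transversal_unique[OF A(2) rsR[OF that(1)] r(1), of "h \<otimes> rs l"] r j h cl by auto
          then show False using that j rs by (auto simp: bij_betw_def inj_on_def)
        qed
        then show ?thesis by (simp add: m_def)
      qed
      have "(\<rho> g * \<rho> h) $$ (i, l) = (\<Sum>j'\<in>{0..<k}. m (inv (rs i) \<otimes> g \<otimes> rs j') * m (inv (rs j') \<otimes> h \<otimes> rs l))"
        using il by (simp add: \<rho>_def scalar_prod_def)
      also have "\<dots> = (\<Sum>j'\<in>{j}. m (inv (rs i) \<otimes> g \<otimes> rs j') * m (inv (rs j') \<otimes> h \<otimes> rs l))"
        using z j by (intro sum.mono_neutral_right) auto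
      also have "\<dots> = m (inv (rs i) \<otimes> g \<otimes> rs j) * \<mu> (inv (rs j) \<otimes> h \<otimes> rs l)" using ja by (simp add: m_def)
      also have "\<dots> = m (inv (rs i) \<otimes> g \<otimes> rs j \<otimes> (inv (rs j) \<otimes> h \<otimes> rs l))"
        using m_mult[OF _ ja] g ci cj by simp
      also have "inv (rs i) \<otimes> g \<otimes> rs j \<otimes> (inv (rs j) \<otimes> h \<otimes> rs l) = inv (rs i) \<otimes> g \<otimes> (rs j \<otimes> inv (rs j)) \<otimes> h \<otimes> rs l"
        using g h ci cj cl by (simp only: m_assoc inv_closed m_closed)
      also have "\<dots> = inv (rs i) \<otimes> (g \<otimes> h) \<otimes> rs l" using g h ci cj cl by (simp add: m_assoc)
      finally show "\<rho> (g \<otimes> h) $$ (i, l) = (\<rho> g * \<rho> h) $$ (i, l)" using il by (simp add: \<rho>_def)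
    qed (auto simp: \<rho>_def)
  qed (simp add: \<rho>_def)
  have kpos: "k > 0" unfolding k_def using R1[OF one_closed] finR by (auto simp: card_gt_0_iff)
  have diag: "(\<rho> x *\<^sub>v v) $ i = \<mu> (inv (rs i) \<otimes> x \<otimes> rs i) * v $ i"
    if "x \<in> N" "i < k" "v \<in> carrier_vec k" for x i v
  proof -
    have xc: "x \<in> carrier G" using that N.subset by auto
    have d0: "m (inv (rs i) \<otimes> x \<otimes> rs j) = 0" if "j < k" "j \<noteq> i" for j
    proof -
      have "inv (rs i) \<otimes> x \<otimes> rs j \<notin> A"
      proof
        assume a: "inv (rs i) \<otimes> x \<otimes> rs j \<in> A"
        have ci: "rs i \<in> carrier G" "rs j \<in> carrier G" using rsc that \<open>i < k\<close> by auto
        have "inv (inv (rs i) \<otimes> x \<otimes> rs i) \<in> A"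
          using N(2) N.inv_op_closed1[OF ci(1) \<open>x \<in> N\<close>] by auto
        then have "inv (inv (rs i) \<otimes> x \<otimes> rs i) \<otimes> (inv (rs i) \<otimes> x \<otimes> rs j) \<in> A" using a by simp
        moreover have "inv (inv (rs i) \<otimes> x \<otimes> rs i) \<otimes> (inv (rs i) \<otimes> x \<otimes> rs j) = inv (rs i) \<otimes> rs j"
        proof -
          have "(inv (rs i) \<otimes> x \<otimes> rs i) \<otimes> (inv (rs i) \<otimes> rs j) = inv (rs i) \<otimes> x \<otimes> (rs i \<otimes> inv (rs i)) \<otimes> rs j"
            using ci xc by (simp only: m_assoc inv_closed m_closed)
          also have "\<dots> = inv (rs i) \<otimes> x \<otimes> rs j" using ci xc by simp
          finally show ?thesis using ci xc by (metis inv_closed inv_solve_left m_closed)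
        qed
        ultimately show False using rs_eq[of i j] that \<open>i < k\<close> by auto
      qed
      then show ?thesis by (simp add: m_def)
    qed
    have "(\<rho> x *\<^sub>v v) $ i = (\<Sum>j\<in>{0..<k}. m (inv (rs i) \<otimes> x \<otimes> rs j) * v $ j)"
      using that by (simp add: \<rho>_def scalar_prod_def)
    also have "\<dots> = (\<Sum>j\<in>{i}. m (inv (rs i) \<otimes> x \<otimes> rs j) * v $ j)"
      using d0 that by (intro sum.mono_neutral_right) auto
    finally show ?thesis
      using N(2) N.inv_op_closed1[OF rsc[OF that(2)] that(1)] by (auto simp: m_def)
  qed
  have "W = carrier_vec k" if W: "is_subspace k W" "\<forall>g\<in>carrier G. \<forall>w\<in>W. \<rho> g *\<^sub>v w \<in> W" "W \<noteq> {0\<^sub>v k}" for W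
  proof -
    have Wc: "w \<in> carrier_vec k" if "w \<in> W" for w using that is_subspaceD(1)[OF W(1)] by auto
    have "\<exists>v\<in>W. v \<noteq> 0\<^sub>v k \<and> (\<forall>x\<in>N. \<exists>c. \<rho> x *\<^sub>v v = c \<cdot>\<^sub>v v)"
    proof (rule common_eigenvector[OF G rep _ N.subset W(1,3)])
      show "finite N" using N.subset G(2) finite_subset by blast
      show "\<rho> s *\<^sub>v v \<in> W" if "s \<in> N" "v \<in> W" for s v using W(2) that N.subset by auto
      fix s t v assume st: "s \<in> N" "t \<in> N" "v \<in> W"
      have c: "\<rho> s *\<^sub>v v \<in> carrier_vec k" "\<rho> t *\<^sub>v v \<in> carrier_vec k"
        using st N.subset Wc rep by auto
      show "\<rho> s *\<^sub>v (\<rho> t *\<^sub>v v) = \<rho> t *\<^sub>v (\<rho> s *\<^sub>v v)"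
      proof (rule eq_vecI)
        fix i assume "i < dim_vec (\<rho> t *\<^sub>v (\<rho> s *\<^sub>v v))"
        then have i: "i < k" by (simp add: \<rho>_def)
        show "(\<rho> s *\<^sub>v (\<rho> t *\<^sub>v v)) $ i = (\<rho> t *\<^sub>v (\<rho> s *\<^sub>v v)) $ i"
          using diag[OF st(1) i c(2)] diag[OF st(2) i c(1)] diag[OF st(1) i Wc[OF st(3)]]
            diag[OF st(2) i Wc[OF st(3)]] by simp
      qed (simp add: \<rho>_def)
    qed
    then obtain v where v: "v \<in> W" "v \<noteq> 0\<^sub>v k" "\<And>x. x \<in> N \<Longrightarrow> \<exists>c. \<rho> x *\<^sub>v v = c \<cdot>\<^sub>v v" by blast
    obtain i where i: "i < k" "v $ i \<noteq> 0" using v Wc[OF v(1)] by (auto simp: vec_eq_iff)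
    \<comment> \<open>Two nonzero coordinates of an eigenvector would force two diagonal characters
      of \<open>N\<close> to agree.\<close>
    have vj: "v $ j = 0" if j: "j < k" "j \<noteq> i" for j
    proof (rule ccontr)
      assume nz: "v $ j \<noteq> 0"
      have "inv (rs i) \<otimes> rs j \<notin> A" using rs_eq[OF i(1) j(1)] j by auto
      from separated_cosets[OF G(1) N(1) sep rsc[OF i(1)] rsc[OF j(1)] this]
      obtain x where x: "x \<in> N" "\<mu> (inv (rs i) \<otimes> x \<otimes> rs i) \<noteq> \<mu> (inv (rs j) \<otimes> x \<otimes> rs j)" by blast
      obtain c where c: "\<rho> x *\<^sub>v v = c \<cdot>\<^sub>v v" using v(3)[OF x(1)] by blast
      have "\<mu> (inv (rs i) \<otimes> x \<otimes> rs i) = c" "\<mu> (inv (rs j) \<otimes> x \<otimes> rs j) = c"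
        using diag[OF x(1) i(1) Wc[OF v(1)]] diag[OF x(1) j(1) Wc[OF v(1)]] c i j nz Wc[OF v(1)]
        by (auto simp: smult_vec_index[of _ k])
      then show False using x(2) by simp
    qed
    have "unit_vec k i = inverse (v $ i) \<cdot>\<^sub>v v"
      using i vj Wc[OF v(1)] by (intro eq_vecI) (auto simp: smult_vec_index[of _ k] unit_vec_def)
    then have ei: "unit_vec k i \<in> W" using is_subspaceD(4)[OF W(1) v(1)] by simp
    have ej: "unit_vec k j \<in> W" if j: "j < k" for j
    proof -
      note cc = rsc[OF i(1)] rsc[OF j]
      \<comment> \<open>Because \<open>\<mu> \<one> = 1\<close>, the unit vectors are carried to
        each other without a scalar factor.\<close>
      have "\<rho> (rs j \<otimes> inv (rs i)) *\<^sub>v unit_vec k i = unit_vec k j"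
      proof (rule eq_vecI)
        fix l assume "l < dim_vec (unit_vec k j :: complex vec)"
        then have l: "l < k" by simp
        have "(\<rho> (rs j \<otimes> inv (rs i)) *\<^sub>v unit_vec k i) $ l = m (inv (rs l) \<otimes> (rs j \<otimes> inv (rs i)) \<otimes> rs i)"
          using i l by (simp add: \<rho>_def scalar_prod_right_unit)
        also have "inv (rs l) \<otimes> (rs j \<otimes> inv (rs i)) \<otimes> rs i = inv (rs l) \<otimes> rs j"
          using cc rsc[OF l] by (simp add: m_assoc)
        also have "m (inv (rs l) \<otimes> rs j) = (if l = j then 1 else 0)"
          using rs_eq[OF l j] cc \<mu>1 by (auto simp: m_def)
        finally show "(\<rho> (rs j \<otimes> inv (rs i)) *\<^sub>v unit_vec k i) $ l = unit_vec k j $ l"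
          using l j by simp
      qed (simp add: \<rho>_def)
      then show ?thesis using W(2) ei cc by (metis inv_closed m_closed)
    qed
    have "x \<in> W" if x: "x \<in> carrier_vec k" for x
    proof -
      have "x = vsum k {..<k} (\<lambda>j. x $ j \<cdot>\<^sub>v unit_vec k j)"
      proof (rule eq_vecI)
        fix i assume "i < dim_vec (vsum k {..<k} (\<lambda>j. x $ j \<cdot>\<^sub>v unit_vec k j))"
        then have i: "i < k" by simp
        have "(\<Sum>j<k. (x $ j \<cdot>\<^sub>v unit_vec k j) $ i) = (\<Sum>j<k. if j = i then x $ j else 0)"
          using i by (intro sum.cong) auto
        then show "x $ i = vsum k {..<k} (\<lambda>j. x $ j \<cdot>\<^sub>v unit_vec k j) $ i" using i by simp
      qed (use x in simp)
      moreover have "vsum k {..<k} (\<lambda>j. x $ j \<cdot>\<^sub>v unit_vec k j) \<in> W"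
        using ej is_subspaceD(4)[OF W(1)] by (intro subspace_vsum[OF W(1)]) auto
      ultimately show ?thesis by simp
    qed
    then show ?thesis using Wc by blast
  qed
  then have "irr_rep G k \<rho>" using rep kpos unfolding irr_rep_def by blast
  then show ?thesis using k_def by blast
qed

section \<open>Transport along isomorphisms\<close>

lemma lower_central_subset:
  assumes "group G"
  shows "lower_central G c \<subseteq> carrier G"
proof (induction c)
  case (Suc c)
  interpret group G by fact
  show ?case using Suc by (auto intro!: generate_incl)
qed simp

text \<open>Quotient maps and isomorphisms are both surjective homomorphisms; this serves
  \<open>nilpotent_quotient_iff\<close> and \<open>fitting_chain_iso\<close> alike.\<close>

lemma lower_central_img:
  assumes "group_hom K Q f" "f ` carrier K = carrier Q"
  shows "lower_central Q c = f ` lower_central K c"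
proof (induction c)
  case (Suc c)
  interpret group_hom K Q f by fact
  have sub: "lower_central K c \<subseteq> carrier K" by (rule lower_central_subset) (rule G.is_group)
  let ?C = "{x \<otimes>\<^bsub>K\<^esub> y \<otimes>\<^bsub>K\<^esub> inv\<^bsub>K\<^esub> x \<otimes>\<^bsub>K\<^esub> inv\<^bsub>K\<^esub> y | x y. x \<in> lower_central K c \<and> y \<in> carrier K}"
  have C: "?C \<subseteq> carrier K" using sub by auto
  have im: "f (x \<otimes>\<^bsub>K\<^esub> y \<otimes>\<^bsub>K\<^esub> inv\<^bsub>K\<^esub> x \<otimes>\<^bsub>K\<^esub> inv\<^bsub>K\<^esub> y) =
      f x \<otimes>\<^bsub>Q\<^esub> f y \<otimes>\<^bsub>Q\<^esub> inv\<^bsub>Q\<^esub> f x \<otimes>\<^bsub>Q\<^esub> inv\<^bsub>Q\<^esub> f y"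
    if "x \<in> lower_central K c" "y \<in> carrier K" for x y using that sub by auto
  have "{x \<otimes>\<^bsub>Q\<^esub> y \<otimes>\<^bsub>Q\<^esub> inv\<^bsub>Q\<^esub> x \<otimes>\<^bsub>Q\<^esub> inv\<^bsub>Q\<^esub> y | x y. x \<in> f ` lower_central K c \<and> y \<in> f ` carrier K} = f ` ?C"
    (is "?D = _")
  proof (intro equalityI subsetI)
    fix u assume "u \<in> ?D"
    then obtain x y where xy: "x \<in> lower_central K c" "y \<in> carrier K"
      "u = f x \<otimes>\<^bsub>Q\<^esub> f y \<otimes>\<^bsub>Q\<^esub> inv\<^bsub>Q\<^esub> f x \<otimes>\<^bsub>Q\<^esub> inv\<^bsub>Q\<^esub> f y" by auto
    then show "u \<in> f ` ?C" using im[OF xy(1,2)] by (intro image_eqI[of _ f]) auto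
  next
    fix u assume "u \<in> f ` ?C"
    then obtain x y where xy: "x \<in> lower_central K c" "y \<in> carrier K"
      "u = f (x \<otimes>\<^bsub>K\<^esub> y \<otimes>\<^bsub>K\<^esub> inv\<^bsub>K\<^esub> x \<otimes>\<^bsub>K\<^esub> inv\<^bsub>K\<^esub> y)" by auto
    then show "u \<in> ?D" using im[OF xy(1,2)] by auto
  qed
  then show ?case using Suc assms(2) generate_img[OF C] by simp
qed (use assms in simp)

text \<open>The image of a term of the series in the quotient is trivial exactly when that term lies
  in \<open>L\<close>. This removes cosets from the Fitting height, so that everything can be
  computed with elements of \<open>G\<close>.\<close>

lemma nilpotent_quotient_iff:
  assumes "group G" "subgroup K G" "L \<lhd> G" "L \<subseteq> K"
  shows "nilpotent ((G\<lparr>carrier := K\<rparr>) Mod L) \<longleftrightarrow> (\<exists>c. lower_central (G\<lparr>carrier := K\<rparr>) c \<subseteq> L)"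
proof -
  interpret G: group G by fact
  let ?K = "G\<lparr>carrier := K\<rparr>"
  have L: "L \<lhd> ?K" using G.normal_restrict_supergroup assms by blast
  interpret K: group ?K using G.subgroup_imp_group assms by blast
  interpret L: normal L ?K by (rule L)
  have hom: "group_hom ?K (?K Mod L) (\<lambda>a. L #>\<^bsub>?K\<^esub> a)"
    using L.r_coset_hom_Mod L.factorgroup_is_group K.is_group
    by (simp add: group_hom_def group_hom_axioms_def)
  have surj: "(\<lambda>a. L #>\<^bsub>?K\<^esub> a) ` carrier ?K = carrier (?K Mod L)"
    unfolding FactGroup_def RCOSETS_def by auto
  have "lower_central (?K Mod L) c = {\<one>\<^bsub>?K Mod L\<^esub>} \<longleftrightarrow> lower_central ?K c \<subseteq> L" for c
  proof -
    have one: "\<one>\<^bsub>?K\<^esub> \<in> lower_central ?K c" using K.one_closed generate.one[of ?K] by (cases c) auto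
    have mem: "L #>\<^bsub>?K\<^esub> x = L \<longleftrightarrow> x \<in> L" if "x \<in> carrier ?K" for x
      using K.coset_join1[OF _ that L.subgroup_axioms] K.coset_join2[OF that L.subgroup_axioms] by auto
    have "(\<lambda>a. L #>\<^bsub>?K\<^esub> a) ` lower_central ?K c = {L} \<longleftrightarrow> (\<forall>x\<in>lower_central ?K c. L #>\<^bsub>?K\<^esub> x = L)"
      using one by blast
    also have "\<dots> \<longleftrightarrow> lower_central ?K c \<subseteq> L"
      using mem lower_central_subset[OF K.is_group, of c] by blast
    finally show ?thesis using lower_central_img[OF hom surj, of c] by (simp add: FactGroup_def)
  qed
  then show ?thesis by (simp add: nilpotent_def)
qed

text \<open>The chains of \<open>fitting_height\<close>, with the nilpotent quotients replaced by
  the criterion of \<open>nilpotent_quotient_iff\<close>.\<close>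

definition fitting_chain :: "('a, 'b) monoid_scheme \<Rightarrow> nat \<Rightarrow> (nat \<Rightarrow> 'a set) \<Rightarrow> bool" where
  "fitting_chain G h F \<longleftrightarrow> F 0 = {\<one>\<^bsub>G\<^esub>} \<and> F h = carrier G \<and> (\<forall>i\<le>h. F i \<lhd> G) \<and>
     (\<forall>i<h. F i \<subseteq> F (Suc i) \<and> (\<exists>c. lower_central (G\<lparr>carrier := F (Suc i)\<rparr>) c \<subseteq> F i))"

lemma fitting_height_eq:
  assumes "group G"
  shows "fitting_height G = (LEAST h. \<exists>F. fitting_chain G h F)"
proof -
  have *: "(\<forall>i \<le> h. F i \<lhd> G) \<and>
     (\<forall>i < h. F i \<subseteq> F (Suc i) \<and> nilpotent ((G\<lparr>carrier := F (Suc i)\<rparr>) Mod (F i))) \<longleftrightarrow>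
     (\<forall>i\<le>h. F i \<lhd> G) \<and>
     (\<forall>i<h. F i \<subseteq> F (Suc i) \<and> (\<exists>c. lower_central (G\<lparr>carrier := F (Suc i)\<rparr>) c \<subseteq> F i))"
    for h and F :: "nat \<Rightarrow> 'a set"
  proof (intro conj_cong refl all_cong imp_cong)
    fix i assume N: "\<forall>i\<le>h. F i \<lhd> G" and "i < h" and sub: "F i \<subseteq> F (Suc i)"
    then show "nilpotent ((G\<lparr>carrier := F (Suc i)\<rparr>) Mod (F i)) \<longleftrightarrow> (\<exists>c. lower_central (G\<lparr>carrier := F (Suc i)\<rparr>) c \<subseteq> F i)"
      using nilpotent_quotient_iff[OF assms normal_imp_subgroup _ sub] by simp
  qed
  show ?thesis unfolding fitting_height_def fitting_chain_def * ..
qed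

lemma fitting_chain_iso:
  assumes G: "group G" "group H" "f \<in> iso G H" and F: "fitting_chain G h F"
  shows "fitting_chain H h (\<lambda>i. f ` F i)"
proof -
  have hom: "group_hom G H f" using G by (simp add: group_hom_def group_hom_axioms_def iso_def)
  interpret group_hom G H f by (rule hom)
  have im: "f ` carrier G = carrier H" using G by (simp add: iso_def bij_betw_def)
  have "lower_central (H\<lparr>carrier := f ` K\<rparr>) c = f ` lower_central (G\<lparr>carrier := K\<rparr>) c" if K: "K \<lhd> G" for K c
  proof (rule lower_central_img)
    have sub: "subgroup K G" by (rule normal_imp_subgroup[OF K])
    then have "subgroup (f ` K) H" by (rule subgroup_img_is_subgroup)
    then show "group_hom (G\<lparr>carrier := K\<rparr>) (H\<lparr>carrier := f ` K\<rparr>) f"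
      using sub G.subgroup_imp_group H.subgroup_imp_group subgroup.mem_carrier[OF sub]
      by (auto simp: group_hom_def group_hom_axioms_def hom_def)
  qed simp
  moreover have "f ` K \<lhd> H" if "K \<lhd> G" for K
    using normal.surj_hom_normal_subgroup[OF that hom im] .
  moreover have "f ` {\<one>\<^bsub>G\<^esub>} = {\<one>\<^bsub>H\<^esub>}" by simp
  ultimately show ?thesis using F im unfolding fitting_chain_def
    by (simp add: image_mono) (metis image_mono Suc_leI)
qed

lemma cd_subset_iso:
  assumes "group L" "group K" "h \<in> iso L K"
  shows "cd K \<subseteq> cd L"
proof -
  have h: "group_hom L K h" "h ` carrier L = carrier K"
    using assms by (simp_all add: group_hom_def group_hom_axioms_def iso_def bij_betw_def)
  interpret group_hom L K h by (rule h)
  have "irr_rep L n (\<lambda>g. \<rho> (h g))" if "irr_rep K n \<rho>" for n \<rho>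
    unfolding irr_rep_def
  proof (intro conjI allI impI)
    show "is_rep L n (\<lambda>g. \<rho> (h g))" using that by (simp add: irr_rep_def is_rep_def)
    show "n > 0" using that by (simp add: irr_rep_def)
    fix W assume W: "is_subspace n W \<and> (\<forall>g\<in>carrier L. \<forall>w\<in>W. \<rho> (h g) *\<^sub>v w \<in> W)"
    have "\<forall>g\<in>carrier K. \<forall>w\<in>W. \<rho> g *\<^sub>v w \<in> W" using W unfolding h(2)[symmetric] by blast
    then show "W = {0\<^sub>v n} \<or> W = carrier_vec n" using that W by (simp add: irr_rep_def)
  qed
  then show ?thesis unfolding cd_def by blast
qed

text \<open>The group will be built on triples, while the theorem asks for a group on the natural
  numbers; each invariant in its statement has to be carried over.\<close>

lemma iso_transfer:
  assumes G: "group G" "group H" and iso: "f \<in> iso G H"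
  shows "solvable G \<Longrightarrow> solvable H" "derived_length H = derived_length G"
    "fitting_height H = fitting_height G" "cd H = cd G"
proof -
  have hom: "group_hom G H f" using G iso by (simp add: group_hom_def group_hom_axioms_def iso_def)
  interpret group_hom G H f by (rule hom)
  have im: "f ` carrier G = carrier H" and inj: "inj_on f (carrier G)"
    using iso by (simp_all add: iso_def bij_betw_def)
  have der: "(derived H ^^ n) (carrier H) = {\<one>\<^bsub>H\<^esub>} \<longleftrightarrow> (derived G ^^ n) (carrier G) = {\<one>\<^bsub>G\<^esub>}" for n
  proof -
    have "(derived H ^^ n) (carrier H) = f ` ((derived G ^^ n) (carrier G))"
      using exp_of_derived_img[of "carrier G" n] im by simp
    moreover have "(derived G ^^ n) (carrier G) \<subseteq> carrier G" by (rule G.exp_of_derived_in_carrier) simp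
    moreover have "f ` {\<one>\<^bsub>G\<^esub>} = {\<one>\<^bsub>H\<^esub>}" by simp
    ultimately show ?thesis using inj_on_image_eq_iff[OF inj, of _ "{\<one>\<^bsub>G\<^esub>}"] by (metis G.one_closed empty_subsetI insert_subset)
  qed
  show "derived_length H = derived_length G" unfolding derived_length_def der ..
  show "solvable G \<Longrightarrow> solvable H" using der G.solvable_iff_trivial_derived_seq H.solvable_iff_trivial_derived_seq by blast
  have iso': "inv_into (carrier G) f \<in> iso H G" using G.iso_set_sym[OF iso] .
  show "fitting_height H = fitting_height G"
    unfolding fitting_height_eq[OF G(1)] fitting_height_eq[OF G(2)]
    using fitting_chain_iso[OF G iso] fitting_chain_iso[OF G(2,1) iso'] by metis
  show "cd H = cd G" using cd_subset_iso[OF G iso] cd_subset_iso[OF G(2,1) iso'] by blast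
qed

lemma finite_group_iso_nat:
  assumes "group G" "finite (carrier G)"
  shows "\<exists>H :: nat monoid. \<exists>f. group H \<and> f \<in> iso G H"
proof -
  obtain f :: "'a \<Rightarrow> nat" and n where "f ` carrier G = {i. i < n}" "inj_on f (carrier G)"
    using finite_imp_inj_to_nat_seg[OF assms(2)] by metis
  then have inj: "inj_on f (carrier G)" by simp
  from inj_imp_image_group_iso[OF this] have iso: "f \<in> iso G (image_group f G)" .
  moreover have "group (image_group f G)" by (rule group.inj_imp_image_group_is_group[OF assms(1) inj])
  ultimately show ?thesis by blast
qed

section \<open>The field with \<open>p ^ q\<close> elements\<close>

text \<open>The error term is kept as a multiple of \<open>p\<close> because the lemma is applied to
  integer polynomials, where \<open>p\<close> is not zero.\<close>

lemma freshmans_dream_multiple: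
  fixes u v :: "'a :: comm_ring_1"
  assumes "Factorial_Ring.prime (p::nat)"
  shows "\<exists>h. (u + v) ^ p = u ^ p + v ^ p + of_nat p * h"
proof -
  have p1: "p > 1" using assms prime_gt_1_nat by blast
  define h where "h = (\<Sum>k\<in>{1..<p}. of_nat ((p choose k) div p) * u ^ k * v ^ (p - k))"
  have "(u + v) ^ p = (\<Sum>k\<le>p. of_nat (p choose k) * u ^ k * v ^ (p - k))"
    by (rule binomial_ring)
  also have "{..p} = insert 0 (insert p {1..<p})" using p1 by auto
  also have "(\<Sum>k\<in>\<dots>. of_nat (p choose k) * u ^ k * v ^ (p - k)) =
      v ^ p + (u ^ p + (\<Sum>k\<in>{1..<p}. of_nat (p choose k) * u ^ k * v ^ (p - k)))"
    using p1 by simp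
  also have "(\<Sum>k\<in>{1..<p}. of_nat (p choose k) * u ^ k * v ^ (p - k)) = of_nat p * h"
    unfolding h_def sum_distrib_left
  proof (rule sum.cong)
    fix k assume k: "k \<in> {1..<p}"
    have "p dvd (p choose k)" using k assms by (intro dvd_choose_prime) auto
    then have "of_nat (p choose k) = (of_nat p * of_nat ((p choose k) div p) :: 'a)"
      by (metis dvd_mult_div_cancel of_nat_mult)
    then show "of_nat (p choose k) * u ^ k * v ^ (p - k) =
        of_nat p * (of_nat ((p choose k) div p) * u ^ k * v ^ (p - k))" by (simp add: mult.assoc)
  qed simp
  finally show ?thesis by (intro exI[of _ h]) (simp add: algebra_simps)
qed

lemma fermat_int:
  assumes "Factorial_Ring.prime (p::nat)"
  shows "[c ^ p = c] (mod int p)"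
proof -
  have p0: "p > 0" using assms prime_gt_0_nat by blast
  define m where "m = nat (c mod int p)"
  have c: "[c = int m] (mod int p)" using p0 by (simp add: m_def cong_def)
  have "[m ^ p = m] (mod p)"
  proof (cases "p dvd m")
    case True
    then have "p dvd m ^ p" using p0 by (meson dvd_power dvd_trans)
    then show ?thesis using True by (simp add: cong_def mod_eq_0_iff_dvd)
  next
    case False
    have "[m * m ^ (p - 1) = m * 1] (mod p)" using fermat_theorem[OF assms False] by (rule cong_scalar_left)
    then show ?thesis using p0 by (simp add: power_eq_if)
  qed
  then have "[int m ^ p = int m] (mod int p)" by (simp flip: of_nat_power add: cong_int_iff)
  from cong_trans[OF cong_trans[OF cong_pow[OF c] this] cong_sym[OF c]] show ?thesis .
qed

section \<open>Polynomials with coefficients reduced modulo \<open>p\<close>\<close>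

definition bounded_polys :: "nat \<Rightarrow> nat \<Rightarrow> int poly set" where
  "bounded_polys p k = {f. \<forall>i. 0 \<le> coeff f i \<and> coeff f i < int p \<and> (i \<ge> k \<longrightarrow> coeff f i = 0)}"

definition redc :: "nat \<Rightarrow> int poly \<Rightarrow> int poly" where
  "redc p f = map_poly (\<lambda>c. c mod int p) f"

lemma coeff_redc [simp]: "coeff (redc p f) i = coeff f i mod int p"
  by (simp add: redc_def coeff_map_poly)

lemma bounded_polysD:
  assumes "f \<in> bounded_polys p k"
  shows "0 \<le> coeff f i" "coeff f i < int p" "i \<ge> k \<Longrightarrow> coeff f i = 0" "coeff f i mod int p = coeff f i"
  using assms by (auto simp: bounded_polys_def)

lemma zero_bounded_polys [simp]: "p > 0 \<Longrightarrow> 0 \<in> bounded_polys p k"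
  by (simp add: bounded_polys_def)

lemma redc_bounded: "p > 0 \<Longrightarrow> (\<And>i. i \<ge> k \<Longrightarrow> coeff f i = 0) \<Longrightarrow> redc p f \<in> bounded_polys p k"
  by (simp add: bounded_polys_def)

lemma redc_add_bounded [simp]:
  "p > 0 \<Longrightarrow> f \<in> bounded_polys p k \<Longrightarrow> g \<in> bounded_polys p k \<Longrightarrow> redc p (f + g) \<in> bounded_polys p k"
  by (intro redc_bounded) (simp_all add: bounded_polys_def)

lemma bounded_polys_eqI:
  assumes "f \<in> bounded_polys p k" "g \<in> bounded_polys p k" "\<And>i. int p dvd coeff f i - coeff g i"
  shows "f = g"
proof (rule poly_eqI)
  fix i
  have "coeff f i mod int p = coeff g i mod int p" using assms(3) by (simp add: mod_eq_dvd_iff)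
  then show "coeff f i = coeff g i" using assms(1,2) bounded_polysD(4) by metis
qed

lemma bij_bounded_polys:
  assumes p0: "p > 0"
  shows "bij_betw (\<lambda>f. \<lambda>i\<in>{..<k}. coeff f i) (bounded_polys p k) ({..<k} \<rightarrow>\<^sub>E {0..<int p})"
proof (intro bij_betwI')
  fix f g assume fg: "f \<in> bounded_polys p k" "g \<in> bounded_polys p k"
  show "((\<lambda>i\<in>{..<k}. coeff f i) = (\<lambda>i\<in>{..<k}. coeff g i)) = (f = g)"
  proof
    assume H: "(\<lambda>i\<in>{..<k}. coeff f i) = (\<lambda>i\<in>{..<k}. coeff g i)"
    show "f = g"
    proof (rule poly_eqI)
      fix i show "coeff f i = coeff g i"
        using fun_cong[OF H, of i] bounded_polysD(3)[OF fg(1), of i] bounded_polysD(3)[OF fg(2), of i]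
        by (cases "i < k") auto
    qed
  qed simp
next
  fix f assume "f \<in> bounded_polys p k"
  then show "(\<lambda>i\<in>{..<k}. coeff f i) \<in> {..<k} \<rightarrow>\<^sub>E {0..<int p}" by (simp add: bounded_polys_def)
next
  fix y assume y: "y \<in> {..<k} \<rightarrow>\<^sub>E {0..<int p}"
  define f where "f = (\<Sum>i<k. monom (y i) i)"
  have c: "coeff f i = (if i < k then y i else 0)" for i
    by (simp add: f_def coeff_sum)
  have ext: "y i = undefined" if "i \<notin> {..<k}" for i by (rule PiE_arb[OF y that])
  have "(\<lambda>i\<in>{..<k}. coeff f i) = y" using ext by (auto simp: c restrict_def fun_eq_iff)
  moreover have "f \<in> bounded_polys p k" using y p0 by (auto simp: bounded_polys_def c PiE_def Pi_def)
  ultimately show "\<exists>f\<in>bounded_polys p k. y = (\<lambda>i\<in>{..<k}. coeff f i)" by metis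
qed

lemma card_bounded_polys: "p > 0 \<Longrightarrow> card (bounded_polys p k) = p ^ k"
  using bij_betw_same_card[OF bij_bounded_polys[of p k]] by (simp add: card_PiE)

lemma finite_bounded_polys: "p > 0 \<Longrightarrow> finite (bounded_polys p k)"
  using bij_betw_finite[OF bij_bounded_polys[of p k]] by (simp add: finite_PiE)

text \<open>With \<open>k = q\<close> this will be the additive group of the field, with
  \<open>k = n - q\<close> the summand on which the rotations act trivially.\<close>

definition poly_group :: "nat \<Rightarrow> nat \<Rightarrow> int poly monoid" where
  "poly_group p k = \<lparr>carrier = bounded_polys p k, monoid.mult = (\<lambda>f g. redc p (f + g)), one = 0\<rparr>"

lemma poly_group_comm: 
  assumes "p > 0"
  shows "comm_group (poly_group p k)"
proof (rule comm_groupI)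
  fix x y z :: "int poly"
  show "x \<otimes>\<^bsub>poly_group p k\<^esub> y \<otimes>\<^bsub>poly_group p k\<^esub> z = x \<otimes>\<^bsub>poly_group p k\<^esub> (y \<otimes>\<^bsub>poly_group p k\<^esub> z)"
    by (auto simp: poly_group_def poly_eq_iff mod_simps add.assoc)
  show "x \<otimes>\<^bsub>poly_group p k\<^esub> y = y \<otimes>\<^bsub>poly_group p k\<^esub> x" by (simp add: poly_group_def add.commute)
next
  fix x assume x: "x \<in> carrier (poly_group p k)"
  then show "\<one>\<^bsub>poly_group p k\<^esub> \<otimes>\<^bsub>poly_group p k\<^esub> x = x"
    by (simp add: poly_group_def poly_eq_iff bounded_polysD(4)[of x p k])
  have "redc p (- x) \<in> bounded_polys p k" using x assms
    by (intro redc_bounded) (simp_all add: poly_group_def bounded_polys_def)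
  moreover have "redc p (redc p (- x) + x) = 0" by (auto simp: poly_eq_iff mod_simps)
  ultimately show "\<exists>y\<in>carrier (poly_group p k). y \<otimes>\<^bsub>poly_group p k\<^esub> x = \<one>\<^bsub>poly_group p k\<^esub>"
    by (auto simp: poly_group_def)
qed (use assms in \<open>auto simp: poly_group_def\<close>)

text \<open>By \<open>nonres\<close>, \<open>a\<close> is not a q-th power modulo \<open>p\<close>.
  As \<open>q\<close> divides \<open>p - 1\<close>, adjoining a q-th root of \<open>a\<close> gives
  a Kummer extension of degree \<open>q\<close>, in which Frobenius is diagonal on the powers of
  that root. Both the field property and the rule for iterated Frobenius are drawn from this
  diagonal form.\<close>

locale kummer =
  fixes p q a :: nat
  assumes p: "Factorial_Ring.prime p" and q: "Factorial_Ring.prime q" and qp: "q dvd p - 1"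
    and nonres: "\<not> [a ^ ((p - 1) div q) = 1] (mod p)" and a0: "\<not> p dvd a"
begin

text \<open>The residue of X^(p-1) modulo X^q - a, hence the factor by which Frobenius scales
  X.\<close>

definition z :: nat where "z = a ^ ((p - 1) div q)"

lemma p0 [simp]: "p > 0" and q0 [simp]: "q > 0" and p1: "p > 1" and q1: "q > 1"
  using p q prime_gt_0_nat prime_gt_1_nat by auto

lemma zq: "[z ^ q = 1] (mod p)"
proof -
  have "z ^ q = a ^ (p - 1)" using qp by (simp add: z_def flip: power_mult)
  then show ?thesis using fermat_theorem[OF p a0] by simp
qed

lemma coprime_z: "coprime p z"
  using a0 p by (simp add: z_def prime_imp_coprime)

lemma ord_z: "ord p z = q"
proof -
  have "ord p z dvd q" using zq ord_divides[of z q p] by blast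
  moreover have "ord p z \<noteq> 1" using nonres ord_divides[of z 1 p] by (auto simp: z_def)
  ultimately show ?thesis using q by (metis prime_nat_iff)
qed

lemma z_pow_cong: "[z ^ i = z ^ j] (mod p) \<longleftrightarrow> [i = j] (mod q)"
  using order_divides_expdiff[OF coprime_z, of i j] by (simp add: ord_z)

text \<open>The ideal generated by \<open>p\<close> and X^q - a. Computing with congruences modulo
  \<open>J\<close> keeps the algebra in the commutative ring \<open>int poly\<close>;
  representatives are chosen only at the end.\<close>

definition J :: "int poly set" where
  "J = {of_nat p * f + (monom 1 q - [:int a:]) * g | f g. True}"

definition eqv :: "int poly \<Rightarrow> int poly \<Rightarrow> bool" (infix "\<equiv>\<^sub>J" 50) where
  "f \<equiv>\<^sub>J g \<longleftrightarrow> f - g \<in> J"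

lemma JI: "of_nat p * f + (monom 1 q - [:int a:]) * g \<in> J"
  by (auto simp: J_def)

lemma JE: "h \<in> J \<Longrightarrow> (\<And>f g. h = of_nat p * f + (monom 1 q - [:int a:]) * g \<Longrightarrow> thesis) \<Longrightarrow> thesis"
  by (auto simp: J_def)

lemma J_add: "f \<in> J \<Longrightarrow> g \<in> J \<Longrightarrow> f + g \<in> J"
proof (elim JE)
  fix f1 f2 g1 g2
  assume "f = of_nat p * f1 + (monom 1 q - [:int a:]) * g1" "g = of_nat p * f2 + (monom 1 q - [:int a:]) * g2"
  then have "f + g = of_nat p * (f1 + f2) + (monom 1 q - [:int a:]) * (g1 + g2)"
    by (simp only: distrib_left add_ac)
  then show "f + g \<in> J" by (simp only: JI)
qed

lemma J_mult: "f \<in> J \<Longrightarrow> f * h \<in> J"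
proof (elim JE)
  fix f1 g1
  assume "f = of_nat p * f1 + (monom 1 q - [:int a:]) * g1"
  then have "f * h = of_nat p * (f1 * h) + (monom 1 q - [:int a:]) * (g1 * h)"
    by (simp only: distrib_right mult.assoc)
  then show "f * h \<in> J" by (simp only: JI)
qed

lemma J_uminus: "f \<in> J \<Longrightarrow> - f \<in> J"
  using J_mult[of f "-1"] by simp

lemma eqv_refl [simp, intro]: "f \<equiv>\<^sub>J f"
  using JI[of 0 0] by (simp add: eqv_def)

lemma eqv_sym: "f \<equiv>\<^sub>J g \<Longrightarrow> g \<equiv>\<^sub>J f"
  using J_uminus[of "f - g"] by (simp add: eqv_def)

lemma eqv_trans [trans]: "f \<equiv>\<^sub>J g \<Longrightarrow> g \<equiv>\<^sub>J h \<Longrightarrow> f \<equiv>\<^sub>J h"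
  using J_add[of "f - g" "g - h"] by (simp add: eqv_def)

lemma eqv_add: "f \<equiv>\<^sub>J f' \<Longrightarrow> g \<equiv>\<^sub>J g' \<Longrightarrow> f + g \<equiv>\<^sub>J f' + g'"
  using J_add[of "f - f'" "g - g'"] by (simp add: eqv_def algebra_simps)

lemma eqv_mult: "f \<equiv>\<^sub>J f' \<Longrightarrow> g \<equiv>\<^sub>J g' \<Longrightarrow> f * g \<equiv>\<^sub>J f' * g'"
  using J_add[OF J_mult[of "f - f'" g] J_mult[of "g - g'" f']] by (simp add: eqv_def algebra_simps)

lemma eqv_minus: "f \<equiv>\<^sub>J f' \<Longrightarrow> g \<equiv>\<^sub>J g' \<Longrightarrow> f - g \<equiv>\<^sub>J f' - g'"
  using eqv_add[of f f' "- g" "- g'"] J_uminus[of "g - g'"] by (simp add: eqv_def)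

lemma eqv_power: "f \<equiv>\<^sub>J f' \<Longrightarrow> f ^ n \<equiv>\<^sub>J f' ^ n"
  by (induction n) (auto intro: eqv_mult)

lemma eqv_p: "f + of_nat p * h \<equiv>\<^sub>J f"
  using JI[of h 0] by (simp add: eqv_def)

lemma eqv_coeffs:
  assumes "\<And>i. [coeff f i = coeff g i] (mod int p)"
  shows "f \<equiv>\<^sub>J g"
proof -
  have "[:int p:] dvd f - g"
    using assms by (subst const_poly_dvd_iff) (auto simp: cong_iff_dvd_diff)
  then obtain h where "f - g = [:int p:] * h" by (auto elim: dvdE)
  then have "f = g + of_nat p * h" by (simp add: of_nat_poly algebra_simps)
  then show ?thesis using eqv_p by simp
qed

lemma eqv_redc: "redc p f \<equiv>\<^sub>J f"
  by (rule eqv_coeffs) (simp add: cong_def)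

lemma eqv_smult: "[c = d] (mod p) \<Longrightarrow> Polynomial.smult (int c) f \<equiv>\<^sub>J Polynomial.smult (int d) f"
  by (intro eqv_coeffs) (simp add: cong_scalar_right cong_int_iff)

lemma eqv_monom_q: "monom 1 q \<equiv>\<^sub>J [:int a:]"
  using JI[of 0 1] by (simp add: eqv_def)

lemma eqv_monom_p: "monom 1 p \<equiv>\<^sub>J monom (int z) 1"
proof -
  have "monom 1 p = monom 1 1 * (monom 1 q) ^ ((p - 1) div q)"
    using qp p0 by (simp add: monom_power mult_monom)
  also have "\<dots> \<equiv>\<^sub>J monom 1 1 * [:int a:] ^ ((p - 1) div q)"
    by (intro eqv_mult eqv_power eqv_monom_q eqv_refl)
  also have "[:int a:] ^ ((p - 1) div q) = [:int z:]" by (simp add: z_def poly_const_pow)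
  also have "monom 1 1 * [:int z:] = monom (int z) 1" by (simp add: smult_monom)
  finally show ?thesis .
qed

text \<open>Modulo \<open>J\<close> both sides are additive and multiplicative; they agree on
  constants by Fermat and on X by \<open>eqv_monom_p\<close>. The induction on coefficients is
  Horner's scheme.\<close>

lemma frobenius: "f ^ p \<equiv>\<^sub>J f \<circ>\<^sub>p [:0, int z:]"
proof (induction f)
  case 0
  then show ?case using p0 by (simp add: zero_power)
next
  case (pCons c f)
  obtain h where h: "([:c:] + monom 1 1 * f) ^ p = [:c:] ^ p + (monom 1 1 * f) ^ p + of_nat p * h"
    using freshmans_dream_multiple[OF p] by blast
  have e: "pCons c f = [:c:] + monom 1 1 * f" by (simp add: monom_Suc)
  have "pCons c f ^ p \<equiv>\<^sub>J [:c:] ^ p + (monom 1 1 * f) ^ p"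
    unfolding e h by (rule eqv_p)
  also have "[:c:] ^ p + (monom 1 1 * f) ^ p \<equiv>\<^sub>J [:c:] + monom (int z) 1 * (f \<circ>\<^sub>p [:0, int z:])"
  proof (rule eqv_add)
    have "[c ^ p = c] (mod int p)" by (rule fermat_int[OF p])
    then show "[:c:] ^ p \<equiv>\<^sub>J [:c:]"
      unfolding poly_const_pow by (intro eqv_coeffs) (auto simp: coeff_pCons split: nat.split)
    have "(monom 1 1 * f) ^ p = monom 1 p * f ^ p" by (simp add: power_mult_distrib monom_power)
    also have "\<dots> \<equiv>\<^sub>J monom (int z) 1 * (f \<circ>\<^sub>p [:0, int z:])"
      by (intro eqv_mult eqv_monom_p pCons.IH)
    finally show "(monom 1 1 * f) ^ p \<equiv>\<^sub>J monom (int z) 1 * (f \<circ>\<^sub>p [:0, int z:])" .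
  qed
  also have "[:c:] + monom (int z) 1 * (f \<circ>\<^sub>p [:0, int z:]) = pCons c f \<circ>\<^sub>p [:0, int z:]"
    by (simp add: pcompose_pCons monom_Suc monom_0)
  finally show ?case .
qed

text \<open>X^q - a is monic: at the largest index where the cofactor \<open>g\<close> has a
  coefficient prime to \<open>p\<close>, that coefficient is carried to the index shifted by
  \<open>q\<close>, where \<open>h\<close> has none. So \<open>p\<close> divides all of
  \<open>g\<close>. This makes reduced representatives unique.\<close>

lemma J_small:
  assumes "h \<in> J" "\<And>i. i \<ge> q \<Longrightarrow> coeff h i = 0"
  shows "int p dvd coeff h i"
proof -
  obtain f g where h: "h = of_nat p * f + (monom 1 q - [:int a:]) * g" using assms(1) by (rule JE)
  have c: "coeff h i = int p * coeff f i + ((if i < q then 0 else coeff g (i - q)) - int a * coeff g i)" for i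
    by (simp add: h of_nat_poly left_diff_distrib coeff_monom_mult)
  have g: "int p dvd coeff g m" for m
  proof (rule ccontr)
    assume "\<not> int p dvd coeff g m"
    let ?S = "{m. \<not> int p dvd coeff g m}"
    have fin: "finite ?S"
      by (rule finite_subset[of _ "{..degree g}"]) (auto intro: le_degree)
    have "?S \<noteq> {}" using \<open>\<not> int p dvd coeff g m\<close> by blast
    then have m: "Max ?S \<in> ?S" using fin Max_in by blast
    have "Max ?S + q \<notin> ?S" using Max_ge[OF fin, of "Max ?S + q"] q0 by linarith
    then have "int p dvd coeff g (Max ?S + q)" by simp
    moreover have "coeff g (Max ?S) = int a * coeff g (Max ?S + q) - int p * coeff f (Max ?S + q)"
      using c[of "Max ?S + q"] assms(2)[of "Max ?S + q"] by simp
    ultimately have "int p dvd coeff g (Max ?S)" by simp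
    then show False using m by simp
  qed
  show ?thesis unfolding c using g by simp
qed

lemma eqv_bounded_eq:
  assumes "f \<in> bounded_polys p q" "g \<in> bounded_polys p q" "f \<equiv>\<^sub>J g"
  shows "f = g"
proof (rule bounded_polys_eqI[OF assms(1,2)])
  fix i
  have "int p dvd coeff (f - g) i"
    using assms by (intro J_small) (simp_all add: eqv_def bounded_polys_def)
  then show "int p dvd coeff f i - coeff g i" by simp
qed

text \<open>Horner's scheme: multiplication by X creates only one term of degree \<open>q\<close>,
  namely \<open>t\<close> X^q, which is exchanged for the constant \<open>t a\<close>.\<close>

lemma bounded_representative: "\<exists>g\<in>bounded_polys p q. f \<equiv>\<^sub>J g"
proof (induction f)
  case 0
  then show ?case by (intro bexI[of _ 0]) auto
next
  case (pCons c f)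
  obtain g where g: "g \<in> bounded_polys p q" "f \<equiv>\<^sub>J g" using pCons.IH by blast
  define t where "t = coeff g (q - 1)"
  define h where "h = pCons c g - monom t q + [:t * int a:]"
  have "pCons c f = [:c:] + monom 1 1 * f" by (simp add: monom_Suc)
  also have "\<dots> \<equiv>\<^sub>J [:c:] + monom 1 1 * g" by (intro eqv_add eqv_mult g eqv_refl)
  also have "\<dots> = pCons c g" by (simp add: monom_Suc)
  also have "\<dots> = h + [:t:] * (monom 1 q - [:int a:])" by (simp add: h_def smult_diff_right smult_monom)
  also have "\<dots> \<equiv>\<^sub>J h + [:t:] * ([:int a:] - [:int a:])"
    by (intro eqv_add eqv_mult eqv_minus eqv_monom_q eqv_refl)
  also have "\<dots> = h" by simp
  also have "h \<equiv>\<^sub>J redc p h" by (rule eqv_sym[OF eqv_redc])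
  finally have "pCons c f \<equiv>\<^sub>J redc p h" .
  moreover have "redc p h \<in> bounded_polys p q"
  proof (rule redc_bounded[OF p0])
    fix i assume i: "i \<ge> q"
    show "coeff h i = 0"
    proof (cases "i = q")
      case True
      then show ?thesis using q0 by (cases q) (auto simp: h_def t_def coeff_pCons)
    next
      case False
      then show ?thesis using i q0 bounded_polysD(3)[OF g(1), of "i - 1"]
        by (cases i) (auto simp: h_def coeff_pCons)
    qed
  qed
  ultimately show ?case by blast
qed

definition red :: "int poly \<Rightarrow> int poly" where
  "red f = (THE g. g \<in> bounded_polys p q \<and> f \<equiv>\<^sub>J g)"

lemma red: "red f \<in> bounded_polys p q" "f \<equiv>\<^sub>J red f"
proof -
  obtain g where g: "g \<in> bounded_polys p q" "f \<equiv>\<^sub>J g" using bounded_representative[of f] by blast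
  have "\<exists>!g. g \<in> bounded_polys p q \<and> f \<equiv>\<^sub>J g"
  proof (rule ex1I[of _ g])
    fix h assume "h \<in> bounded_polys p q \<and> f \<equiv>\<^sub>J h"
    then show "h = g" using eqv_bounded_eq[of h g] eqv_trans[OF eqv_sym[of f h] g(2)] g(1) by simp
  qed (use g in simp)
  from theI'[OF this] show "red f \<in> bounded_polys p q" "f \<equiv>\<^sub>J red f" by (simp_all add: red_def)
qed

lemma red_unique: "g \<in> bounded_polys p q \<Longrightarrow> f \<equiv>\<^sub>J g \<Longrightarrow> red f = g"
  by (rule eqv_bounded_eq[OF red(1) _ eqv_trans[OF eqv_sym[OF red(2)]]])

lemma red_eq_iff: "red f = red g \<longleftrightarrow> f \<equiv>\<^sub>J g"
proof
  assume "red f = red g"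
  with red(2)[of f] have "f \<equiv>\<^sub>J red g" by simp
  then show "f \<equiv>\<^sub>J g" by (rule eqv_trans) (rule eqv_sym[OF red(2)])
next
  assume "f \<equiv>\<^sub>J g"
  then show "red f = red g" by (rule red_unique[OF red(1) eqv_trans[OF _ red(2)]])
qed

lemma red_bounded [simp]: "f \<in> bounded_polys p q \<Longrightarrow> red f = f"
  by (rule red_unique) auto

text \<open>By \<open>frobenius\<close>, every ideal that contains \<open>J\<close> is stable under the substitution of \<open>z X\<close>
  for \<open>X\<close>, whose eigenvectors are the monomials. Hence a nonzero ideal contains a monomial, which
  is a unit.\<close>
lemma invertible_aux:
  assumes "u \<in> bounded_polys p q" "u \<noteq> 0" "u \<equiv>\<^sub>J f * g"
  shows "\<exists>h. f * h \<equiv>\<^sub>J 1"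
  using assms
proof (induction "card {i. coeff u i \<noteq> 0}" arbitrary: u g rule: less_induct)
  case less
  have fin: "finite {i. coeff u i \<noteq> 0}"
    by (rule finite_subset[of _ "{..degree u}"]) (auto intro: le_degree)
  obtain i where i: "coeff u i \<noteq> 0" using less.prems(2) by (auto simp: poly_eq_iff)
  have iq: "i < q" using i bounded_polysD(3)[OF less.prems(1)] not_le by blast
  show ?case
  proof (cases "\<exists>l. l \<noteq> i \<and> coeff u l \<noteq> 0")
    case True
    then obtain l where l: "l \<noteq> i" "coeff u l \<noteq> 0" by blast
    have lq: "l < q" using l bounded_polysD(3)[OF less.prems(1)] not_le by blast
    \<comment> \<open>Coefficient \<open>m\<close> is multiplied by \<open>z^m - z^i\<close>. This
      kills index \<open>i\<close> and keeps index \<open>l\<close>, because \<open>z\<close> has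
      order \<open>q\<close> and both indices are below \<open>q\<close>.\<close>
    define u' where "u' = redc p (u \<circ>\<^sub>p [:0, int z:] - Polynomial.smult (int z ^ i) u)"
    have c: "coeff u' m = (coeff u m * (int z ^ m - int z ^ i)) mod int p" for m
      by (simp add: u'_def coeff_pcompose_linear algebra_simps)
    have ci: "coeff u' i = 0" by (simp add: c)
    have "\<not> [z ^ l = z ^ i] (mod p)" using z_pow_cong l iq lq by (simp add: cong_def)
    then have "\<not> int p dvd int z ^ l - int z ^ i"
      by (simp flip: cong_iff_dvd_diff of_nat_power add: cong_int_iff)
    moreover have "\<not> int p dvd coeff u l" using l(2) bounded_polysD(1,2)[OF less.prems(1), of l]
      by (auto dest: zdvd_imp_le)
    ultimately have cl: "coeff u' l \<noteq> 0"
      using p by (simp add: c mod_eq_0_iff_dvd prime_dvd_mult_iff)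
    have sub: "{m. coeff u' m \<noteq> 0} \<subset> {m. coeff u m \<noteq> 0}"
    proof (rule psubsetI)
      show "{m. coeff u' m \<noteq> 0} \<subseteq> {m. coeff u m \<noteq> 0}" by (auto simp: c)
      show "{m. coeff u' m \<noteq> 0} \<noteq> {m. coeff u m \<noteq> 0}" using ci i by blast
    qed
    have "u' \<equiv>\<^sub>J u ^ p - Polynomial.smult (int z ^ i) u"
      unfolding u'_def using eqv_trans[OF eqv_redc eqv_minus[OF eqv_sym[OF frobenius] eqv_refl]] .
    also have "u ^ p - Polynomial.smult (int z ^ i) u = u * (u ^ (p - 1) - [:int z ^ i:])"
      using power_minus_mult[OF p0, of u] by (simp add: right_diff_distrib mult.commute[of u])
    also have "\<dots> \<equiv>\<^sub>J f * g * (u ^ (p - 1) - [:int z ^ i:])" by (intro eqv_mult less.prems eqv_refl)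
    finally have "u' \<equiv>\<^sub>J f * (g * (u ^ (p - 1) - [:int z ^ i:]))" by (simp add: mult.assoc)
    moreover have "u' \<in> bounded_polys p q"
      using bounded_polysD(3)[OF less.prems(1)] by (simp add: bounded_polys_def c)
    moreover have "u' \<noteq> 0" using cl by auto
    ultimately show ?thesis using less.hyps[OF psubset_card_mono[OF fin sub]] by blast
  next
    case False
    then have u: "u = monom (coeff u i) i" by (auto simp: poly_eq_iff)
    have "\<not> int p dvd coeff u i" using i bounded_polysD(1,2)[OF less.prems(1), of i]
      by (auto dest: zdvd_imp_le)
    then have "coprime (coeff u i) (int p)" using p by (simp add: prime_imp_coprime coprime_commute)
    moreover have "coprime (int a) (int p)" using prime_imp_coprime[OF p a0] by (simp add: coprime_commute)
    ultimately have "coprime (coeff u i * int a) (int p)" by simp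
    then obtain b where b: "[coeff u i * int a * b = 1] (mod int p)" using cong_solve_coprime_int by blast
    \<comment> \<open>A monomial c X^i times b X^(q-i) is c b X^q, which is c b a modulo
      \<open>J\<close>; \<open>b\<close> was chosen to make this 1.\<close>
    have "f * (g * monom b (q - i)) \<equiv>\<^sub>J u * monom b (q - i)"
      using eqv_mult[OF eqv_sym[OF less.prems(3)] eqv_refl, of "monom b (q - i)"] by (simp add: mult.assoc)
    also have "u * monom b (q - i) = [:coeff u i * b:] * monom 1 q"
      using iq by (subst u) (simp add: mult_monom smult_monom)
    also have "\<dots> \<equiv>\<^sub>J [:coeff u i * b:] * [:int a:]" by (intro eqv_mult eqv_monom_q eqv_refl)
    also have "\<dots> = [:coeff u i * int a * b:]" by (simp add: mult_ac)
    also have "\<dots> \<equiv>\<^sub>J 1"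
      using b by (intro eqv_coeffs) (auto simp: coeff_pCons one_pCons split: nat.split)
    finally show ?thesis by blast
  qed
qed

lemma invertible:
  assumes "\<not> f \<equiv>\<^sub>J 0"
  shows "\<exists>h. f * h \<equiv>\<^sub>J 1"
proof (rule invertible_aux[OF red(1)[of f]])
  show "red f \<noteq> 0" using assms red(2)[of f] by auto
  show "red f \<equiv>\<^sub>J f * 1" using red(2) eqv_sym by simp
qed

lemma one_bounded: "1 \<in> bounded_polys p q"
  using p1 q0 by (auto simp: bounded_polys_def)

text \<open>A ring record to which the cyclicity of the unit group of a finite field applies;
  \<open>primitive_element\<close> translates the outcome back into congruences modulo
  \<open>J\<close>.\<close>

definition F :: "int poly ring" where
  "F = \<lparr>carrier = bounded_polys p q, monoid.mult = (\<lambda>f g. red (f * g)), one = 1, ring.zero = 0, ring.add = (\<lambda>f g. red (f + g))\<rparr>"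

lemma field_F: "field F"
proof (rule cring.cring_fieldI2)
  show "cring F"
  proof (rule cringI)
    show "abelian_group F"
    proof (rule abelian_groupI)
      fix x y z assume "x \<in> carrier F" "y \<in> carrier F" "z \<in> carrier F"
      show "(x \<oplus>\<^bsub>F\<^esub> y) \<oplus>\<^bsub>F\<^esub> z = x \<oplus>\<^bsub>F\<^esub> (y \<oplus>\<^bsub>F\<^esub> z)"
      proof -
        have "red (x + y) + z \<equiv>\<^sub>J (x + y) + z" by (intro eqv_add eqv_sym[OF red(2)] eqv_refl)
        also have "(x + y) + z = x + (y + z)" by (rule add.assoc)
        also have "\<dots> \<equiv>\<^sub>J x + red (y + z)" by (intro eqv_add red(2) eqv_refl)
        finally show ?thesis by (simp add: F_def red_eq_iff)
      qed
      show "x \<oplus>\<^bsub>F\<^esub> y = y \<oplus>\<^bsub>F\<^esub> x" by (simp add: F_def add.commute)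
    next
      fix x assume x: "x \<in> carrier F"
      have "red (- x) + x \<equiv>\<^sub>J - x + x" by (intro eqv_add eqv_sym[OF red(2)] eqv_refl)
      then have "red (red (- x) + x) = 0" by (intro red_unique) auto
      then show "\<exists>y\<in>carrier F. y \<oplus>\<^bsub>F\<^esub> x = \<zero>\<^bsub>F\<^esub>" using red(1) by (auto simp: F_def)
    qed (auto simp: F_def red)
    show "comm_monoid F"
    proof (rule comm_monoidI)
      fix x y z assume "x \<in> carrier F" "y \<in> carrier F" "z \<in> carrier F"
      show "(x \<otimes>\<^bsub>F\<^esub> y) \<otimes>\<^bsub>F\<^esub> z = x \<otimes>\<^bsub>F\<^esub> (y \<otimes>\<^bsub>F\<^esub> z)"
      proof -
        have "red (x * y) * z \<equiv>\<^sub>J (x * y) * z" by (intro eqv_mult eqv_sym[OF red(2)] eqv_refl)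
        also have "(x * y) * z = x * (y * z)" by (rule mult.assoc)
        also have "\<dots> \<equiv>\<^sub>J x * red (y * z)" by (intro eqv_mult red(2) eqv_refl)
        finally show ?thesis by (simp add: F_def red_eq_iff)
      qed
      show "x \<otimes>\<^bsub>F\<^esub> y = y \<otimes>\<^bsub>F\<^esub> x" by (simp add: F_def mult.commute)
    qed (auto simp: F_def red one_bounded)
    fix x y z assume "x \<in> carrier F" "y \<in> carrier F" "z \<in> carrier F"
    have "red (x + y) * z \<equiv>\<^sub>J (x + y) * z" by (intro eqv_mult eqv_sym[OF red(2)] eqv_refl)
    also have "(x + y) * z = x * z + y * z" by (rule distrib_right)
    also have "\<dots> \<equiv>\<^sub>J red (x * z) + red (y * z)" by (intro eqv_add red)
    finally show "(x \<oplus>\<^bsub>F\<^esub> y) \<otimes>\<^bsub>F\<^esub> z = x \<otimes>\<^bsub>F\<^esub> z \<oplus>\<^bsub>F\<^esub> y \<otimes>\<^bsub>F\<^esub> z"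
      by (simp add: F_def red_eq_iff)
  qed
  show "\<zero>\<^bsub>F\<^esub> \<noteq> \<one>\<^bsub>F\<^esub>" by (simp add: F_def)
  fix x assume x: "x \<in> carrier F" "x \<noteq> \<zero>\<^bsub>F\<^esub>"
  then have "\<not> x \<equiv>\<^sub>J 0" using eqv_bounded_eq[of x 0] by (auto simp: F_def)
  then obtain h where h: "x * h \<equiv>\<^sub>J 1" using invertible by blast
  have "x * red h \<equiv>\<^sub>J 1" using eqv_trans[OF eqv_mult[OF eqv_refl eqv_sym[OF red(2)]] h] .
  then have "red (x * red h) = 1" by (rule red_unique[OF one_bounded])
  then show "\<exists>b\<in>carrier F. x \<otimes>\<^bsub>F\<^esub> b = \<one>\<^bsub>F\<^esub>" using red(1) by (auto simp: F_def)
qed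

lemma primitive_element:
  "\<exists>w. (\<forall>f. \<not> f \<equiv>\<^sub>J 0 \<longrightarrow> (\<exists>i::nat. f \<equiv>\<^sub>J w ^ i)) \<and> (\<forall>i j. w ^ i \<equiv>\<^sub>J w ^ j \<longleftrightarrow> [i = j] (mod (p ^ q - 1))) \<and> \<not> w \<equiv>\<^sub>J 0"
proof -
  interpret F: field F by (rule field_F)
  have fin: "finite (carrier F)" by (simp add: F_def finite_bounded_polys)
  obtain w where w: "w \<in> carrier (Multiplicative_Group.mult_of F)" and gen: "carrier (Multiplicative_Group.mult_of F) = {w [^]\<^bsub>F\<^esub> i | i::nat. i \<in> UNIV}"
    using F.finite_field_mult_group_has_gen[OF fin] by blast
  interpret U: group "Multiplicative_Group.mult_of F" by (rule F.field_mult_group)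
  have wF: "w \<in> bounded_polys p q" "w \<noteq> 0" using w by (auto simp: F_def)
  have pow: "w [^]\<^bsub>F\<^esub> i = red (w ^ i)" for i :: nat
  proof (induction i)
    case 0
    show ?case using one_bounded by (simp add: nat_pow_def) (simp add: F_def)
  next
    case (Suc i)
    have "w [^]\<^bsub>F\<^esub> Suc i = red (red (w ^ i) * w)" by (simp add: Suc) (simp add: F_def)
    also have "\<dots> = red (w ^ Suc i)" unfolding red_eq_iff power_Suc2
      by (intro eqv_mult eqv_sym[OF red(2)] eqv_refl)
    finally show ?case .
  qed
  have card: "card (carrier (Multiplicative_Group.mult_of F)) = p ^ q - 1"
    using F.order_mult_of[OF fin] by (simp add: Coset.order_def F_def card_bounded_polys)
  have finU: "finite (carrier (Multiplicative_Group.mult_of F))" using fin by (rule F.finite_mult_of)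
  have powU: "w [^]\<^bsub>Multiplicative_Group.mult_of F\<^esub> i = w [^]\<^bsub>F\<^esub> i" for i :: nat by (simp add: Multiplicative_Group.nat_pow_mult_of)
  have "carrier (Multiplicative_Group.mult_of F) = {w [^]\<^bsub>Multiplicative_Group.mult_of F\<^esub> i | i. i \<in> {0 .. U.ord w - 1}}"
    using gen unfolding powU[symmetric] U.ord_elems[OF finU w] .
  then have "carrier (Multiplicative_Group.mult_of F) = (\<lambda>i. w [^]\<^bsub>Multiplicative_Group.mult_of F\<^esub> i) ` {0 .. U.ord w - 1}"
    by (simp only: Setcompr_eq_image)
  \<comment> \<open>The powers of \<open>w\<close> with exponents below its order are distinct and
    exhaust the units, so counting determines the order.\<close>
  then have "p ^ q - 1 = card {0 .. U.ord w - 1}"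
    using card card_image[OF U.ord_inj[OF w]] by metis
  then have ord: "U.ord w = p ^ q - 1" using U.ord_ge_1[OF finU w] by simp
  have *: "w ^ i \<equiv>\<^sub>J w ^ j \<longleftrightarrow> [i = j] (mod (p ^ q - 1))" if "i \<le> j" for i j
  proof -
    have "w ^ i \<equiv>\<^sub>J w ^ j \<longleftrightarrow> w [^]\<^bsub>Multiplicative_Group.mult_of F\<^esub> i = w [^]\<^bsub>Multiplicative_Group.mult_of F\<^esub> j" by (simp add: powU pow red_eq_iff)
    also have "\<dots> \<longleftrightarrow> w [^]\<^bsub>Multiplicative_Group.mult_of F\<^esub> (j - i) = \<one>\<^bsub>Multiplicative_Group.mult_of F\<^esub>"
    proof -
      have "w [^]\<^bsub>Multiplicative_Group.mult_of F\<^esub> j = w [^]\<^bsub>Multiplicative_Group.mult_of F\<^esub> i \<otimes>\<^bsub>Multiplicative_Group.mult_of F\<^esub> w [^]\<^bsub>Multiplicative_Group.mult_of F\<^esub> (j - i)"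
        using U.nat_pow_mult[OF w, of i "j - i"] that by simp
      then show ?thesis
        using U.Units_l_cancel[of "w [^]\<^bsub>Multiplicative_Group.mult_of F\<^esub> i"
            "w [^]\<^bsub>Multiplicative_Group.mult_of F\<^esub> (j - i)" "\<one>\<^bsub>Multiplicative_Group.mult_of F\<^esub>"]
          U.r_one[OF U.nat_pow_closed[OF w, of i]] U.nat_pow_closed[OF w] U.one_closed U.Units_eq by metis
    qed
    also have "\<dots> \<longleftrightarrow> p ^ q - 1 dvd j - i" using U.pow_eq_id[OF w] by (simp add: ord)
    also have "\<dots> \<longleftrightarrow> [i = j] (mod (p ^ q - 1))" using that by (metis cong_altdef_nat cong_sym_eq)
    finally show ?thesis .
  qed
  have "\<exists>i::nat. f \<equiv>\<^sub>J w ^ i" if "\<not> f \<equiv>\<^sub>J 0" for f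
  proof -
    have "red f \<noteq> 0" using that red(2)[of f] by auto
    then have "red f \<in> carrier (Multiplicative_Group.mult_of F)" using red(1) by (simp add: F_def)
    then obtain i :: nat where "red f = red (w ^ i)" unfolding gen using pow by auto
    then show ?thesis by (auto simp: red_eq_iff)
  qed
  moreover have "w ^ i \<equiv>\<^sub>J w ^ j \<longleftrightarrow> [i = j] (mod (p ^ q - 1))" for i j
    using *[of i j] *[of j i] eqv_sym cong_sym_eq by (metis nat_le_linear)
  moreover have "\<not> w \<equiv>\<^sub>J 0" using wF eqv_bounded_eq[of w 0] by auto
  ultimately show ?thesis by blast
qed

end

section \<open>The Frobenius module\<close>

lemma prime_power_cong_one:
  fixes p q :: nat
  assumes "q dvd p - 1" "p > 0"
  shows "[p ^ i = 1] (mod q)"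
proof -
  have "[p = 1] (mod q)" using assms by (simp add: cong_altdef_nat)
  from cong_pow[OF this, of i] show ?thesis by simp
qed

lemma power_cong_mod_order:
  fixes p q :: nat
  assumes "p > 0" "[i = j] (mod q)"
  shows "[p ^ i = p ^ j] (mod (p ^ q - 1))"
proof -
  have one: "[p ^ q = 1] (mod (p ^ q - 1))" using assms(1) by (simp add: cong_altdef_nat)
  have *: "[p ^ (n mod q) = p ^ n] (mod (p ^ q - 1))" for n
  proof -
    have "[p ^ (n mod q) * (p ^ q) ^ (n div q) = p ^ (n mod q) * 1 ^ (n div q)] (mod (p ^ q - 1))"
      by (intro cong_mult cong_pow one cong_refl)
    moreover have "p ^ (n mod q) * (p ^ q) ^ (n div q) = p ^ n"
      by (simp flip: power_mult power_add)
    ultimately show ?thesis by (simp add: cong_sym_eq)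
  qed
  show ?thesis using cong_trans[OF cong_sym[OF *[of i]]] *[of j] assms(2) by (simp add: cong_def[of i j q])
qed

lemma geometric_sum_nat:
  fixes p q :: nat
  assumes "p > 0"
  shows "p ^ q - 1 = (p - 1) * (\<Sum>i<q. p ^ i)"
proof -
  obtain t where t: "p = Suc t" using assms gr0_implies_Suc by blast
  have "Suc t ^ q = Suc (t * (\<Sum>i<q. Suc t ^ i))"
    by (induction q) (simp_all add: algebra_simps)
  then show ?thesis by (simp add: t)
qed

text \<open>With \<open>p = 1 + q * t\<close>, the power p^i is 1 + i q t modulo q^2. The indices
  below \<open>q\<close> sum to q (q - 1) / 2, a multiple of \<open>q\<close> since \<open>q\<close>
  is odd, so the linear terms contribute nothing.\<close>

lemma geometric_sum_cong:
  fixes p q :: nat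
  assumes "odd q" "q dvd p - 1" "p > 0"
  shows "[(\<Sum>i<q. p ^ i) = q] (mod q\<^sup>2)"
proof -
  obtain t where t: "p = 1 + q * t" using assms by (metis dvdE le_add_diff_inverse Suc_leI One_nat_def)
  have *: "[p ^ i = 1 + i * (q * t)] (mod q\<^sup>2)" for i
  proof (induction i)
    case (Suc i)
    have "[p * p ^ i = (1 + q * t) * (1 + i * (q * t))] (mod q\<^sup>2)"
      using Suc t by (intro cong_mult) auto
    also have "(1 + q * t) * (1 + i * (q * t)) = 1 + Suc i * (q * t) + q\<^sup>2 * (i * t * t)"
      by (simp add: algebra_simps power2_eq_square)
    also have "[\<dots> = 1 + Suc i * (q * t)] (mod q\<^sup>2)" by (simp add: cong_def)
    finally show ?case by simp
  qed simp
  have "[(\<Sum>i<q. p ^ i) = (\<Sum>i<q. 1 + i * (q * t))] (mod q\<^sup>2)" by (intro cong_sum *)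
  also have "(\<Sum>i<q. 1 + i * (q * t)) = q + (\<Sum>i<q. i) * (q * t)"
    by (simp only: sum.distrib sum_distrib_right) simp
  also have "(\<Sum>i<q. i) = q * ((q - 1) div 2)"
  proof -
    have "{..<q} = {0..<q}" by auto
    then have "(\<Sum>i<q. i) = q * (q - 1) div 2" using Sum_Ico_nat[of 0 q] by simp
    moreover have "even (q - 1)" using assms(1) by simp
    ultimately show ?thesis by (simp add: div_mult_swap)
  qed
  also have "q + q * ((q - 1) div 2) * (q * t) = q + q\<^sup>2 * ((q - 1) div 2 * t)"
    by (simp add: power2_eq_square)
  also have "[\<dots> = q] (mod q\<^sup>2)" by (simp add: cong_def)
  finally show ?thesis .
qed

text \<open>Besides the exact factor \<open>q\<close>, the bound \<open>u > 1\<close> matters: it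
  supplies a prime divisor of p^q - 1 outside \<open>p - 1\<close>, and it makes p^q - 1 larger than
  (p - 1) q.\<close>

lemma geometric_sum_factor:
  fixes p q :: nat
  assumes "Factorial_Ring.prime q" "odd q" "q dvd p - 1" "p > 1"
  obtains u where "(\<Sum>i<q. p ^ i) = q * u" "\<not> q dvd u" "u > 1"
proof -
  let ?T = "\<Sum>i<q. p ^ i"
  have q1: "q > 1" using assms(1) prime_gt_1_nat by blast
  have c: "[?T = q] (mod q\<^sup>2)" using assms by (intro geometric_sum_cong) auto
  then have "[?T = q] (mod q)" by (rule cong_dvd_modulus_nat) (simp add: power2_eq_square)
  then have "q dvd ?T" by (simp add: cong_def mod_eq_0_iff_dvd)
  then obtain u where u: "?T = q * u" by (elim dvdE)
  have "\<not> q dvd u"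
  proof
    assume "q dvd u"
    then have "q\<^sup>2 dvd ?T" unfolding u by (auto simp: power2_eq_square)
    then have "q\<^sup>2 dvd q" using c by (simp add: cong_dvd_iff)
    then show False using q1 by (auto simp: power2_eq_square dest: dvd_imp_le)
  qed
  moreover have "u > 1"
  proof -
    have "(\<Sum>i<q. 1) < ?T"
    proof (rule sum_strict_mono_ex1)
      show "\<forall>i\<in>{..<q}. 1 \<le> p ^ i" using assms(4) by simp
      show "\<exists>i\<in>{..<q}. 1 < p ^ i" using q1 assms(4) by (intro bexI[of _ 1]) auto
    qed simp
    then have "q * 1 < q * u" using u by simp
    then show ?thesis using q1 by (simp only: mult_less_cancel1)
  qed
  ultimately show ?thesis using that u by blast
qed

lemma index_formula:
  fixes p q :: nat
  assumes "Factorial_Ring.prime q" "odd q" "q dvd p - 1" "p > 1"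
  shows "pprime_part q (p ^ q - 1) * ppart q (p - 1) * q = p ^ q - 1"
proof -
  obtain u where u: "(\<Sum>i<q. p ^ i) = q * u" "\<not> q dvd u" "u > 1"
    by (rule geometric_sum_factor[OF assms])
  define e where "e = multiplicity q (p - 1)"
  have q1: "q > 1" using assms(1) prime_gt_1_nat by blast
  have M: "p ^ q - 1 = (p - 1) * (q * u)" using geometric_sum_nat[of p q] u assms(4) by simp
  have "multiplicity q (p ^ q - 1) = e + (1 + 0)"
    unfolding M e_def using assms q1 u
    by (subst prime_elem_multiplicity_mult_distrib; simp add: prime_elem_multiplicity_mult_distrib not_dvd_imp_multiplicity_0)
  then have pp: "ppart q (p ^ q - 1) = q ^ e * q" by (simp add: ppart_def)
  have dv: "q ^ e * q dvd p ^ q - 1" unfolding M e_def by (simp add: multiplicity_dvd mult_dvd_mono)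
  have "pprime_part q (p ^ q - 1) * ppart q (p - 1) * q = (p ^ q - 1) div (q ^ e * q) * (q ^ e * q)"
    unfolding pprime_part_def pp by (simp add: ppart_def e_def mult.assoc)
  also have "\<dots> = p ^ q - 1" by (rule dvd_div_mult_self[OF dv])
  finally show ?thesis .
qed

text \<open>Any prime divisor of the cofactor \<open>u\<close> works: modulo a divisor of
  \<open>p - 1\<close> the geometric sum is \<open>q\<close>, while \<open>u\<close> is prime to
  \<open>q\<close>. Such an \<open>r\<close> keeps the lower central series of \<open>G\<close> from
  losing all rotations.\<close>

lemma order_has_large_prime:
  fixes p q :: nat
  assumes "Factorial_Ring.prime q" "odd q" "q dvd p - 1" "p > 1"
  obtains r where "Factorial_Ring.prime r" "r dvd p ^ q - 1" "\<not> r dvd p - 1" "r \<noteq> q"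
proof -
  obtain u where u: "(\<Sum>i<q. p ^ i) = q * u" "\<not> q dvd u" "u > 1"
    by (rule geometric_sum_factor[OF assms])
  obtain r where r: "Factorial_Ring.prime r" "r dvd u" using prime_factor_nat[of u] u(3) by auto
  have rq: "r \<noteq> q" using r u by auto
  have "\<not> r dvd p - 1"
  proof
    assume a: "r dvd p - 1"
    have "[(\<Sum>i<q. p ^ i) = (\<Sum>i<q. 1)] (mod r)"
      using prime_power_cong_one[OF a] assms(4) by (intro cong_sum) auto
    moreover have "r dvd (\<Sum>i<q. p ^ i)" using r u by simp
    ultimately have "r dvd q" by (simp add: cong_dvd_iff)
    then show False using r(1) assms(1) rq primes_dvd_imp_eq by blast
  qed
  moreover have "r dvd p ^ q - 1" using geometric_sum_nat[of p q] u r assms(4) by simp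
  ultimately show ?thesis using that r(1) rq by blast
qed

lemma square_dvd_order:
  fixes p q :: nat
  assumes "Factorial_Ring.prime q" "odd q" "q dvd p - 1" "p > 1"
  shows "q * q dvd p ^ q - 1"
proof -
  obtain u where u: "(\<Sum>i<q. p ^ i) = q * u" by (rule geometric_sum_factor[OF assms])
  show ?thesis using geometric_sum_nat[of p q] u assms(3,4) by (simp add: mult_dvd_mono)
qed

text \<open>A primitive root serves: its order \<open>p - 1\<close> does not divide the smaller
  number \<open>(p - 1) div q\<close>.\<close>

lemma nonresidue_exists:
  fixes p q :: nat
  assumes "Factorial_Ring.prime p" "Factorial_Ring.prime q" "q dvd p - 1"
  obtains a where "\<not> [a ^ ((p - 1) div q) = 1] (mod p)" "\<not> p dvd a"
proof -
  have p1: "p > 1" and q1: "q > 1" using assms prime_gt_1_nat by auto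
  obtain g where "residue_primroot p g" using prime_primitive_root_exists[OF p1 assms(1)] by blast
  then have g: "coprime p g" "ord p g = p - 1"
    using assms(1) by (auto simp: residue_primroot_def totient_prime)
  have "\<not> p - 1 dvd (p - 1) div q"
  proof
    assume "p - 1 dvd (p - 1) div q"
    moreover have "(p - 1) div q > 0" "(p - 1) div q < p - 1"
      using assms(3) p1 q1 by (auto simp: div_greater_zero_iff dest: dvd_imp_le)
    ultimately show False by (auto dest: dvd_imp_le)
  qed
  then have "\<not> [g ^ ((p - 1) div q) = 1] (mod p)"
    using ord_divides[of g "(p - 1) div q" p] g(2) by simp
  moreover have "\<not> p dvd g" using g(1) p1 by (metis coprime_common_divisor_nat dvd_refl nat_neq_iff)
  ultimately show ?thesis using that by blast
qed

text \<open>The model is \<open>U = V \<times> D\<close> with \<open>V = GF(p ^ q)\<close> and \<open>act j x = w ^ j * x ^ (p ^ j)\<close> on \<open>V\<close>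
  for a generator \<open>w\<close> of the unit group. \<open>act_act\<close> makes the indices modulo \<open>p ^ q - 1\<close> a group with
  multiplication \<open>i + p ^ i * j\<close>.\<close>
locale frobenius_module =
  fixes U :: "'x monoid" (structure) and p q :: nat and act :: "nat \<Rightarrow> 'x \<Rightarrow> 'x"
    and z :: nat and V D :: "'x set"
  assumes U: "comm_group U" and finU: "finite (carrier U)"
    and p: "Factorial_Ring.prime p" and q: "Factorial_Ring.prime q" and odd_q: "odd q" and qp: "q dvd p - 1"
    and zq: "[z ^ q = 1] (mod p)" and z1: "\<not> [z = 1] (mod p)"
    and exponent: "\<And>x. x \<in> carrier U \<Longrightarrow> x [^] p = \<one>"
    and act_hom: "\<And>j. act j \<in> hom U U"
    and act_0: "\<And>x. x \<in> carrier U \<Longrightarrow> act 0 x = x"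
    and act_act: "\<And>i j x. x \<in> carrier U \<Longrightarrow> act i (act j x) = act (i + p ^ i * j) x"
    and act_cong: "\<And>i j x. [i = j] (mod (p ^ q - 1)) \<Longrightarrow> x \<in> carrier U \<Longrightarrow> act i x = act j x"
    and V: "subgroup V U" and D: "D \<subseteq> carrier U"
    and VD: "\<And>x. x \<in> carrier U \<Longrightarrow> \<exists>v\<in>V. \<exists>d\<in>D. x = v \<otimes> d"
    and act_V: "\<And>v j. v \<in> V \<Longrightarrow> act j v \<in> V" and act_D: "\<And>d j. d \<in> D \<Longrightarrow> act j d = d"
    and free: "\<And>v i j. v \<in> V \<Longrightarrow> v \<noteq> \<one> \<Longrightarrow> act i v = act j v \<Longrightarrow> [i = j] (mod (p ^ q - 1))"
    and scalar: "\<exists>s. q dvd s \<and> (\<forall>v\<in>V. act s v = v [^] z)"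
    and V_nontrivial: "\<exists>v\<in>V. v \<noteq> \<one>"
    and separating: "\<And>x. x \<in> carrier U \<Longrightarrow> x \<noteq> \<one> \<Longrightarrow> \<exists>\<phi>::'x \<Rightarrow> int. \<phi> x mod int p \<noteq> 0 \<and>
        (\<forall>a\<in>carrier U. \<forall>b\<in>carrier U. [\<phi> (a \<otimes> b) = \<phi> a + \<phi> b] (mod int p))"

section \<open>Construction of the module from the Kummer extension\<close>

context kummer
begin

lemma pcompose_eq_power: "f \<circ>\<^sub>p [:0, int z ^ j:] \<equiv>\<^sub>J f ^ (p ^ j)"
proof (induction j)
  case 0
  then show ?case by (simp add: pcompose_idR)
next
  case (Suc j)
  have "f \<circ>\<^sub>p [:0, int z ^ Suc j:] = (f \<circ>\<^sub>p [:0, int z ^ j:]) \<circ>\<^sub>p [:0, int z:]"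
    by (simp add: poly_eq_iff coeff_pcompose_linear power_mult_distrib mult_ac)
  also have "\<dots> \<equiv>\<^sub>J (f \<circ>\<^sub>p [:0, int z ^ j:]) ^ p" by (rule eqv_sym[OF frobenius])
  also have "\<dots> \<equiv>\<^sub>J (f ^ (p ^ j)) ^ p" by (rule eqv_power[OF Suc.IH])
  also have "(f ^ (p ^ j)) ^ p = f ^ (p ^ Suc j)" by (simp add: mult.commute flip: power_mult)
  finally show ?case .
qed

lemma frobenius_add: "(f + g) ^ (p ^ j) \<equiv>\<^sub>J f ^ (p ^ j) + g ^ (p ^ j)"
proof -
  have "(f + g) ^ (p ^ j) \<equiv>\<^sub>J (f + g) \<circ>\<^sub>p [:0, int z ^ j:]" by (rule eqv_sym[OF pcompose_eq_power])
  also have "\<dots> = f \<circ>\<^sub>p [:0, int z ^ j:] + g \<circ>\<^sub>p [:0, int z ^ j:]" by (rule pcompose_add)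
  also have "\<dots> \<equiv>\<^sub>J f ^ (p ^ j) + g ^ (p ^ j)" by (intro eqv_add pcompose_eq_power)
  finally show ?thesis .
qed

text \<open>The j-th iterate of Frobenius is a substitution that depends only on
  \<open>z ^ j\<close>, and \<open>z\<close> has order \<open>q\<close>.\<close>

lemma frobenius_cong:
  assumes "[i = j] (mod q)"
  shows "f ^ (p ^ i) \<equiv>\<^sub>J f ^ (p ^ j)"
proof -
  have "[z ^ i = z ^ j] (mod p)" using assms by (simp add: z_pow_cong)
  then have "[int z ^ i = int z ^ j] (mod int p)" by (simp flip: of_nat_power add: cong_int_iff)
  then have "f \<circ>\<^sub>p [:0, int z ^ i:] \<equiv>\<^sub>J f \<circ>\<^sub>p [:0, int z ^ j:]"
    unfolding coeff_pcompose_linear[symmetric]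
    by (intro eqv_coeffs) (auto simp: coeff_pcompose_linear intro!: cong_mult cong_pow)
  then show ?thesis by (rule eqv_trans[OF eqv_sym[OF pcompose_eq_power] eqv_trans[OF _ pcompose_eq_power]])
qed

theorem frobenius_module_exists:
  assumes odd: "odd q"
  shows "\<exists>(U :: (int poly \<times> int poly) monoid) act V D. frobenius_module U p q act z V D \<and> card (carrier U) = p ^ (q + k)"
proof -
  obtain w where w: "\<And>f. \<not> f \<equiv>\<^sub>J 0 \<Longrightarrow> \<exists>i::nat. f \<equiv>\<^sub>J w ^ i"
    "\<And>i j. w ^ i \<equiv>\<^sub>J w ^ j \<longleftrightarrow> [i = j] (mod (p ^ q - 1))"
    using primitive_element by blast
  define a where "a j x = red (w ^ j * x ^ (p ^ j))" for j x
  have aV: "a j x \<in> bounded_polys p q" for j x by (simp add: a_def red(1))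
  have aeq: "a j x \<equiv>\<^sub>J w ^ j * x ^ (p ^ j)" for j x unfolding a_def by (rule eqv_sym[OF red(2)])
  have a_add: "a j (redc p (x + y)) = redc p (a j x + a j y)" for j x y
  proof -
    have "w ^ j * (redc p (x + y)) ^ (p ^ j) \<equiv>\<^sub>J w ^ j * (x + y) ^ (p ^ j)"
      by (intro eqv_mult eqv_power eqv_redc eqv_refl)
    also have "\<dots> \<equiv>\<^sub>J w ^ j * (x ^ (p ^ j) + y ^ (p ^ j))"
      by (intro eqv_mult frobenius_add eqv_refl)
    also have "\<dots> = w ^ j * x ^ (p ^ j) + w ^ j * y ^ (p ^ j)" by (rule distrib_left)
    also have "\<dots> \<equiv>\<^sub>J a j x + a j y" by (intro eqv_add eqv_sym[OF aeq])
    also have "\<dots> \<equiv>\<^sub>J redc p (a j x + a j y)" by (rule eqv_sym[OF eqv_redc])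
    finally show ?thesis unfolding a_def[of j "redc p (x + y)"]
      by (intro red_unique redc_add_bounded aV) auto
  qed
  have p1': "p - 1 > 0" using p1 by simp
  have modq: "[p ^ i = 1] (mod q)" for i by (rule prime_power_cong_one[OF qp p0])
  have shift: "[i + p ^ i * j = i + j] (mod q)" for i j
    using cong_add[OF cong_refl cong_mult[OF modq cong_refl]] by simp
  have a_act: "a i (a j x) = a (i + p ^ i * j) x" for i j x
  proof -
    have "w ^ i * (a j x) ^ (p ^ i) \<equiv>\<^sub>J w ^ i * (w ^ j * x ^ (p ^ j)) ^ (p ^ i)"
      by (intro eqv_mult eqv_power aeq eqv_refl)
    also have "\<dots> = w ^ (i + p ^ i * j) * x ^ (p ^ (i + j))"
      by (simp add: power_mult_distrib power_add mult_ac flip: power_mult)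
    also have "\<dots> \<equiv>\<^sub>J w ^ (i + p ^ i * j) * x ^ (p ^ (i + p ^ i * j))"
      by (intro eqv_mult frobenius_cong cong_sym[OF shift] eqv_refl)
    finally show ?thesis unfolding a_def[of i] a_def[of "i + p ^ i * j"] red_eq_iff .
  qed
  have q2: "q * q dvd p ^ q - 1" by (rule square_dvd_order[OF q odd qp p1])
  then have qM: "q dvd p ^ q - 1" by (rule dvd_mult_left)
  have a_cong: "a i x = a j x" if "[i = j] (mod (p ^ q - 1))" for i j x
  proof -
    have "[i = j] (mod q)" using that qM by (rule cong_dvd_modulus_nat)
    moreover have "w ^ i \<equiv>\<^sub>J w ^ j" using that w(2) by simp
    ultimately show ?thesis unfolding a_def red_eq_iff by (intro eqv_mult frobenius_cong)
  qed
  \<comment> \<open>Write \<open>v\<close> as \<open>w ^ l\<close>; then \<open>a i v\<close> is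
    \<open>w\<close> to the power \<open>i + l * p ^ i\<close>. Since \<open>p\<close> is 1 modulo
    \<open>q\<close>, equality gives first \<open>i = j\<close> modulo \<open>q\<close>, hence equal
    powers of \<open>p\<close> modulo p^q - 1, and then \<open>i = j\<close> modulo p^q - 1.\<close>
  have a_free: "[i = j] (mod (p ^ q - 1))"
    if v: "v \<in> bounded_polys p q" "v \<noteq> 0" and eq: "a i v = a j v" for v i j
  proof -
    have "\<not> v \<equiv>\<^sub>J 0" using v eqv_bounded_eq[of v 0] by auto
    then obtain l where l: "v \<equiv>\<^sub>J w ^ l" using w(1) by blast
    have *: "a i v \<equiv>\<^sub>J w ^ (i + l * p ^ i)" for i
    proof -
      have "a i v \<equiv>\<^sub>J w ^ i * v ^ (p ^ i)" by (rule aeq)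
      also have "\<dots> \<equiv>\<^sub>J w ^ i * (w ^ l) ^ (p ^ i)" by (intro eqv_mult eqv_power l eqv_refl)
      also have "\<dots> = w ^ (i + l * p ^ i)" by (simp add: power_add flip: power_mult)
      finally show ?thesis .
    qed
    have "w ^ (i + l * p ^ i) \<equiv>\<^sub>J w ^ (j + l * p ^ j)"
      using eqv_trans[OF eqv_sym[OF *[of i]]] *[of j] eq by simp
    then have c: "[i + l * p ^ i = j + l * p ^ j] (mod (p ^ q - 1))" using w(2) by simp
    then have "[i + l * p ^ i = j + l * p ^ j] (mod q)" using qM by (rule cong_dvd_modulus_nat)
    moreover have "[i + l * p ^ i = i + l] (mod q)" for i
      using cong_add[OF cong_refl cong_mult[OF cong_refl modq]] by simp
    ultimately have "[i + l = j + l] (mod q)" using cong_trans cong_sym by meson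
    then have "[i = j] (mod q)" by (simp add: cong_add_rcancel_nat)
    then have "[p ^ i = p ^ j] (mod (p ^ q - 1))" by (intro power_cong_mod_order) auto
    then have "[j + l * p ^ j = j + l * p ^ i] (mod (p ^ q - 1))"
      by (intro cong_add cong_mult cong_refl) (rule cong_sym)
    with c have "[i + l * p ^ i = j + l * p ^ i] (mod (p ^ q - 1))" by (rule cong_trans)
    then show ?thesis by (simp add: cong_add_rcancel_nat)
  qed
  \<comment> \<open>Let \<open>z\<close> be \<open>w ^ s\<close>. From z^q = 1 it follows that p^q -
    1 divides \<open>s * q\<close>, and since q^2 divides p^q - 1, \<open>q\<close> divides
    \<open>s\<close>. So the Frobenius part of \<open>a s\<close> is trivial and only the
    multiplication by \<open>z\<close> remains.\<close>
  have a_scalar: "\<exists>s. q dvd s \<and> (\<forall>v\<in>bounded_polys p q. a s v = redc p (Polynomial.smult (int z) v))"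
  proof -
    have zp: "\<not> p dvd z" using coprime_z p1 by (metis coprime_common_divisor_nat dvd_refl nat_neq_iff)
    have "\<not> [:int z:] \<equiv>\<^sub>J 0"
    proof
      assume "[:int z:] \<equiv>\<^sub>J 0"
      then have "int p dvd coeff [:int z:] 0"
      proof (intro J_small)
        show "coeff [:int z:] i = 0" if "q \<le> i" for i
          using less_le_trans[OF q0 that] by (intro coeff_eq_0) simp
      qed (simp add: eqv_def)
      then show False using zp by simp
    qed
    then obtain s where s: "[:int z:] \<equiv>\<^sub>J w ^ s" using w(1) by blast
    have "w ^ (s * q) \<equiv>\<^sub>J [:int z:] ^ q" using eqv_power[OF eqv_sym[OF s], of q] by (simp add: power_mult)
    also have "[:int z:] ^ q = Polynomial.smult (int (z ^ q)) 1" by (simp add: poly_const_pow)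
    also have "\<dots> \<equiv>\<^sub>J Polynomial.smult (int 1) 1" by (intro eqv_smult zq)
    also have "\<dots> = w ^ 0" by simp
    finally have "[s * q = 0] (mod (p ^ q - 1))" by (simp only: w(2))
    then have "p ^ q - 1 dvd s * q" by (simp only: cong_0_iff)
    then have "q * q dvd s * q" using q2 dvd_trans by blast
    then have qs: "q dvd s" using q0 by auto
    moreover have "a s v = redc p (Polynomial.smult (int z) v)" if v: "v \<in> bounded_polys p q" for v
    proof -
      have "w ^ s * v ^ (p ^ s) \<equiv>\<^sub>J [:int z:] * v ^ (p ^ 0)"
        using qs by (intro eqv_mult eqv_sym[OF s] frobenius_cong) (simp add: cong_0_iff)
      also have "\<dots> = Polynomial.smult (int z) v" by simp
      also have "\<dots> \<equiv>\<^sub>J redc p (Polynomial.smult (int z) v)" by (rule eqv_sym[OF eqv_redc])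
      finally show ?thesis unfolding a_def using v
        by (intro red_unique redc_bounded) (auto simp: bounded_polys_def)
    qed
    ultimately show ?thesis by blast
  qed
  define V0 where "V0 = bounded_polys p q"
  define U where "U = poly_group p q \<times>\<times> poly_group p k"
  define act where "act j = (\<lambda>(v, d). (a j v, d :: int poly))" for j
  interpret A: comm_group "poly_group p q" by (rule poly_group_comm) simp
  interpret B: comm_group "poly_group p k" by (rule poly_group_comm) simp
  have carX: "carrier U = V0 \<times> bounded_polys p k" by (simp add: U_def DirProd_def poly_group_def V0_def)
  have multX: "x \<otimes>\<^bsub>U\<^esub> y = (redc p (fst x + fst y), redc p (snd x + snd y))" for x y
    by (simp add: U_def DirProd_def poly_group_def split: prod.split)
  have oneX: "\<one>\<^bsub>U\<^esub> = (0, 0)" by (simp add: U_def DirProd_def poly_group_def)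
  have XG: "group U" unfolding U_def by (intro DirProd_group A.is_group B.is_group)
  interpret XG: group U by (rule XG)
  have XC: "comm_group U"
    by (rule XG.group_comm_groupI) (simp add: multX add.commute)
  have powX: "x [^]\<^bsub>U\<^esub> (m::nat) = (redc p (Polynomial.smult (int m) (fst x)), redc p (Polynomial.smult (int m) (snd x)))"
    if "x \<in> carrier U" for x m
  proof (induction m)
    case 0
    then show ?case by (simp add: oneX poly_eq_iff)
  next
    case (Suc m)
    then show ?case by (simp add: multX poly_eq_iff mod_simps algebra_simps)
  qed
  have "frobenius_module U p q act z (V0 \<times> {0}) ({0} \<times> bounded_polys p k)"
  proof (rule frobenius_module.intro)
    show "comm_group U" by fact
    show "finite (carrier U)" by (simp add: carX V0_def finite_bounded_polys)
    show "Factorial_Ring.prime p" "Factorial_Ring.prime q" "odd q" "q dvd p - 1" "[z ^ q = 1] (mod p)"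
      by (fact p q odd qp zq)+
    show "\<not> [z = 1] (mod p)" using nonres by (simp add: z_def)
    show "x [^]\<^bsub>U\<^esub> p = \<one>\<^bsub>U\<^esub>" if "x \<in> carrier U" for x
      using powX[OF that] by (simp add: oneX poly_eq_iff)
    show "act j \<in> hom U U" for j
      by (auto simp: hom_def carX multX act_def V0_def aV a_add)
    show "act 0 x = x" if "x \<in> carrier U" for x using that by (auto simp: carX act_def a_def V0_def)
    show "act i (act j x) = act (i + p ^ i * j) x" for i j x by (auto simp: act_def a_act split: prod.split)
    show "act i x = act j x" if "[i = j] (mod (p ^ q - 1))" for i j x
      using a_cong[OF that] by (auto simp: act_def split: prod.split)
    show "subgroup (V0 \<times> {0}) U"
    proof (rule XG.subgroupI)
      show "V0 \<times> {0} \<subseteq> carrier U" by (auto simp: carX)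
      have "(0, 0) \<in> V0 \<times> {0}" by (simp add: V0_def)
      then show "V0 \<times> {0} \<noteq> {}" by blast
      show "x \<otimes>\<^bsub>U\<^esub> y \<in> V0 \<times> {0}" if "x \<in> V0 \<times> {0}" "y \<in> V0 \<times> {0}" for x y
        using that by (auto simp: multX V0_def poly_eq_iff)
      fix x :: "int poly \<times> int poly" assume x: "x \<in> V0 \<times> {0}"
      have "inv\<^bsub>U\<^esub> x = (redc p (- fst x), 0)"
      proof (rule XG.inv_equality)
        show "(redc p (- fst x), 0) \<otimes>\<^bsub>U\<^esub> x = \<one>\<^bsub>U\<^esub>"
          using x by (auto simp: multX oneX poly_eq_iff mod_simps)
      qed (use x in \<open>auto simp: carX V0_def bounded_polys_def\<close>)
      then show "inv\<^bsub>U\<^esub> x \<in> V0 \<times> {0}" using x by (auto simp: V0_def bounded_polys_def)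
    qed
    show "{0} \<times> bounded_polys p k \<subseteq> carrier U" by (auto simp: carX V0_def)
    show "\<exists>v\<in>V0 \<times> {0}. \<exists>d\<in>{0} \<times> bounded_polys p k. x = v \<otimes>\<^bsub>U\<^esub> d" if x: "x \<in> carrier U" for x
    proof (intro bexI)
      show "x = (fst x, 0) \<otimes>\<^bsub>U\<^esub> (0, snd x)"
        using x by (auto simp: multX carX V0_def poly_eq_iff bounded_polysD(4))
    qed (use x in \<open>auto simp: carX\<close>)
    show "act j v \<in> V0 \<times> {0}" if "v \<in> V0 \<times> {0}" for j v using that by (auto simp: act_def V0_def aV)
    have "a j 0 = 0" for j
    proof -
      have "w ^ j * 0 ^ (p ^ j) \<equiv>\<^sub>J 0" by (simp add: zero_power)
      then show ?thesis unfolding a_def by (intro red_unique) auto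
    qed
    then show "act j d = d" if "d \<in> {0} \<times> bounded_polys p k" for j d using that by (auto simp: act_def)
    show "[i = j] (mod (p ^ q - 1))" if "v \<in> V0 \<times> {0}" "v \<noteq> \<one>\<^bsub>U\<^esub>" "act i v = act j v" for v i j
      by (rule a_free[of "fst v"]) (use that in \<open>auto simp: act_def oneX V0_def\<close>)
    obtain s where s: "q dvd s" "\<forall>v\<in>bounded_polys p q. a s v = redc p (Polynomial.smult (int z) v)"
      using a_scalar by blast
    have "act s v = v [^]\<^bsub>U\<^esub> z" if "v \<in> V0 \<times> {0}" for v
    proof -
      have "v \<in> carrier U" using that by (auto simp: carX)
      from powX[OF this] show ?thesis using that s(2) by (auto simp: act_def V0_def poly_eq_iff)
    qed
    then show "\<exists>s. q dvd s \<and> (\<forall>v\<in>V0 \<times> {0}. act s v = v [^]\<^bsub>U\<^esub> z)" using s(1) by blast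
    show "\<exists>v\<in>V0 \<times> {0}. v \<noteq> \<one>\<^bsub>U\<^esub>"
      by (intro bexI[of _ "(1, 0)"]) (auto simp: oneX V0_def one_bounded)
    fix x assume x: "x \<in> carrier U" "x \<noteq> \<one>\<^bsub>U\<^esub>"
    show "\<exists>\<phi>. \<phi> x mod int p \<noteq> 0 \<and>
        (\<forall>a\<in>carrier U. \<forall>b\<in>carrier U. [\<phi> (a \<otimes>\<^bsub>U\<^esub> b) = \<phi> a + \<phi> b] (mod int p))"
    \<comment> \<open>A nonzero coefficient of \<open>x\<close> in either component is the desired
      functional.\<close>
    proof (cases "fst x = 0")
      case True
      then have "snd x \<noteq> 0" using x by (auto simp: oneX prod_eq_iff)
      then obtain i where "coeff (snd x) i \<noteq> 0" by (auto simp: poly_eq_iff)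
      moreover have "coeff (snd x) i mod int p = coeff (snd x) i"
        using x by (intro bounded_polysD(4)) (auto simp: carX)
      ultimately show ?thesis
        by (intro exI[of _ "\<lambda>y. coeff (snd y) i"]) (auto simp: multX cong_def)
    next
      case False
      then obtain i where "coeff (fst x) i \<noteq> 0" by (auto simp: poly_eq_iff)
      moreover have "coeff (fst x) i mod int p = coeff (fst x) i"
        using x by (intro bounded_polysD(4)) (auto simp: carX V0_def)
      ultimately show ?thesis
        by (intro exI[of _ "\<lambda>y. coeff (fst y) i"]) (auto simp: multX cong_def)
    qed
  qed
  moreover have "card (carrier U) = p ^ (q + k)"
    by (simp add: carX V0_def card_cartesian_product card_bounded_polys power_add)
  ultimately show ?thesis by blast
qed

end

section \<open>The group \<open>G\<close>\<close>

lemma prime_order_pow_dvd: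
  fixes z p q :: nat
  assumes "Factorial_Ring.prime q" "[z ^ q = 1] (mod p)" "\<not> [z = 1] (mod p)" "[z ^ j = 1] (mod p)"
  shows "q dvd j"
proof -
  have "ord p z dvd j" "ord p z dvd q" using assms(2,4) ord_divides[of z _ p] by blast+
  moreover have "ord p z \<noteq> 1" using assms(3) ord_divides[of z 1 p] by auto
  ultimately show "q dvd j" using assms(1) by (metis prime_nat_iff)
qed

section \<open>Index arithmetic, the action, and affine functions\<close>

context frobenius_module
begin

sublocale comm_group U by (rule U)

definition M :: nat where "M = p ^ q - 1"

abbreviation eqp :: "int \<Rightarrow> int \<Rightarrow> bool" where "eqp s t \<equiv> [s = t] (mod int p)"

lemma p1: "p > 1" and q1: "q > 1" and p0: "p > 0" and q0: "q > 0"
  using p q prime_gt_1_nat prime_gt_0_nat by auto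

lemma qM: "q dvd M"
  using square_dvd_order[OF q odd_q qp p1] unfolding M_def by (rule dvd_mult_left)

text \<open>The commutator of the rotations \<open>1\<close> and \<open>q\<close> has index (p - 1)
  q up to a power of \<open>p\<close>; the bound shows that it is not trivial.\<close>

lemma M_gt: "(p - 1) * q < M"
proof -
  obtain u where u: "(\<Sum>i<q. p ^ i) = q * u" "u > 1"
    by (rule geometric_sum_factor[OF q odd_q qp p1]) auto
  have "(p - 1) * (q * 1) < (p - 1) * (q * u)" using p1 q0 u(2) by simp
  then show ?thesis using geometric_sum_nat[OF p0, of q] u(1) by (simp add: M_def)
qed

lemma M1: "M > 1" 
proof -
  have "1 * 1 < (p - 1) * q" using p1 q1 by (intro mult_le_less_imp_less) auto
  then show ?thesis using M_gt by linarith
qed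

lemma p_pow_q: "[p ^ i = 1] (mod q)"
  by (rule prime_power_cong_one[OF qp p0])

lemma p_pow_M: "[i = j] (mod q) \<Longrightarrow> [p ^ i = p ^ j] (mod M)"
  unfolding M_def by (rule power_cong_mod_order[OF p0])

lemma p_pow_M1: "q dvd i \<Longrightarrow> [p ^ i = 1] (mod M)"
  using p_pow_M[of i 0] by (simp add: cong_0_iff)

text \<open>Reduction modulo \<open>q\<close> is thus a homomorphism from H to a cyclic group, and
  its kernel is C.\<close>

lemma idx_mod_q: "[(i + p ^ i * j) mod M = i + j] (mod q)"
proof -
  have "[(i + p ^ i * j) mod M = i + p ^ i * j] (mod q)"
    using qM by (intro cong_dvd_modulus_nat[OF _ qM]) simp
  also have "[i + p ^ i * j = i + 1 * j] (mod q)" by (intro cong_add cong_mult p_pow_q cong_refl)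
  finally show ?thesis by simp
qed

text \<open>Multiplication by an element of C is plain addition of indices; in particular C is
  commutative.\<close>

lemma idx_M: "q dvd i \<Longrightarrow> (i + p ^ i * j) mod M = (i + j) mod M"
  using cong_add[OF cong_refl[of i] cong_mult[OF p_pow_M1 cong_refl[of j]]] by (simp add: cong_def)

lemma mod_M_dvd: "q dvd i mod M \<longleftrightarrow> q dvd i"
  using qM by (simp add: dvd_mod_iff)

lemma z_cong: "[i = j] (mod q) \<Longrightarrow> eqp (int z ^ i) (int z ^ j)"
proof -
  have *: "[z ^ (n mod q) = z ^ n] (mod p)" for n
  proof -
    have "[z ^ (n mod q) * (z ^ q) ^ (n div q) = z ^ (n mod q) * 1 ^ (n div q)] (mod p)"
      by (intro cong_mult cong_pow zq cong_refl)
    moreover have "z ^ (n mod q) * (z ^ q) ^ (n div q) = z ^ n"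
      by (simp flip: power_mult power_add)
    ultimately show ?thesis by (simp add: cong_sym_eq)
  qed
  assume "[i = j] (mod q)"
  then have "[z ^ i = z ^ j] (mod p)" using cong_trans[OF cong_sym[OF *[of i]]] *[of j] by (simp add: cong_def[of i j q])
  then show ?thesis by (simp flip: of_nat_power add: cong_int_iff)
qed

lemma z_one: "q dvd j \<Longrightarrow> eqp (int z ^ j) 1"
  using z_cong[of j 0] by (simp add: cong_0_iff)

lemma z_one_iff: "eqp (int z ^ j) 1 \<longleftrightarrow> q dvd j"
proof
  assume "eqp (int z ^ j) 1"
  then have "[z ^ j = 1] (mod p)" using cong_int_iff[of "z ^ j" 1 p] by simp
  then show "q dvd j" by (rule prime_order_pow_dvd[OF q zq z1])
qed (rule z_one)

text \<open>The exponent \<open>(q - 1) * j\<close> is -j modulo \<open>q\<close> and remains a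
  natural number; it serves as the inverse of \<open>z ^ j\<close> throughout.\<close>

lemma z_inv: "eqp (int z ^ ((q - 1) * j) * int z ^ j) 1"
proof -
  have "(q - 1) * j + j = q * j" using q0 by (simp add: algebra_simps)
  then show ?thesis unfolding power_add[symmetric] by (simp only: z_one dvd_triv_left)
qed

lemma act_closed [simp]: "x \<in> carrier U \<Longrightarrow> act j x \<in> carrier U"
  using act_hom[of j] by (auto simp: hom_def)

lemma act_mult [simp]: "x \<in> carrier U \<Longrightarrow> y \<in> carrier U \<Longrightarrow> act j (x \<otimes> y) = act j x \<otimes> act j y"
  using act_hom[of j] by (auto simp: hom_def)

lemma act_group_hom: "group_hom U U (act j)"
  using act_hom is_group by (simp add: group_hom_def group_hom_axioms_def)

lemma act_one [simp]: "act j \<one> = \<one>"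
  using group_hom.hom_one[OF act_group_hom] .

lemma act_inv [simp]: "x \<in> carrier U \<Longrightarrow> act j (inv x) = inv (act j x)"
  using group_hom.hom_inv[OF act_group_hom] .

lemma act_idx: "x \<in> carrier U \<Longrightarrow> act ((i + p ^ i * j) mod M) x = act i (act j x)"
  using act_act[of x i j] act_cong[of "(i + p ^ i * j) mod M" "i + p ^ i * j" x] by (simp add: M_def)

lemma act_eq_iff: "v \<in> V \<Longrightarrow> v \<noteq> \<one> \<Longrightarrow> act i v = act j v \<longleftrightarrow> [i = j] (mod M)"
  using free[of v i j] act_cong[of i j v] subgroup.mem_carrier[OF V] by (auto simp: M_def)

text \<open>Solves \<open>i + p ^ i * j = 0\<close> modulo \<open>M\<close>: modulo \<open>q\<close>
  this says \<open>i = -j\<close>, so \<open>p ^ i\<close> must be \<open>p ^ ((q - 1) * j)\<close>,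
  and \<open>M - j\<close> stands for \<open>-j\<close>.\<close>

definition idx_inv :: "nat \<Rightarrow> nat" where
  "idx_inv j = (p ^ ((q - 1) * j) * (M - j)) mod M"

lemma idx_inv_less: "idx_inv j < M"
  using M1 by (simp add: idx_inv_def)

lemma idx_inv:
  assumes "j < M"
  shows "(idx_inv j + p ^ idx_inv j * j) mod M = 0"
proof -
  let ?i = "idx_inv j"
  have "[?i = p ^ ((q - 1) * j) * (M - j)] (mod q)"
    unfolding idx_inv_def by (intro cong_dvd_modulus_nat[OF _ qM]) simp
  also have "[p ^ ((q - 1) * j) * (M - j) = 1 * (M - j)] (mod q)"
    by (intro cong_mult p_pow_q cong_refl)
  finally have "[?i + j = 1 * (M - j) + j] (mod q)" by (intro cong_add cong_refl)
  moreover have "1 * (M - j) + j = M" using assms by simp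
  ultimately have "[?i + j = M] (mod q)" by simp
  also have "[M = (q - 1) * j + j] (mod q)"
    using qM q0 by (simp add: cong_def algebra_simps)
  finally have "[?i = (q - 1) * j] (mod q)" by (simp add: cong_add_rcancel_nat)
  then have "[p ^ ?i = p ^ ((q - 1) * j)] (mod M)" by (rule p_pow_M)
  then have "[?i + p ^ ?i * j = p ^ ((q - 1) * j) * (M - j) + p ^ ((q - 1) * j) * j] (mod M)"
    by (intro cong_add cong_mult cong_refl) (simp_all add: idx_inv_def cong_def)
  also have "p ^ ((q - 1) * j) * (M - j) + p ^ ((q - 1) * j) * j = p ^ ((q - 1) * j) * M"
    using assms by (simp flip: distrib_left)
  finally show ?thesis by (simp add: cong_def)
qed

lemma act_idx_inv: "j < M \<Longrightarrow> x \<in> carrier U \<Longrightarrow> act (idx_inv j) (act j x) = x"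
  using act_idx[of x "idx_inv j" j] by (simp add: idx_inv act_0)

lemma act_inj: "j < M \<Longrightarrow> x \<in> carrier U \<Longrightarrow> y \<in> carrier U \<Longrightarrow> act j x = act j y \<longleftrightarrow> x = y"
  using act_idx_inv by metis

lemma act_surj:
  assumes "j < M" "x \<in> carrier U"
  shows "act j (act (idx_inv j) x) = x"
proof -
  have "act (idx_inv (idx_inv j)) (act (idx_inv j) (act j (act (idx_inv j) x))) = act (idx_inv (idx_inv j)) (act (idx_inv j) x)"
    using act_idx_inv[OF assms(1)] assms by simp
  then show ?thesis using act_idx_inv[OF idx_inv_less, of _ j] assms by simp
qed

text \<open>A homomorphism to GF(p) plus the constant \<open>f \<one>\<close>. Keeping the constant
  inside makes the class stable under translations of the argument.\<close>

definition affine :: "('x \<Rightarrow> int) \<Rightarrow> bool" where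
  "affine f \<longleftrightarrow> (\<forall>x\<in>carrier U. \<forall>y\<in>carrier U. eqp (f (x \<otimes> y) + f \<one>) (f x + f y))"

text \<open>Reduced values, and the default value outside the carrier, leave one representative for
  each function modulo \<open>p\<close>; equality in \<open>G\<close> becomes congruence on the
  carrier.\<close>

definition mk :: "('x \<Rightarrow> int) \<Rightarrow> 'x \<Rightarrow> int" where
  "mk f = (\<lambda>x\<in>carrier U. f x mod int p)"

definition aff :: "('x \<Rightarrow> int) set" where
  "aff = {f \<in> carrier U \<rightarrow>\<^sub>E {0..<int p}. affine f}"

lemma mk_apply [simp]: "x \<in> carrier U \<Longrightarrow> mk f x = f x mod int p"
  by (simp add: mk_def)

lemma mk_eq_iff: "mk f = mk g \<longleftrightarrow> (\<forall>x\<in>carrier U. eqp (f x) (g x))"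
  by (auto simp: mk_def fun_eq_iff cong_def restrict_def)

lemma affineD: "affine f \<Longrightarrow> x \<in> carrier U \<Longrightarrow> y \<in> carrier U \<Longrightarrow> int p dvd f (x \<otimes> y) + f \<one> - (f x + f y)"
  by (simp add: affine_def cong_iff_dvd_diff)

lemma affineI: "(\<And>x y. x \<in> carrier U \<Longrightarrow> y \<in> carrier U \<Longrightarrow> int p dvd f (x \<otimes> y) + f \<one> - (f x + f y)) \<Longrightarrow> affine f"
  by (simp add: affine_def cong_iff_dvd_diff)

lemma affine_const [simp]: "affine (\<lambda>_. c)"
  by (rule affineI) simp

lemma affine_mk [simp]: "affine (mk f) \<longleftrightarrow> affine f"
  by (simp add: affine_def cong_def mod_simps)

lemma affine_comb:
  assumes "affine f" "affine g"
  shows "affine (\<lambda>x. c * f x + d * g x)"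
proof (rule affineI)
  fix x y assume xy: "x \<in> carrier U" "y \<in> carrier U"
  have "c * f (x \<otimes> y) + d * g (x \<otimes> y) + (c * f \<one> + d * g \<one>) - (c * f x + d * g x + (c * f y + d * g y)) =
    c * (f (x \<otimes> y) + f \<one> - (f x + f y)) + d * (g (x \<otimes> y) + g \<one> - (g x + g y))"
    by (simp add: algebra_simps)
  then show "int p dvd c * f (x \<otimes> y) + d * g (x \<otimes> y) + (c * f \<one> + d * g \<one>) - (c * f x + d * g x + (c * f y + d * g y))"
    using affineD[OF assms(1) xy] affineD[OF assms(2) xy] by (simp only: dvd_add dvd_mult)
qed

lemma affine_scale: "affine f \<Longrightarrow> affine (\<lambda>x. c * f x)"
  using affine_comb[of f "\<lambda>_. 0" c 0] by simp

lemma affine_add: "affine f \<Longrightarrow> affine g \<Longrightarrow> affine (\<lambda>x. f x + g x)"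
  using affine_comb[of f g 1 1] by simp

lemma affine_diff: "affine f \<Longrightarrow> affine g \<Longrightarrow> affine (\<lambda>x. f x - g x)"
  using affine_comb[of f g 1 "-1"] by simp

lemma affine_shift:
  assumes f: "affine f" and a: "a \<in> carrier U"
  shows "affine (\<lambda>x. f (act j x \<otimes> a))"
proof (rule affineI)
  fix x y assume xy: "x \<in> carrier U" "y \<in> carrier U"
  let ?x = "act j x" and ?y = "act j y"
  have "?x \<otimes> a \<otimes> ?y = ?x \<otimes> ?y \<otimes> a" using xy a by (simp add: m_ac)
  then have 1: "int p dvd f (?x \<otimes> ?y \<otimes> a) + f \<one> - (f (?x \<otimes> a) + f ?y)"
    using affineD[OF f, of "?x \<otimes> a" ?y] xy a by simp
  have 2: "int p dvd f (?y \<otimes> a) + f \<one> - (f ?y + f a)" using affineD[OF f, of ?y a] xy a by simp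
  have "(f (?x \<otimes> ?y \<otimes> a) + f \<one> - (f (?x \<otimes> a) + f ?y)) - (f (?y \<otimes> a) + f \<one> - (f ?y + f a)) =
     f (?x \<otimes> ?y \<otimes> a) + f a - (f (?x \<otimes> a) + f (?y \<otimes> a))" by simp
  with dvd_diff[OF 1 2] have "int p dvd f (?x \<otimes> ?y \<otimes> a) + f a - (f (?x \<otimes> a) + f (?y \<otimes> a))" by (simp only:)
  then show "int p dvd f (act j (x \<otimes> y) \<otimes> a) + f (act j \<one> \<otimes> a) - (f (act j x \<otimes> a) + f (act j y \<otimes> a))"
    using xy a by simp
qed

lemma affine_translate:
  assumes "affine f" "a \<in> carrier U"
  shows "affine (\<lambda>x. f (x \<otimes> a))"
proof -
  have "affine (\<lambda>x. f (act 0 x \<otimes> a))" by (rule affine_shift[OF assms])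
  then show ?thesis by (simp add: affine_def act_0)
qed

lemma affine_act: "affine f \<Longrightarrow> affine (\<lambda>x. f (act j x))"
  using affine_shift[of f \<one> j] by (simp add: affine_def)

lemma affine_trans: "affine f \<Longrightarrow> x \<in> carrier U \<Longrightarrow> b \<in> carrier U \<Longrightarrow> eqp (f (x \<otimes> b)) (f x + (f b - f \<one>))"
  using affineD[of f x b] by (simp add: cong_iff_dvd_diff algebra_simps)

lemma aff_affine: "f \<in> aff \<Longrightarrow> affine f"
  by (simp add: aff_def)

lemma mk_aff [simp]: "mk f \<in> aff \<longleftrightarrow> affine f"
  using p0 by (auto simp: aff_def) (auto simp: mk_def)

lemma mk_id: "f \<in> aff \<Longrightarrow> mk f = f"
  by (auto simp: aff_def mk_def fun_eq_iff restrict_def PiE_def Pi_def extensional_def)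

lemma aff_eqI:
  assumes "f \<in> aff" "g \<in> aff" "\<And>x. x \<in> carrier U \<Longrightarrow> eqp (f x) (g x)"
  shows "f = g"
  using mk_eq_iff[of f g] assms by (simp add: mk_id)

lemma aff_less: "f \<in> aff \<Longrightarrow> x \<in> carrier U \<Longrightarrow> f x mod int p = f x"
  using mk_apply[of x f] by (simp add: mk_id)

lemma finite_aff: "finite aff"
  by (rule finite_subset[of _ "carrier U \<rightarrow>\<^sub>E {0..<int p}"]) (auto simp: aff_def finU intro!: finite_PiE)

text \<open>\<open>(j, a, f)\<close> stands for the permutation \<open>(x, s) \<mapsto> (act j x \<otimes> a, z ^ j * s + f x)\<close> of \<open>U \<times> GF(p)\<close>.\<close>
definition G :: "(nat \<times> 'x \<times> ('x \<Rightarrow> int)) monoid" where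
  "G = \<lparr>carrier = {..<M} \<times> carrier U \<times> aff,
     monoid.mult = (\<lambda>(i, a, f) (j, b, g). ((i + p ^ i * j) mod M, a \<otimes> act i b,
        mk (\<lambda>x. int z ^ i * g x + f (act j x \<otimes> b)))),
     one = (0, \<one>, mk (\<lambda>_. 0))\<rparr>"

lemma G_mult: "(i, a, f) \<otimes>\<^bsub>G\<^esub> (j, b, g) =
    ((i + p ^ i * j) mod M, a \<otimes> act i b, mk (\<lambda>x. int z ^ i * g x + f (act j x \<otimes> b)))"
  by (simp add: G_def)

lemma G_carrier: "(j, a, f) \<in> carrier G \<longleftrightarrow> j < M \<and> a \<in> carrier U \<and> f \<in> aff"
  by (simp add: G_def)

lemma G_one: "\<one>\<^bsub>G\<^esub> = (0, \<one>, mk (\<lambda>_. 0))"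
  by (simp add: G_def)

lemma affine_mult: "f \<in> aff \<Longrightarrow> g \<in> aff \<Longrightarrow> b \<in> carrier U \<Longrightarrow> affine (\<lambda>x. c * g x + f (act j x \<otimes> b))"
  by (intro affine_add affine_scale affine_shift aff_affine)

lemma G_closed: "x \<in> carrier G \<Longrightarrow> y \<in> carrier G \<Longrightarrow> x \<otimes>\<^bsub>G\<^esub> y \<in> carrier G"
  using M1
  by (cases x; cases y) (auto simp: G_mult G_carrier affine_mult)

lemma G_assoc:
  assumes "x \<in> carrier G" "y \<in> carrier G" "w \<in> carrier G"
  shows "x \<otimes>\<^bsub>G\<^esub> y \<otimes>\<^bsub>G\<^esub> w = x \<otimes>\<^bsub>G\<^esub> (y \<otimes>\<^bsub>G\<^esub> w)"
proof -
  obtain i a f where x: "x = (i, a, f)" by (cases x)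
  obtain j b g where y: "y = (j, b, g)" by (cases y)
  obtain k c h where w: "w = (k, c, h)" by (cases w)
  have C: "a \<in> carrier U" "b \<in> carrier U" "c \<in> carrier U"
    using assms by (auto simp: x y w G_carrier)
  let ?ij = "(i + p ^ i * j) mod M" and ?jk = "(j + p ^ j * k) mod M"
  have "[?ij + p ^ ?ij * k = (i + p ^ i * j) + p ^ (i + j) * k] (mod M)"
    by (intro cong_add cong_mult p_pow_M idx_mod_q cong_refl) (simp add: cong_def)
  also have "(i + p ^ i * j) + p ^ (i + j) * k = i + p ^ i * (j + p ^ j * k)"
    by (simp add: power_add algebra_simps)
  also have "[\<dots> = i + p ^ i * ?jk] (mod M)" by (intro cong_add cong_mult cong_refl) (simp add: cong_def)
  finally have 1: "(?ij + p ^ ?ij * k) mod M = (i + p ^ i * ?jk) mod M" by (simp add: cong_def)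
  have 2: "a \<otimes> act i b \<otimes> act ?ij c = a \<otimes> act i (b \<otimes> act j c)"
    using C by (simp add: act_idx m_assoc)
  have 3: "eqp (int z ^ ?ij * h t + mk (\<lambda>x. int z ^ i * g x + f (act j x \<otimes> b)) (act k t \<otimes> c))
      (int z ^ i * mk (\<lambda>x. int z ^ j * h x + g (act k x \<otimes> c)) t + f (act ?jk t \<otimes> (b \<otimes> act j c)))"
    if t: "t \<in> carrier U" for t
  proof -
    have "act j (act k t \<otimes> c) \<otimes> b = act ?jk t \<otimes> (b \<otimes> act j c)"
      using C t by (simp add: act_idx m_ac)
    then have "eqp (int z ^ ?ij * h t + mk (\<lambda>x. int z ^ i * g x + f (act j x \<otimes> b)) (act k t \<otimes> c))
       (int z ^ (i + j) * h t + (int z ^ i * g (act k t \<otimes> c) + f (act ?jk t \<otimes> (b \<otimes> act j c))))"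
      using C t by (intro cong_add cong_mult z_cong idx_mod_q cong_refl) (simp add: cong_def)
    also have "int z ^ (i + j) * h t + (int z ^ i * g (act k t \<otimes> c) + f (act ?jk t \<otimes> (b \<otimes> act j c))) =
       int z ^ i * (int z ^ j * h t + g (act k t \<otimes> c)) + f (act ?jk t \<otimes> (b \<otimes> act j c))"
      by (simp add: power_add algebra_simps)
    also have "eqp \<dots> (int z ^ i * mk (\<lambda>x. int z ^ j * h x + g (act k x \<otimes> c)) t + f (act ?jk t \<otimes> (b \<otimes> act j c)))"
      using t by (intro cong_add cong_mult cong_refl) (simp add: cong_def)
    finally show ?thesis .
  qed
  show ?thesis unfolding x y w G_mult 1 2 using 3 by (simp add: mk_eq_iff)
qed

lemma G_group: "group G"
proof (rule groupI)
  show "\<one>\<^bsub>G\<^esub> \<in> carrier G" using M1 by (simp add: G_one G_carrier)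
  fix x assume x: "x \<in> carrier G"
  obtain j a f where e: "x = (j, a, f)" by (cases x)
  have C: "j < M" "a \<in> carrier U" "f \<in> aff" using x by (auto simp: e G_carrier)
  have "mk (\<lambda>t. int z ^ 0 * f t + mk (\<lambda>_. 0) (act j t \<otimes> a)) = mk f"
    using C by (simp add: mk_eq_iff)
  then show "\<one>\<^bsub>G\<^esub> \<otimes>\<^bsub>G\<^esub> x = x" using C by (simp add: e G_one G_mult act_0 mk_id)
  \<comment> \<open>The inverse permutation: \<open>?b\<close> undoes the translation after rotating
    back, and \<open>?g\<close> subtracts \<open>f\<close> at the preimage, scaled by the inverse
    rotation.\<close>
  let ?i = "idx_inv j" and ?b = "inv (act (idx_inv j) a)"
  let ?g = "mk (\<lambda>t. - (int z ^ ?i) * f (act ?i t \<otimes> ?b))"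
  have "affine (\<lambda>t. - (int z ^ ?i) * f (act ?i t \<otimes> ?b))"
    using C by (intro affine_scale affine_shift aff_affine) auto
  then have y: "(?i, ?b, ?g) \<in> carrier G" using C idx_inv_less[of j] by (simp add: G_carrier)
  have "mk (\<lambda>t. int z ^ ?i * f t + ?g (act j t \<otimes> a)) = mk (\<lambda>_. 0)"
    unfolding mk_eq_iff
  proof
    fix t assume t: "t \<in> carrier U"
    have "act ?i (act j t \<otimes> a) \<otimes> ?b = t" using C t by (simp add: act_idx_inv m_assoc)
    then show "eqp (int z ^ ?i * f t + ?g (act j t \<otimes> a)) 0"
      using C t by (simp add: cong_def mod_simps)
  qed
  then have "(?i, ?b, ?g) \<otimes>\<^bsub>G\<^esub> x = \<one>\<^bsub>G\<^esub>"
    using C idx_inv[OF C(1)] by (simp add: e G_mult G_one)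
  then show "\<exists>y\<in>carrier G. y \<otimes>\<^bsub>G\<^esub> x = \<one>\<^bsub>G\<^esub>" using y by blast
qed (simp_all add: G_closed G_assoc)

lemma G_finite: "finite (carrier G)"
  by (simp add: G_def finU finite_aff)

end

section \<open>Subgroups and commutators\<close>

text \<open>In a finite group inverses are powers, so closure under products suffices and no inverse
  in \<open>G\<close> has to be computed.\<close>

lemma finite_subgroupI:
  fixes G (structure)
  assumes "group G" "finite (carrier G)" "K \<subseteq> carrier G" "\<one> \<in> K" "\<And>x y. x \<in> K \<Longrightarrow> y \<in> K \<Longrightarrow> x \<otimes> y \<in> K"
  shows "subgroup K G"
proof -
  interpret group G by fact
  show ?thesis
  proof (rule subgroupI)
    fix x assume x: "x \<in> K"
    then have xc: "x \<in> carrier G" using assms(3) by auto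
    have pow: "x [^] n \<in> K" for n :: nat by (induction n) (use x assms(4,5) in auto)
    have "card (carrier G) > 0" using assms(2) one_closed by (auto simp: card_gt_0_iff)
    then have "card (carrier G) = Suc (card (carrier G) - 1)" by simp
    then have "x [^] (card (carrier G) - 1) \<otimes> x = \<one>"
      using pow_order_eq_1[OF xc] nat_pow_Suc[of x "card (carrier G) - 1"] by (simp add: Coset.order_def)
    then have "inv x = x [^] (card (carrier G) - 1)" using xc by (intro inv_equality) auto
    then show "inv x \<in> K" using pow by simp
  qed (use assms in auto)
qed

lemma normalI_swap:
  fixes G (structure)
  assumes "group G" "subgroup K G"
    and "\<And>g h. g \<in> carrier G \<Longrightarrow> h \<in> K \<Longrightarrow> \<exists>h'\<in>K. h \<otimes> g = g \<otimes> h'"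
  shows "K \<lhd> G"
proof -
  interpret group G by fact
  show ?thesis unfolding normal_inv_iff
  proof (intro conjI ballI)
    fix x h assume x: "x \<in> carrier G" and h: "h \<in> K"
    have hc: "h \<in> carrier G" using h subgroup.mem_carrier[OF assms(2)] by auto
    obtain h' where h': "h' \<in> K" "h \<otimes> inv x = inv x \<otimes> h'" using assms(3)[of "inv x" h] x h by auto
    have "h' \<in> carrier G" using h' subgroup.mem_carrier[OF assms(2)] by auto
    then have "x \<otimes> h \<otimes> inv x = h'" using x hc h'(2) by (simp add: m_assoc) (simp flip: m_assoc)
    then show "x \<otimes> h \<otimes> inv x \<in> K" using h' by simp
  qed fact
qed

text \<open>The commutators of \<open>K\<close> lie in \<open>L\<close>, again without
  inverses.\<close>

definition commute_mod :: "('a, 'b) monoid_scheme \<Rightarrow> 'a set \<Rightarrow> 'a set \<Rightarrow> bool" where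
  "commute_mod G K L \<longleftrightarrow> (\<forall>x\<in>K. \<forall>y\<in>K. \<exists>e\<in>L. x \<otimes>\<^bsub>G\<^esub> y = y \<otimes>\<^bsub>G\<^esub> x \<otimes>\<^bsub>G\<^esub> e)"

lemma commute_modD:
  fixes G (structure)
  assumes "group G" "subgroup K G" "L \<subseteq> carrier G" "commute_mod G K L" "x \<in> K" "y \<in> K"
  shows "x \<otimes> y \<otimes> inv x \<otimes> inv y \<in> L"
proof -
  interpret group G by fact
  have xy: "x \<in> carrier G" "y \<in> carrier G" "inv x \<in> K" "inv y \<in> K"
    using assms(5,6) subgroup.mem_carrier[OF assms(2)] subgroup.m_inv_closed[OF assms(2)] by auto
  obtain e where e: "e \<in> L" "inv x \<otimes> inv y = inv y \<otimes> inv x \<otimes> e"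
    using assms(4) xy(3,4) by (auto simp: commute_mod_def)
  have ec: "e \<in> carrier G" using e assms(3) by auto
  have "x \<otimes> y \<otimes> inv x \<otimes> inv y = x \<otimes> y \<otimes> (inv x \<otimes> inv y)" using xy by (simp add: m_assoc)
  also have "\<dots> = x \<otimes> (y \<otimes> inv y) \<otimes> inv x \<otimes> e" unfolding e(2) using xy ec by (simp only: m_assoc inv_closed m_closed)
  also have "\<dots> = e" using xy ec by simp
  finally show ?thesis using e by simp
qed

lemma derived_subset:
  assumes "group G" "subgroup K G" "subgroup L G" "commute_mod G K L"
  shows "derived G K \<subseteq> L"
  unfolding derived_def
  using commute_modD[OF assms(1,2) subgroup.subset[OF assms(3)] assms(4)]
  by (intro group.generate_subgroup_incl[OF assms(1) _ assms(3)]) auto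

lemma lower_central_one_subset:
  assumes "group G" "subgroup K G" "subgroup L G" "commute_mod G K L" "L \<subseteq> K"
  shows "lower_central (G\<lparr>carrier := K\<rparr>) 1 \<subseteq> L"
proof -
  interpret K: group "G\<lparr>carrier := K\<rparr>" using group.subgroup_imp_group assms by blast
  have sub: "subgroup L (G\<lparr>carrier := K\<rparr>)"
    using assms(1-3,5) group.subgroup_incl by blast
  have inv: "x \<in> K \<Longrightarrow> inv\<^bsub>G\<lparr>carrier := K\<rparr>\<^esub> x = inv\<^bsub>G\<^esub> x" for x
    using group.m_inv_consistent[OF assms(1,2)] by blast
  show ?thesis
    using commute_modD[OF assms(1,2) subgroup.subset[OF assms(3)] assms(4)]
    unfolding One_nat_def lower_central.simps
    by (intro K.generate_subgroup_incl[OF _ sub]) (auto simp: inv)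
qed

lemma commutator_in_derived:
  fixes G (structure)
  assumes "group G" "subgroup K G" "x \<in> K" "y \<in> K" "e \<in> carrier G" "x \<otimes> y = y \<otimes> x \<otimes> e"
  shows "e \<in> derived G K"
proof -
  interpret group G by fact
  have xy: "x \<in> carrier G" "y \<in> carrier G" "inv x \<in> K" "inv y \<in> K"
    using assms(3,4) subgroup.mem_carrier[OF assms(2)] subgroup.m_inv_closed[OF assms(2)] by auto
  have "e = inv (y \<otimes> x) \<otimes> (x \<otimes> y)" using xy assms(5,6) by (simp add: inv_solve_left)
  also have "\<dots> = inv x \<otimes> inv y \<otimes> inv (inv x) \<otimes> inv (inv y)"
    using xy by (simp add: inv_mult_group m_assoc)
  finally show ?thesis unfolding derived_def using xy(3,4) by (intro generate.incl) blast
qed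

text \<open>The generators of \<open>lower_central\<close> are x y x^-1 y^-1, so the correction
  \<open>c\<close> stands on the left. In \<open>commutator_in_derived\<close> it stands on the
  right and is the commutator of the inverses.\<close>

lemma commutator_in_lower_central:
  fixes G (structure)
  assumes "group G" "subgroup K G" "x \<in> lower_central (G\<lparr>carrier := K\<rparr>) i" "y \<in> K" "c \<in> carrier G"
    "x \<otimes> y = c \<otimes> (y \<otimes> x)"
  shows "c \<in> lower_central (G\<lparr>carrier := K\<rparr>) (Suc i)"
proof -
  interpret group G by fact
  have "group (G\<lparr>carrier := K\<rparr>)" using subgroup_imp_group assms(2) by blast
  then have xK: "x \<in> K" using lower_central_subset assms(3) by fastforce
  then have xy: "x \<in> carrier G" "y \<in> carrier G" using assms(4) subgroup.mem_carrier[OF assms(2)] by auto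
  have "c = x \<otimes> y \<otimes> inv (y \<otimes> x)" using xy assms(5,6) by (simp add: inv_solve_right)
  also have "\<dots> = x \<otimes> y \<otimes> inv x \<otimes> inv y" using xy by (simp add: inv_mult_group m_assoc)
  also have "\<dots> = x \<otimes> y \<otimes> inv\<^bsub>G\<lparr>carrier := K\<rparr>\<^esub> x \<otimes> inv\<^bsub>G\<lparr>carrier := K\<rparr>\<^esub> y"
    using m_inv_consistent[OF assms(2)] xK assms(4) by simp
  finally show ?thesis unfolding lower_central.simps using assms(3,4) by (intro generate.incl) auto
qed

section \<open>The normal subgroups of \<open>G\<close> and their commutators\<close>

context frobenius_module
begin

sublocale GG: group G by (rule G_group)

text \<open>In the notation of the header, \<open>Cs\<close> is \<open>P C\<close>, \<open>As\<close> is \<open>N C\<close>, and \<open>Es\<close> is generated by \<open>F\<close>, its dual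
  and \<open>Z\<close>.\<close>
definition Ps where "Ps = {(0::nat, a, f) | a f. a \<in> carrier U \<and> f \<in> aff}"
definition Ns where "Ns = {(0::nat, \<one>, f) | f. f \<in> aff}"
definition Zs where "Zs = {(0::nat, \<one>, mk (\<lambda>_. c)) | c. True}"
definition Es where "Es = {(0::nat, v, f) | v f. v \<in> V \<and> f \<in> aff \<and> (\<forall>d\<in>D. f d = f \<one>)}"
definition Cs where "Cs = {(j, a, f) | j a f. (j, a, f) \<in> carrier G \<and> q dvd j}"
definition As where "As = {(j, \<one>, f) | j f. (j, \<one>, f) \<in> carrier G \<and> q dvd j}"

lemma V_carrier: "v \<in> V \<Longrightarrow> v \<in> carrier U"
  using subgroup.mem_carrier[OF V] .

lemma D_carrier: "d \<in> D \<Longrightarrow> d \<in> carrier U"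
  using D by auto

lemma P_mult:
  assumes "a \<in> carrier U" "b \<in> carrier U"
  shows "(0, a, f) \<otimes>\<^bsub>G\<^esub> (0, b, g) = (0, a \<otimes> b, mk (\<lambda>x. g x + f (x \<otimes> b)))"
  using assms by (simp add: G_mult act_0 mk_eq_iff)

lemma subsets: "Zs \<subseteq> Ns" "Ns \<subseteq> Ps" "Zs \<subseteq> Es" "Es \<subseteq> Ps" "Ps \<subseteq> Cs" "Ns \<subseteq> As" "As \<subseteq> Cs" "Cs \<subseteq> carrier G"
proof -
  show "Zs \<subseteq> Ns" "Ns \<subseteq> Ps" by (auto simp: Zs_def Ns_def Ps_def)
  show "Zs \<subseteq> Es" using subgroup.one_closed[OF V] D_carrier by (auto simp: Zs_def Es_def)
  show "Es \<subseteq> Ps" using V_carrier by (auto simp: Es_def Ps_def)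
  show "Ps \<subseteq> Cs" using M1 by (auto simp: Ps_def Cs_def G_carrier)
  show "Ns \<subseteq> As" using M1 by (auto simp: Ns_def As_def G_carrier)
  show "As \<subseteq> Cs" "Cs \<subseteq> carrier G" by (auto simp: As_def Cs_def)
qed

lemma affine_trans': "affine f \<Longrightarrow> x \<in> carrier U \<Longrightarrow> b \<in> carrier U \<Longrightarrow> eqp (f (x \<otimes> b) - f b) (f x - f \<one>)"
  using affineD[of f x b] by (simp add: cong_iff_dvd_diff algebra_simps)

lemma fst_mult_mod_q: "x \<in> carrier G \<Longrightarrow> y \<in> carrier G \<Longrightarrow> [fst (x \<otimes>\<^bsub>G\<^esub> y) = fst x + fst y] (mod q)"
  using idx_mod_q by (cases x; cases y) (simp add: G_mult)

lemma subgroup_Zs: "subgroup Zs G"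
proof (rule finite_subgroupI[OF G_group G_finite])
  show "Zs \<subseteq> carrier G" using subsets by blast
  show "\<one>\<^bsub>G\<^esub> \<in> Zs" by (auto simp: Zs_def G_one)
  show "x \<otimes>\<^bsub>G\<^esub> y \<in> Zs" if "x \<in> Zs" "y \<in> Zs" for x y
  proof -
    obtain c d where xy: "x = (0, \<one>, mk (\<lambda>_. c))" "y = (0, \<one>, mk (\<lambda>_. d))" using \<open>x \<in> Zs\<close> \<open>y \<in> Zs\<close> by (auto simp: Zs_def)
    have "x \<otimes>\<^bsub>G\<^esub> y = (0, \<one>, mk (\<lambda>_. d + c))" unfolding xy by (simp add: P_mult mk_eq_iff cong_def mod_simps)
    then show ?thesis by (auto simp: Zs_def)
  qed
qed

lemma affine_add_translate: "f \<in> aff \<Longrightarrow> g \<in> aff \<Longrightarrow> b \<in> carrier U \<Longrightarrow> affine (\<lambda>x. g x + f (x \<otimes> b))"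
  by (intro affine_add affine_translate aff_affine)

lemma subgroup_Ns: "subgroup Ns G"
proof (rule finite_subgroupI[OF G_group G_finite])
  show "Ns \<subseteq> carrier G" using subsets by blast
  show "\<one>\<^bsub>G\<^esub> \<in> Ns" by (auto simp: Ns_def G_one)
  show "x \<otimes>\<^bsub>G\<^esub> y \<in> Ns" if "x \<in> Ns" "y \<in> Ns" for x y
    using that by (auto simp: Ns_def P_mult affine_add_translate)
qed

lemma subgroup_Ps: "subgroup Ps G"
proof (rule finite_subgroupI[OF G_group G_finite])
  show "Ps \<subseteq> carrier G" using subsets by blast
  show "\<one>\<^bsub>G\<^esub> \<in> Ps" by (auto simp: Ps_def G_one)
  show "x \<otimes>\<^bsub>G\<^esub> y \<in> Ps" if "x \<in> Ps" "y \<in> Ps" for x y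
    using that by (auto simp: Ps_def P_mult affine_add_translate)
qed

lemma subgroup_Es: "subgroup Es G"
proof (rule finite_subgroupI[OF G_group G_finite])
  show "Es \<subseteq> carrier G" using subsets by blast
  show "\<one>\<^bsub>G\<^esub> \<in> Es" using subgroup.one_closed[OF V] D_carrier by (auto simp: Es_def G_one)
  show "x \<otimes>\<^bsub>G\<^esub> y \<in> Es" if xy: "x \<in> Es" "y \<in> Es" for x y
  proof -
    obtain a f where x: "x = (0, a, f)" "a \<in> V" "f \<in> aff" "\<forall>d\<in>D. f d = f \<one>" using xy(1) by (auto simp: Es_def)
    obtain b g where y: "y = (0, b, g)" "b \<in> V" "g \<in> aff" "\<forall>d\<in>D. g d = g \<one>" using xy(2) by (auto simp: Es_def)
    note c = V_carrier[OF x(2)] V_carrier[OF y(2)]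
    have "(g d + f (d \<otimes> b)) mod int p = (g \<one> + f b) mod int p" if d: "d \<in> D" for d
    proof -
      have "eqp (g d + f (d \<otimes> b)) (g \<one> + (f d + (f b - f \<one>)))"
        using d y by (intro cong_add affine_trans aff_affine x c D_carrier) auto
      then show ?thesis using d x by (simp add: cong_def)
    qed
    then have "\<forall>d\<in>D. mk (\<lambda>x. g x + f (x \<otimes> b)) d = mk (\<lambda>x. g x + f (x \<otimes> b)) \<one>"
      using D_carrier c by simp
    then show ?thesis using x y c subgroup.m_closed[OF V x(2) y(2)]
      by (simp add: Es_def P_mult affine_add_translate)
  qed
qed

lemma subgroup_Cs: "subgroup Cs G"
proof (rule finite_subgroupI[OF G_group G_finite])
  show "Cs \<subseteq> carrier G" using subsets by blast
  show "\<one>\<^bsub>G\<^esub> \<in> Cs" using GG.one_closed by (auto simp: Cs_def G_one)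
  show "x \<otimes>\<^bsub>G\<^esub> y \<in> Cs" if "x \<in> Cs" "y \<in> Cs" for x y
  proof -
    have xy: "x \<in> carrier G" "y \<in> carrier G" "q dvd fst x" "q dvd fst y" using that by (auto simp: Cs_def)
    then have "q dvd fst (x \<otimes>\<^bsub>G\<^esub> y)" using fst_mult_mod_q[of x y] by (simp add: cong_dvd_iff)
    moreover have "x \<otimes>\<^bsub>G\<^esub> y \<in> carrier G" using xy by simp
    ultimately show ?thesis by (cases "x \<otimes>\<^bsub>G\<^esub> y") (auto simp: Cs_def)
  qed
qed

lemma Cs_iff: "x \<in> Cs \<longleftrightarrow> x \<in> carrier G \<and> q dvd fst x"
  by (cases x) (auto simp: Cs_def)

lemma subgroup_As: "subgroup As G"
proof (rule finite_subgroupI[OF G_group G_finite])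
  show "As \<subseteq> carrier G" using subsets by blast
  show "\<one>\<^bsub>G\<^esub> \<in> As" using GG.one_closed by (auto simp: As_def G_one)
  show "x \<otimes>\<^bsub>G\<^esub> y \<in> As" if "x \<in> As" "y \<in> As" for x y
  proof -
    have "x \<otimes>\<^bsub>G\<^esub> y \<in> Cs" using that subsets(7) subgroup.m_closed[OF subgroup_Cs] by blast
    moreover have "fst (snd (x \<otimes>\<^bsub>G\<^esub> y)) = \<one>" using that by (auto simp: As_def G_mult)
    ultimately show ?thesis by (cases "x \<otimes>\<^bsub>G\<^esub> y") (auto simp: As_def Cs_def)
  qed
qed

text \<open>Solves \<open>h \<otimes> g = g \<otimes> h'\<close> for \<open>h'\<close>: the
  translation is rotated back, and \<open>w\<close> results from isolating the function component
  and dividing by \<open>z ^ j\<close>. Normality of \<open>Ps\<close>, \<open>Ns\<close>,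
  \<open>Zs\<close> and \<open>Es\<close> is read off from it.\<close>

lemma conj_P:
  assumes g: "(j, a, f) \<in> carrier G" and b: "b \<in> carrier U" and u: "u \<in> aff"
  defines "c \<equiv> act (idx_inv j) b"
  defines "w \<equiv> mk (\<lambda>x. int z ^ ((q - 1) * j) * ((f x - f (x \<otimes> c)) + u (act j x \<otimes> a)))"
  shows "(0, b, u) \<otimes>\<^bsub>G\<^esub> (j, a, f) = (j, a, f) \<otimes>\<^bsub>G\<^esub> (0, c, w)" "w \<in> aff"
proof -
  have C: "j < M" "a \<in> carrier U" "f \<in> aff" using g by (auto simp: G_carrier)
  have c: "c \<in> carrier U" "act j c = b" using b C by (simp_all add: c_def act_surj)
  show "w \<in> aff" unfolding w_def mk_aff
    using C c u by (intro affine_scale affine_add affine_diff affine_shift affine_translate aff_affine)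
  have "mk (\<lambda>x. int z ^ 0 * f x + u (act j x \<otimes> a)) = mk (\<lambda>x. int z ^ j * w x + f (act 0 x \<otimes> c))"
    unfolding mk_eq_iff
  proof
    fix x assume x: "x \<in> carrier U"
    let ?s = "(f x - f (x \<otimes> c)) + u (act j x \<otimes> a)"
    have "eqp (int z ^ j * w x) (int z ^ j * (int z ^ ((q - 1) * j) * ?s))"
      using x by (intro cong_mult cong_refl) (simp add: w_def cong_def)
    also have "int z ^ j * (int z ^ ((q - 1) * j) * ?s) = (int z ^ ((q - 1) * j) * int z ^ j) * ?s" by simp
    also have "eqp \<dots> (1 * ?s)" by (intro cong_mult z_inv cong_refl)
    finally have "eqp (int z ^ j * w x + f (act 0 x \<otimes> c)) (1 * ?s + f (act 0 x \<otimes> c))" by (intro cong_add cong_refl)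
    then show "eqp (int z ^ 0 * f x + u (act j x \<otimes> a)) (int z ^ j * w x + f (act 0 x \<otimes> c))"
      using x by (simp add: act_0 cong_sym_eq algebra_simps)
  qed
  then show "(0, b, u) \<otimes>\<^bsub>G\<^esub> (j, a, f) = (j, a, f) \<otimes>\<^bsub>G\<^esub> (0, c, w)"
    using C b c by (simp add: G_mult act_0 m_comm)
qed

lemma normal_Ps: "Ps \<lhd> G"
proof (rule normalI_swap[OF G_group subgroup_Ps])
  fix g h assume g: "g \<in> carrier G" and "h \<in> Ps"
  then obtain b u where h: "h = (0, b, u)" "b \<in> carrier U" "u \<in> aff" by (auto simp: Ps_def)
  obtain j a f where e: "g = (j, a, f)" by (cases g)
  obtain w where w: "w \<in> aff" "(0, b, u) \<otimes>\<^bsub>G\<^esub> g = g \<otimes>\<^bsub>G\<^esub> (0, act (idx_inv j) b, w)"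
    using conj_P[OF g[unfolded e] h(2,3)] unfolding e by blast
  have "(0, act (idx_inv j) b, w) \<in> Ps" using w(1) h(2) by (simp add: Ps_def)
  then show "\<exists>h'\<in>Ps. h \<otimes>\<^bsub>G\<^esub> g = g \<otimes>\<^bsub>G\<^esub> h'" using w(2) unfolding h(1) by blast
qed

lemma normal_Ns: "Ns \<lhd> G"
proof (rule normalI_swap[OF G_group subgroup_Ns])
  fix g h assume g: "g \<in> carrier G" and "h \<in> Ns"
  then obtain u where h: "h = (0, \<one>, u)" "u \<in> aff" by (auto simp: Ns_def)
  obtain j a f where e: "g = (j, a, f)" by (cases g)
  obtain w where w: "w \<in> aff" "(0, \<one>, u) \<otimes>\<^bsub>G\<^esub> g = g \<otimes>\<^bsub>G\<^esub> (0, act (idx_inv j) \<one>, w)"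
    using conj_P[OF g[unfolded e] one_closed h(2)] unfolding e by blast
  have "(0, act (idx_inv j) \<one>, w) \<in> Ns" using w(1) by (simp add: Ns_def)
  then show "\<exists>h'\<in>Ns. h \<otimes>\<^bsub>G\<^esub> g = g \<otimes>\<^bsub>G\<^esub> h'" using w(2) unfolding h(1) by blast
qed

lemma normal_Zs: "Zs \<lhd> G"
proof (rule normalI_swap[OF G_group subgroup_Zs])
  fix g h assume g: "g \<in> carrier G" and "h \<in> Zs"
  then obtain c where h: "h = (0, \<one>, mk (\<lambda>_. c))" by (auto simp: Zs_def)
  obtain j a f where e: "g = (j, a, f)" by (cases g)
  have a: "a \<in> carrier U" using g by (simp add: e G_carrier)
  have "mk (\<lambda>x. int z ^ ((q - 1) * j) * ((f x - f (x \<otimes> act (idx_inv j) \<one>)) + mk (\<lambda>_. c) (act j x \<otimes> a))) =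
     mk (\<lambda>_. int z ^ ((q - 1) * j) * c)"
    using a by (auto simp: mk_eq_iff cong_def mod_simps)
  then show "\<exists>h'\<in>Zs. h \<otimes>\<^bsub>G\<^esub> g = g \<otimes>\<^bsub>G\<^esub> h'"
    using conj_P(1)[OF g[unfolded e] one_closed, of "mk (\<lambda>_. c)"] unfolding e h by (auto simp: Zs_def)
qed

lemma normal_Es: "Es \<lhd> G"
proof (rule normalI_swap[OF G_group subgroup_Es])
  fix g h assume g: "g \<in> carrier G" and "h \<in> Es"
  then obtain b u where h: "h = (0, b, u)" "b \<in> V" "u \<in> aff" "\<forall>d\<in>D. u d = u \<one>" by (auto simp: Es_def)
  obtain j a f where e: "g = (j, a, f)" by (cases g)
  have C: "j < M" "a \<in> carrier U" "f \<in> aff" using g by (auto simp: e G_carrier)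
  let ?c = "act (idx_inv j) b"
  let ?w = "\<lambda>x. int z ^ ((q - 1) * j) * ((f x - f (x \<otimes> ?c)) + u (act j x \<otimes> a))"
  have c: "?c \<in> V" "?c \<in> carrier U" using act_V[OF h(2)] V_carrier by auto
  have "eqp (?w d) (?w \<one>)" if d: "d \<in> D" for d
  proof (intro cong_mult cong_add cong_refl)
    note dc = D_carrier[OF d]
    have "eqp (f d - f (d \<otimes> ?c)) (f d - (f d + (f ?c - f \<one>)))"
      by (intro cong_diff cong_refl affine_trans aff_affine C dc c)
    then show "eqp (f d - f (d \<otimes> ?c)) (f \<one> - f (\<one> \<otimes> ?c))" using c by simp
    have "eqp (u (d \<otimes> a)) (u d + (u a - u \<one>))" by (intro affine_trans aff_affine h dc C)
    then show "eqp (u (act j d \<otimes> a)) (u (act j \<one> \<otimes> a))" using d C h(4) by (simp add: act_D)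
  qed
  then have "\<forall>d\<in>D. mk ?w d = mk ?w \<one>" using D_carrier by (simp add: cong_def)
  then show "\<exists>h'\<in>Es. h \<otimes>\<^bsub>G\<^esub> g = g \<otimes>\<^bsub>G\<^esub> h'"
    using conj_P[OF g[unfolded e] V_carrier[OF h(2)] h(3)] c(1) unfolding e h(1) Es_def by blast
qed

lemma normal_Cs: "Cs \<lhd> G"
proof (rule normalI_swap[OF G_group subgroup_Cs])
  fix g h assume g: "g \<in> carrier G" and h: "h \<in> Cs"
  then have hc: "h \<in> carrier G" by (simp add: Cs_iff)
  let ?h = "inv\<^bsub>G\<^esub> g \<otimes>\<^bsub>G\<^esub> h \<otimes>\<^bsub>G\<^esub> g"
  have e: "h \<otimes>\<^bsub>G\<^esub> g = g \<otimes>\<^bsub>G\<^esub> ?h" using g hc by (simp add: GG.m_assoc[symmetric])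
  have "[fst g + fst ?h = fst (g \<otimes>\<^bsub>G\<^esub> ?h)] (mod q)" using g hc by (intro cong_sym[OF fst_mult_mod_q]) auto
  also have "[fst (g \<otimes>\<^bsub>G\<^esub> ?h) = fst h + fst g] (mod q)" unfolding e[symmetric] using fst_mult_mod_q[OF hc g] .
  also have "[fst h + fst g = 0 + fst g] (mod q)" using h by (intro cong_add cong_refl) (simp add: Cs_iff cong_0_iff)
  finally have "[fst ?h + fst g = 0 + fst g] (mod q)" by (simp add: add.commute)
  then have "q dvd fst ?h" by (simp only: cong_add_rcancel_nat cong_0_iff)
  then show "\<exists>h'\<in>Cs. h \<otimes>\<^bsub>G\<^esub> g = g \<otimes>\<^bsub>G\<^esub> h'" using e g hc by (intro bexI[of _ ?h]) (auto simp: Cs_iff)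
qed

text \<open>\<open>fst\<close> modulo \<open>q\<close> is a homomorphism to an abelian group, so a
  commutator has index divisible by \<open>q\<close>.\<close>

lemma commute_carrier: "commute_mod G (carrier G) Cs"
  unfolding commute_mod_def
proof (intro ballI)
  fix x y assume xy: "x \<in> carrier G" "y \<in> carrier G"
  let ?e = "inv\<^bsub>G\<^esub> (y \<otimes>\<^bsub>G\<^esub> x) \<otimes>\<^bsub>G\<^esub> (x \<otimes>\<^bsub>G\<^esub> y)"
  have e: "x \<otimes>\<^bsub>G\<^esub> y = y \<otimes>\<^bsub>G\<^esub> x \<otimes>\<^bsub>G\<^esub> ?e" using xy by (simp add: GG.m_assoc[symmetric])
  have "[fst x + fst y + fst ?e = fst (y \<otimes>\<^bsub>G\<^esub> x) + fst ?e] (mod q)"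
    using cong_sym[OF fst_mult_mod_q[OF xy(2,1)]] by (intro cong_add cong_refl) (simp add: add.commute)
  also have "[fst (y \<otimes>\<^bsub>G\<^esub> x) + fst ?e = fst (y \<otimes>\<^bsub>G\<^esub> x \<otimes>\<^bsub>G\<^esub> ?e)] (mod q)"
    using xy by (intro cong_sym[OF fst_mult_mod_q]) auto
  also have "y \<otimes>\<^bsub>G\<^esub> x \<otimes>\<^bsub>G\<^esub> ?e = x \<otimes>\<^bsub>G\<^esub> y" by (rule e[symmetric])
  also have "[fst (x \<otimes>\<^bsub>G\<^esub> y) = fst x + fst y + 0] (mod q)" using fst_mult_mod_q[OF xy] by simp
  finally have "q dvd fst ?e" by (simp only: cong_add_lcancel_nat cong_0_iff)
  then show "\<exists>e\<in>Cs. x \<otimes>\<^bsub>G\<^esub> y = y \<otimes>\<^bsub>G\<^esub> x \<otimes>\<^bsub>G\<^esub> e" using e xy by (intro bexI[of _ ?e]) (auto simp: Cs_iff)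
qed

text \<open>The \<open>D\<close> part of \<open>x\<close> is fixed by the action and
  cancels.\<close>

lemma act_quotient_V:
  assumes "x \<in> carrier U"
  shows "act j x \<otimes> inv x \<in> V"
proof -
  obtain v d where vd: "v \<in> V" "d \<in> D" "x = v \<otimes> d" using VD[OF assms] by blast
  note c = V_carrier[OF vd(1)] D_carrier[OF vd(2)]
  have "act j x \<otimes> inv x = act j v \<otimes> d \<otimes> (inv v \<otimes> inv d)" using c vd by (simp add: act_D inv_mult)
  also have "\<dots> = act j v \<otimes> inv v \<otimes> (d \<otimes> inv d)" using c by (simp only: m_ac inv_closed act_closed m_closed)
  also have "\<dots> = act j v \<otimes> inv v" using c by simp
  finally have "act j x \<otimes> inv x = act j v \<otimes> inv v" .
  then show ?thesis using act_V[OF vd(1)] vd(1) subgroup.m_closed[OF V] subgroup.m_inv_closed[OF V] by simp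
qed

text \<open>C is commutative, so commutators have no rotation part. It fixes \<open>D\<close>, so
  their translation part lies in \<open>V\<close>. As \<open>z ^ i\<close> is 1 for
  \<open>q dvd i\<close>, it also acts trivially on linear functionals restricted to
  \<open>D\<close>, so their function part is constant there.\<close>

lemma commute_Cs: "commute_mod G Cs Es"
  unfolding commute_mod_def
proof (intro ballI)
  fix x y assume "x \<in> Cs" "y \<in> Cs"
  then obtain i a f j b g where x: "x = (i, a, f)" "(i, a, f) \<in> carrier G" "q dvd i"
    and y: "y = (j, b, g)" "(j, b, g) \<in> carrier G" "q dvd j" by (auto simp: Cs_def)
  have C: "a \<in> carrier U" "f \<in> aff" "b \<in> carrier U" "g \<in> aff" using x y by (auto simp: G_carrier)
  let ?e = "inv\<^bsub>G\<^esub> (y \<otimes>\<^bsub>G\<^esub> x) \<otimes>\<^bsub>G\<^esub> (x \<otimes>\<^bsub>G\<^esub> y)"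
  have ec: "?e \<in> carrier G" using x y by simp
  obtain k v h where kvh: "?e = (k, v, h)" by (cases ?e)
  have K: "k < M" "v \<in> carrier U" "h \<in> aff" using ec by (auto simp: kvh G_carrier)
  have e: "x \<otimes>\<^bsub>G\<^esub> y = y \<otimes>\<^bsub>G\<^esub> x \<otimes>\<^bsub>G\<^esub> ?e" using x y by (simp add: GG.m_assoc[symmetric])
  let ?m = "(i + j) mod M"
  let ?F = "\<lambda>t. int z ^ j * f t + g (act i t \<otimes> a)"
  let ?H = "\<lambda>t. int z ^ i * g t + f (act j t \<otimes> b)"
  have qm: "q dvd ?m" using x y by (simp add: mod_M_dvd)
  have xy: "x \<otimes>\<^bsub>G\<^esub> y = (?m, a \<otimes> act i b, mk ?H)" using x y by (simp add: G_mult idx_M)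
  have yx: "y \<otimes>\<^bsub>G\<^esub> x = (?m, b \<otimes> act j a, mk ?F)" using x y by (simp add: G_mult idx_M add.commute)
  have eq: "?m = (?m + k) mod M" "a \<otimes> act i b = b \<otimes> act j a \<otimes> act ?m v"
    "mk ?H = mk (\<lambda>t. int z ^ ?m * h t + mk ?F (act k t \<otimes> v))"
    using e[unfolded kvh] unfolding xy yx G_mult idx_M[OF qm] by auto
  have "[?m + k = ?m + 0] (mod M)" using eq(1) by (simp add: cong_def)
  then have k: "k = 0" using K(1) by (simp only: cong_add_lcancel_nat) (simp add: cong_def)
  have "act ?m v = (act i b \<otimes> inv b) \<otimes> inv (act j a \<otimes> inv a)"
  proof -
    have "(act i b \<otimes> inv b) \<otimes> inv (act j a \<otimes> inv a) = inv (b \<otimes> act j a) \<otimes> (a \<otimes> act i b)"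
      using C by (simp add: inv_mult m_ac)
    also have "\<dots> = act ?m v"
    proof -
      have "inv w \<otimes> (w \<otimes> y) = y" if "w \<in> carrier U" "y \<in> carrier U" for w y
        using that by (simp add: m_assoc[symmetric])
      then show ?thesis unfolding eq(2) using C K by simp
    qed
    finally show ?thesis by simp
  qed
  \<comment> \<open>The equation determines \<open>v\<close> only after a rotation by
    \<open>?m\<close>; rotating back stays in \<open>V\<close>.\<close>
  then have "act ?m v \<in> V"
    using act_quotient_V C subgroup.m_closed[OF V] subgroup.m_inv_closed[OF V] by simp
  moreover have "act (idx_inv ?m) (act ?m v) = v" using M1 K by (intro act_idx_inv) auto
  ultimately have vV: "v \<in> V" using act_V by metis
  have affF: "affine ?F" "affine ?H" using C by (auto intro: affine_mult)
  have hH: "eqp (h t) (?H t - ?F (t \<otimes> v))" if t: "t \<in> carrier U" for t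
  proof -
    have "eqp (?H t) (int z ^ ?m * h t + mk ?F (act k t \<otimes> v))" using eq(3) t unfolding mk_eq_iff by blast
    also have "eqp (int z ^ ?m * h t + mk ?F (act k t \<otimes> v)) (1 * h t + ?F (t \<otimes> v))"
      using t K by (intro cong_add cong_mult z_one qm cong_refl) (simp add: k act_0 cong_def)
    finally have "eqp (?H t - ?F (t \<otimes> v)) (1 * h t + ?F (t \<otimes> v) - ?F (t \<otimes> v))" by (intro cong_diff cong_refl)
    then show ?thesis by (simp add: cong_sym_eq)
  qed
  \<comment> \<open>On \<open>D\<close> rotations are the identity, and the powers of
    \<open>z\<close> are 1 here; translations do not affect differences of an affine function. So
    the increments of \<open>f\<close> and of \<open>g\<close> from \<open>\<one>\<close> to
    \<open>d\<close> each occur with both signs.\<close>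
  have "h d = h \<one>" if d: "d \<in> D" for d
  proof -
    note dc = D_carrier[OF d]
    have "eqp (h d - h \<one>) ((?H d - ?F (d \<otimes> v)) - (?H \<one> - ?F (\<one> \<otimes> v)))"
      by (intro cong_diff hH dc one_closed)
    also have "(?H d - ?F (d \<otimes> v)) - (?H \<one> - ?F (\<one> \<otimes> v)) = (?H d - ?H \<one>) - (?F (d \<otimes> v) - ?F v)"
      using K by simp
    also have "eqp \<dots> ((?H d - ?H \<one>) - (?F d - ?F \<one>))"
      by (intro cong_diff cong_refl affine_trans'[OF affF(1) dc K(2)])
    also have "(?H d - ?H \<one>) - (?F d - ?F \<one>) =
        (int z ^ i * (g d - g \<one>) + (f (d \<otimes> b) - f b)) - (int z ^ j * (f d - f \<one>) + (g (d \<otimes> a) - g a))"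
      using C d by (simp add: act_D algebra_simps)
    also have "eqp \<dots> ((1 * (g d - g \<one>) + (f d - f \<one>)) - (1 * (f d - f \<one>) + (g d - g \<one>)))"
      by (intro cong_diff cong_add cong_mult z_one x y affine_trans' aff_affine C dc cong_refl)
    finally have "eqp (h d - h \<one>) 0" by simp
    then have "eqp (h d) (h \<one>)" by (simp add: cong_diff_iff_cong_0)
    then show ?thesis using aff_less[OF K(3)] dc by (simp add: cong_def)
  qed
  then have "?e \<in> Es" using vV K unfolding kvh Es_def k by blast
  then show "\<exists>e\<in>Es. x \<otimes>\<^bsub>G\<^esub> y = y \<otimes>\<^bsub>G\<^esub> x \<otimes>\<^bsub>G\<^esub> e" using e by blast
qed

lemma commute_Ps: "commute_mod G Ps Zs"
  unfolding commute_mod_def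
proof (intro ballI)
  fix x y assume "x \<in> Ps" "y \<in> Ps"
  then obtain a f b g where x: "x = (0, a, f)" "a \<in> carrier U" "f \<in> aff"
    and y: "y = (0, b, g)" "b \<in> carrier U" "g \<in> aff" by (auto simp: Ps_def)
  \<comment> \<open>The commutator pairs each translation with the linear part of the other
    function, as in a Heisenberg group.\<close>
  let ?c = "(f b - f \<one>) - (g a - g \<one>)"
  have "mk (\<lambda>t. g t + f (t \<otimes> b)) = mk (\<lambda>t. mk (\<lambda>_. ?c) t + mk (\<lambda>t. f t + g (t \<otimes> a)) (t \<otimes> \<one>))"
    unfolding mk_eq_iff
  proof
    fix t assume t: "t \<in> carrier U"
    have "eqp (g t + f (t \<otimes> b)) (g t + (f t + (f b - f \<one>)))"
      by (intro cong_add cong_refl affine_trans aff_affine x y t)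
    also have "g t + (f t + (f b - f \<one>)) = ?c + (f t + (g t + (g a - g \<one>)))" by simp
    also have "eqp \<dots> (?c + (f t + g (t \<otimes> a)))"
      by (intro cong_add cong_refl cong_sym[OF affine_trans] aff_affine x y t)
    also have "eqp (?c + (f t + g (t \<otimes> a))) (mk (\<lambda>_. ?c) t + mk (\<lambda>t. f t + g (t \<otimes> a)) (t \<otimes> \<one>))"
      using t by (intro cong_add) (simp_all add: cong_def)
    finally show "eqp (g t + f (t \<otimes> b)) (mk (\<lambda>_. ?c) t + mk (\<lambda>t. f t + g (t \<otimes> a)) (t \<otimes> \<one>))" .
  qed
  then have "x \<otimes>\<^bsub>G\<^esub> y = y \<otimes>\<^bsub>G\<^esub> x \<otimes>\<^bsub>G\<^esub> (0, \<one>, mk (\<lambda>_. ?c))"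
    using x y by (simp add: P_mult m_comm)
  then show "\<exists>e\<in>Zs. x \<otimes>\<^bsub>G\<^esub> y = y \<otimes>\<^bsub>G\<^esub> x \<otimes>\<^bsub>G\<^esub> e" unfolding Zs_def by blast
qed

lemma Zs_central:
  assumes "x \<in> Zs" "y \<in> Ps"
  shows "x \<otimes>\<^bsub>G\<^esub> y = y \<otimes>\<^bsub>G\<^esub> x"
proof -
  obtain c b g where x: "x = (0, \<one>, mk (\<lambda>_. c))" and y: "y = (0, b, g)" "b \<in> carrier U" "g \<in> aff"
    using assms by (auto simp: Zs_def Ps_def)
  show ?thesis using y by (simp add: x P_mult mk_eq_iff add.commute)
qed

lemma Ns_commute:
  assumes "x \<in> Ns" "y \<in> Ns"
  shows "x \<otimes>\<^bsub>G\<^esub> y = y \<otimes>\<^bsub>G\<^esub> x"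
  using assms by (auto simp: Ns_def P_mult mk_eq_iff add.commute)

end

section \<open>Derived length and Fitting height\<close>

context frobenius_module
begin

text \<open>On the finite group \<open>V\<close> the difference of the two actions is an
  endomorphism with trivial kernel, hence onto. The case \<open>j = 0\<close> makes every element of
  \<open>V\<close> a commutator with a rotation; the general case is needed for the twisted
  dual.\<close>

lemma act_difference_surj:
  assumes fix_free: "\<And>y. y \<in> V \<Longrightarrow> act i y = act j y \<Longrightarrow> y = \<one>" and v: "v \<in> V"
  shows "\<exists>b\<in>V. act i b \<otimes> inv (act j b) = v"
proof -
  let ?f = "\<lambda>b. act i b \<otimes> inv (act j b)"
  have fin: "finite V" using finU subgroup.subset[OF V] finite_subset by blast
  have "?f ` V \<subseteq> V"
    using act_V subgroup.m_closed[OF V] subgroup.m_inv_closed[OF V] by auto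
  moreover have "inj_on ?f V"
  proof (rule inj_onI)
    fix b c assume bc: "b \<in> V" "c \<in> V" "?f b = ?f c"
    note C = V_carrier[OF bc(1)] V_carrier[OF bc(2)]
    have "act i (b \<otimes> inv c) = (act i b \<otimes> inv (act j b)) \<otimes> (act j b \<otimes> inv (act i c))"
    proof -
      have "(act i b \<otimes> inv (act j b)) \<otimes> (act j b \<otimes> inv (act i c)) = act i b \<otimes> (inv (act j b) \<otimes> act j b) \<otimes> inv (act i c)"
        using C by (simp only: m_assoc inv_closed m_closed act_closed)
      then show ?thesis using C by simp
    qed
    also have "\<dots> = (act i c \<otimes> inv (act j c)) \<otimes> (act j b \<otimes> inv (act i c))" using bc by simp
    also have "\<dots> = act j b \<otimes> inv (act j c) \<otimes> (act i c \<otimes> inv (act i c))"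
      using C by (simp only: m_ac inv_closed m_closed act_closed)
    also have "\<dots> = act j (b \<otimes> inv c)" using C by simp
    finally have "b \<otimes> inv c = \<one>"
      using bc subgroup.m_closed[OF V] subgroup.m_inv_closed[OF V] by (intro fix_free) auto
    then have "inv (inv c) = b" using C by (intro inv_equality) auto
    then show "b = c" using C by simp
  qed
  ultimately have "?f ` V = V" using endo_inj_surj[OF fin] by blast
  then show ?thesis using v by (metis (no_types, lifting) imageE)
qed

lemma act_quotient_surj:
  assumes "\<not> [j = 0] (mod M)" "v \<in> V"
  shows "\<exists>b\<in>V. act j b \<otimes> inv b = v"
proof -
  obtain b where b: "b \<in> V" "act j b \<otimes> inv (act 0 b) = v"
    using act_difference_surj[of j 0 v] assms act_eq_iff[of _ j 0] by blast
  then show ?thesis using act_0[OF V_carrier[OF b(1)]] by auto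
qed

text \<open>The dual of \<open>V\<close>, realized as the linear functionals on \<open>U\<close>
  that vanish on \<open>D\<close>.\<close>

definition Ls where "Ls = {u \<in> aff. u \<one> = 0 \<and> (\<forall>d\<in>D. u d = 0)}"

text \<open>The conjugation action of the rotation \<open>j\<close> on the dual of \<open>V\<close>;
  compare \<open>w\<close> in \<open>conj_P\<close>.\<close>

definition twist where "twist j u = mk (\<lambda>x. int z ^ ((q - 1) * j) * u (act j x))"

lemma Ls_aff: "u \<in> Ls \<Longrightarrow> u \<in> aff" "u \<in> Ls \<Longrightarrow> u \<one> = 0" "u \<in> Ls \<Longrightarrow> d \<in> D \<Longrightarrow> u d = 0"
  by (auto simp: Ls_def)

lemma aff_diff: "f \<in> aff \<Longrightarrow> g \<in> aff \<Longrightarrow> affine (\<lambda>x. f x - g x)"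
  by (intro affine_diff aff_affine)

lemma aff_act: "f \<in> aff \<Longrightarrow> affine (\<lambda>x. c * f (act j x))"
  by (intro affine_scale affine_act aff_affine)

lemma aff_act_diff: "f \<in> aff \<Longrightarrow> affine (\<lambda>x. f (act j x) - f x)"
  by (intro affine_diff affine_act aff_affine)

lemma twist_Ls: "u \<in> Ls \<Longrightarrow> twist j u \<in> Ls"
  using D_carrier by (auto simp: Ls_def twist_def act_D aff_act)

lemma twist_eqp: "x \<in> carrier U \<Longrightarrow> eqp (int z ^ j * twist j u x) (u (act j x))"
proof -
  assume x: "x \<in> carrier U"
  have "eqp (int z ^ j * twist j u x) (int z ^ j * (int z ^ ((q - 1) * j) * u (act j x)))"
    using x by (intro cong_mult cong_refl) (simp add: twist_def cong_def)
  also have "int z ^ j * (int z ^ ((q - 1) * j) * u (act j x)) = (int z ^ ((q - 1) * j) * int z ^ j) * u (act j x)" by simp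
  also have "eqp ((int z ^ ((q - 1) * j) * int z ^ j) * u (act j x)) (1 * u (act j x))" by (intro cong_mult z_inv cong_refl)
  finally show ?thesis by simp
qed

lemma affine_hom:
  assumes "affine f" "eqp (f \<one>) 0" "x \<in> carrier U" "y \<in> carrier U"
  shows "eqp (f (x \<otimes> y)) (f x + f y)"
proof -
  have "eqp (f (x \<otimes> y)) (f x + (f y - f \<one>))" by (intro affine_trans assms)
  also have "eqp (f x + (f y - f \<one>)) (f x + (f y - 0))" by (intro cong_add cong_diff assms cong_refl)
  finally show ?thesis by simp
qed

lemma affine_hom_inv:
  assumes "affine f" "eqp (f \<one>) 0" "x \<in> carrier U"
  shows "eqp (f (inv x)) (- f x)"
proof -
  have "eqp (f (inv x \<otimes> x)) (f (inv x) + f x)" by (intro affine_hom assms) (use assms in auto)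
  then have "eqp (f (inv x) + f x) 0" using assms cong_trans cong_sym by (metis l_inv)
  then have "eqp (f (inv x) + f x + (- f x)) (0 + (- f x))" by (intro cong_add cong_refl)
  then show ?thesis by simp
qed

lemma affine_hom_pow:
  assumes "affine f" "eqp (f \<one>) 0" "x \<in> carrier U"
  shows "eqp (f (x [^] (n::nat))) (int n * f x)"
proof (induction n)
  case 0
  then show ?case using assms by simp
next
  case (Suc n)
  have "eqp (f (x [^] n \<otimes> x)) (f (x [^] n) + f x)" by (intro affine_hom assms nat_pow_closed)
  also have "eqp (f (x [^] n) + f x) (int n * f x + f x)" by (intro cong_add Suc cong_refl)
  finally show ?case by (simp add: algebra_simps)
qed

text \<open>The dual action of \<open>H\<close> on the functionals is twisted by the character \<open>j \<mapsto> z\<^sup>j\<close>. It is still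
  free, because \<open>scalar\<close> says that multiplication by \<open>z\<close> is itself the action of an element of \<open>C\<close>.\<close>
lemma twist_fixed_zero:
  assumes f: "affine f" "eqp (f \<one>) 0" "\<And>d. d \<in> D \<Longrightarrow> eqp (f d) 0"
    and j: "\<not> [j = 0] (mod M)"
    and fixd: "\<And>x. x \<in> carrier U \<Longrightarrow> eqp (int z ^ j * f x) (f (act j x))"
    and x: "x \<in> carrier U"
  shows "eqp (f x) 0"
proof -
  obtain s where s: "q dvd s" "\<And>v. v \<in> V \<Longrightarrow> act s v = v [^] z" using scalar by blast
  \<comment> \<open>Since \<open>q\<close> divides \<open>s\<close>, iterating \<open>act s\<close>
    just adds indices, so powers of \<open>z\<close> act as rotations too.\<close>
  have pow: "act (s * n) v = v [^] (z ^ n)" if v: "v \<in> V" for n v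
  proof (induction n)
    case 0
    then show ?case using V_carrier[OF v] by (simp add: act_0)
  next
    case (Suc n)
    note vc = V_carrier[OF v]
    have "[s * Suc n = s + p ^ s * (s * n)] (mod M)"
      using cong_add[OF cong_refl[of s] cong_mult[OF cong_sym[OF p_pow_M1[OF s(1)]] cong_refl[of "s * n"]]] by simp
    then have "act (s * Suc n) v = act (s + p ^ s * (s * n)) v"
      using vc by (intro act_cong) (simp_all add: M_def)
    also have "\<dots> = act s (act (s * n) v)" using act_act[OF vc] by simp
    also have "\<dots> = act (s * n) v [^] z" by (rule s(2)[OF act_V[OF v]])
    also have "\<dots> = (v [^] (z ^ n)) [^] z" unfolding Suc ..
    finally show ?case using vc by (simp add: nat_pow_pow mult.commute)
  qed
  have fV: "eqp (f v) 0" if v: "v \<in> V" for v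
  proof -
    \<comment> \<open>Modulo \<open>q\<close> the index \<open>s * j\<close> vanishes, so
      \<open>q dvd j\<close> and \<open>z ^ j\<close> is 1 modulo \<open>p\<close>. Then
      \<open>act (s * j)\<close> is the identity on \<open>V\<close> and \<open>act j\<close> would
      fix \<open>y\<close>.\<close>
    have "y = \<one>" if y: "y \<in> V" "act j y = act (s * j) y" for y
    proof (rule ccontr)
      assume ne: "y \<noteq> \<one>"
      note yc = V_carrier[OF y(1)]
      have "[j = s * j] (mod M)" using act_eq_iff[OF y(1) ne] y(2) by simp
      then have "[j = s * j] (mod q)" using qM by (rule cong_dvd_modulus_nat)
      then have "q dvd j" using s(1) cong_dvd_iff[of j "s * j" q] by simp
      then have "eqp (int z ^ j) 1" by (rule z_one)
      then have "[z ^ j = 1] (mod p)" using cong_int_iff[of "z ^ j" 1 p] by simp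
      then have "z ^ j mod p = 1" using p1 by (simp add: cong_def)
      then have zj: "z ^ j = p * (z ^ j div p) + 1" using div_mult_mod_eq[of "z ^ j" p] by (simp add: mult.commute)
      have "y [^] (p * (z ^ j div p) + 1) = y"
        using yc exponent[OF yc] by (simp add: nat_pow_mult[symmetric] nat_pow_pow[symmetric])
      then have "y [^] (z ^ j) = y" using arg_cong[OF zj, of "\<lambda>n. y [^] n"] by (rule trans[rotated])
      then have "act j y = act 0 y" using y pow[OF y(1)] yc by (simp add: act_0)
      then show False using act_eq_iff[OF y(1) ne, of j 0] j by simp
    qed
    \<comment> \<open>Hence each \<open>v\<close> is a difference of \<open>act j b\<close> and
      \<open>act (s * j) b\<close>. Both have the value \<open>z ^ j * f b\<close> under
      \<open>f\<close>: the first by hypothesis, the second by linearity.\<close>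
    from act_difference_surj[OF this v] obtain b where b: "b \<in> V" "v = act j b \<otimes> inv (act (s * j) b)" by blast
    note bc = V_carrier[OF b(1)]
    have "eqp (f v) (f (act j b) + f (inv (act (s * j) b)))"
      unfolding b(2) by (intro affine_hom f) (use bc in auto)
    also have "eqp (f (act j b) + f (inv (act (s * j) b))) (int z ^ j * f b + (- f (act (s * j) b)))"
      by (intro cong_add cong_sym[OF fixd] affine_hom_inv f) (use bc in auto)
    also have "eqp (int z ^ j * f b + (- f (act (s * j) b))) (int z ^ j * f b + (- (int (z ^ j) * f b)))"
      unfolding pow[OF b(1)] cong_minus_minus_iff
      by (intro cong_add cong_refl) (simp only: cong_minus_minus_iff affine_hom_pow[OF f(1,2) bc])
    finally show ?thesis by simp
  qed
  obtain v d where vd: "v \<in> V" "d \<in> D" "x = v \<otimes> d" using VD[OF x] by blast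
  have "eqp (f x) (f v + f d)" unfolding vd(3) by (intro affine_hom f V_carrier D_carrier vd)
  also have "eqp (f v + f d) (0 + 0)" by (intro cong_add fV f vd)
  finally show ?thesis by simp
qed

text \<open>The dual counterpart of \<open>act_quotient_surj\<close>: by
  \<open>twist_fixed_zero\<close>, applied to a difference of two functionals, the map is injective
  on the finite set \<open>Ls\<close>.\<close>

lemma twist_surj:
  assumes j: "\<not> [j = 0] (mod M)" and w: "w \<in> Ls"
  shows "\<exists>u\<in>Ls. w = mk (\<lambda>x. twist j u x - u x)"
proof -
  let ?f = "\<lambda>u. mk (\<lambda>x. twist j u x - u x)"
  have fin: "finite Ls" by (rule finite_subset[OF _ finite_aff]) (auto simp: Ls_def)
  have "?f ` Ls \<subseteq> Ls"
  proof
    fix w assume "w \<in> ?f ` Ls"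
    then obtain u where u: "u \<in> Ls" "w = ?f u" by blast
    note t = twist_Ls[OF u(1), of j]
    show "w \<in> Ls" unfolding u(2) Ls_def
      using Ls_aff[OF u(1)] Ls_aff[OF t] D_carrier by (auto simp: aff_diff)
  qed
  moreover have "inj_on ?f Ls"
  proof (rule inj_onI)
    fix u u' assume u: "u \<in> Ls" "u' \<in> Ls" "?f u = ?f u'"
    let ?d = "\<lambda>x. u x - u' x"
    note A = Ls_aff[OF u(1)] Ls_aff[OF u(2)]
    have "eqp (?d x) 0" if x: "x \<in> carrier U" for x
    proof (rule twist_fixed_zero[OF _ _ _ j _ x])
      show "affine ?d" by (intro affine_diff aff_affine A)
      show "eqp (?d \<one>) 0" using A by simp
      show "eqp (?d d) 0" if "d \<in> D" for d using A that by simp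
      fix x assume x: "x \<in> carrier U"
      have "eqp (twist j u x - u x) (twist j u' x - u' x)" using u(3) x unfolding mk_eq_iff by blast
      then have "eqp (int z ^ j * ((twist j u x - u x) - (twist j u' x - u' x))) (int z ^ j * 0)"
        by (intro cong_mult cong_refl) (simp add: cong_diff_iff_cong_0)
      then have "eqp (int z ^ j * ?d x + int z ^ j * ((twist j u x - u x) - (twist j u' x - u' x))) (int z ^ j * ?d x + int z ^ j * 0)"
        by (intro cong_add cong_refl)
      then have "eqp (int z ^ j * ?d x) (int z ^ j * twist j u x - int z ^ j * twist j u' x)"
        by (simp add: algebra_simps cong_sym_eq)
      also have "eqp (int z ^ j * twist j u x - int z ^ j * twist j u' x) (?d (act j x))"
        by (intro cong_diff twist_eqp x)
      finally show "eqp (int z ^ j * ?d x) (?d (act j x))" .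
    qed
    then show "u = u'" by (intro aff_eqI A) (simp add: cong_diff_iff_cong_0)
  qed
  ultimately have "?f ` Ls = Ls" using endo_inj_surj[OF fin] by blast
  then show ?thesis using w by (metis (no_types, lifting) imageE)
qed

section \<open>The derived series\<close>

abbreviation zero_fn where "zero_fn \<equiv> mk (\<lambda>_. 0)"

lemma basic_elements:
  "v \<in> carrier U \<Longrightarrow> (0, v, zero_fn) \<in> carrier G" "u \<in> aff \<Longrightarrow> (0, \<one>, u) \<in> carrier G"
  "j < M \<Longrightarrow> (j, \<one>, zero_fn) \<in> carrier G"
  using M1 by (auto simp: G_carrier)

lemma mk_mod: "mk f = mk g \<Longrightarrow> x \<in> carrier U \<Longrightarrow> eqp (f x) (g x)"
  by (simp add: mk_eq_iff)

text \<open>\<open>K\<close> contains \<open>V\<close> and its dual. The property passes to the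
  derived subgroup as long as \<open>K\<close> contains a nontrivial rotation; it carries the lower
  bound for the derived length.\<close>

definition rich where "rich K \<longleftrightarrow> (\<forall>v\<in>V. (0, v, zero_fn) \<in> K) \<and> (\<forall>u\<in>Ls. (0, \<one>, u) \<in> K)"

text \<open>A nontrivial rotation has no fixed points on \<open>V\<close> or on its dual, so every
  element of either is a commutator with it.\<close>

lemma derived_rich:
  assumes K: "subgroup K G" "rich K" and j: "0 < j" "j < M" "(j, \<one>, zero_fn) \<in> K"
  shows "rich (derived G K)"
  unfolding rich_def
proof (intro conjI ballI)
  have j0: "\<not> [j = 0] (mod M)" using j by (simp add: cong_def)
  fix v assume v: "v \<in> V"
  \<comment> \<open>Comparing the two products, \<open>b\<close> has to satisfy
    \<open>act j (b \<otimes> v) = b\<close>.\<close>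
  have "inv (act j v) \<in> V" using v act_V subgroup.m_inv_closed[OF V] by simp
  then obtain b where b: "b \<in> V" "act j b \<otimes> inv b = inv (act j v)" using act_quotient_surj[OF j0] by blast
  note c = V_carrier[OF v] V_carrier[OF b(1)]
  have "act j b = inv (act j v) \<otimes> b" using b(2) c by (simp add: inv_solve_right')
  then have e: "act j b \<otimes> act j v = b" using c by (simp add: m_ac)
  show "(0, v, zero_fn) \<in> derived G K"
  proof (rule commutator_in_derived[OF G_group K(1)])
    show "(0, b, zero_fn) \<in> K" "(j, \<one>, zero_fn) \<in> K" using K(2) b j by (auto simp: rich_def)
    show "(0, v, zero_fn) \<in> carrier G" using c basic_elements by simp
    show "(0, b, zero_fn) \<otimes>\<^bsub>G\<^esub> (j, \<one>, zero_fn) = (j, \<one>, zero_fn) \<otimes>\<^bsub>G\<^esub> (0, b, zero_fn) \<otimes>\<^bsub>G\<^esub> (0, v, zero_fn)"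
      using c e j by (simp add: G_mult act_0 mk_eq_iff)
  qed
next
  have j0: "\<not> [j = 0] (mod M)" using j by (simp add: cong_def)
  fix w assume w: "w \<in> Ls"
  obtain u where u: "u \<in> Ls" "w = mk (\<lambda>x. twist j u x - u x)" using twist_surj[OF j0 w] by blast
  show "(0, \<one>, w) \<in> derived G K"
  proof (rule commutator_in_derived[OF G_group K(1)])
    show "(0, \<one>, u) \<in> K" "(j, \<one>, zero_fn) \<in> K" using K(2) u j by (auto simp: rich_def)
    show "(0, \<one>, w) \<in> carrier G" using Ls_aff[OF w] basic_elements by simp
    have "mk (\<lambda>x. u (act j x)) = mk (\<lambda>x. int z ^ j * w x + int z ^ j * u x)"
      unfolding mk_eq_iff
    proof
      fix x assume x: "x \<in> carrier U"
      have "eqp (int z ^ j * w x + int z ^ j * u x) (int z ^ j * (twist j u x - u x) + int z ^ j * u x)"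
        using x by (intro cong_add cong_mult cong_refl) (simp add: u(2) cong_def)
      also have "int z ^ j * (twist j u x - u x) + int z ^ j * u x = int z ^ j * twist j u x" by (simp add: algebra_simps)
      also have "eqp (int z ^ j * twist j u x) (u (act j x))" by (rule twist_eqp[OF x])
      finally show "eqp (u (act j x)) (int z ^ j * w x + int z ^ j * u x)" by (rule cong_sym)
    qed
    moreover have "(0, \<one>, u) \<otimes>\<^bsub>G\<^esub> (j, \<one>, zero_fn) = (j, \<one>, mk (\<lambda>x. u (act j x)))"
      using j by (simp add: G_mult act_0 mk_eq_iff)
    moreover have "(j, \<one>, zero_fn) \<otimes>\<^bsub>G\<^esub> (0, \<one>, u) \<otimes>\<^bsub>G\<^esub> (0, \<one>, w) = (j, \<one>, mk (\<lambda>x. int z ^ j * w x + int z ^ j * u x))"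
      using j by (simp add: G_mult act_0 mk_eq_iff cong_def mod_simps)
    ultimately show "(0, \<one>, u) \<otimes>\<^bsub>G\<^esub> (j, \<one>, zero_fn) = (j, \<one>, zero_fn) \<otimes>\<^bsub>G\<^esub> (0, \<one>, u) \<otimes>\<^bsub>G\<^esub> (0, \<one>, w)"
      by simp
  qed
qed

lemma rich_carrier: "rich (carrier G)"
  using basic_elements V_carrier Ls_aff by (auto simp: rich_def)

lemma derived_contains_rotation:
  obtains k where "0 < k" "k < M" "(k, \<one>, zero_fn) \<in> derived G (carrier G)"
proof -
  \<comment> \<open>The products of the rotations \<open>1\<close> and \<open>q\<close> have the
    indices 1 + p q and q + 1. Their difference (p - 1) q must be divided by p^(q+1), and
    \<open>p ^ (q - 1)\<close> is the inverse of that power modulo \<open>M\<close>.\<close>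
  define k where "k = (p ^ (q - 1) * ((p - 1) * q)) mod M"
  have qM1: "q < M" using M_gt p1 by (metis le_less_trans mult_le_mono1 mult_1 diff_is_0_eq' less_one not_le nat_le_linear zero_less_diff le_neq_implies_less Suc_leI One_nat_def)
  have km: "k < M" using M1 by (simp add: k_def)
  have k0: "k \<noteq> 0"
  proof
    assume "k = 0"
    \<comment> \<open>Multiplication by \<open>p\<close> completes the power to p^q, which is 1
      modulo \<open>M\<close>.\<close>
    then have "M dvd p * (p ^ (q - 1) * ((p - 1) * q))" by (simp add: k_def mod_eq_0_iff_dvd)
    also have "p * (p ^ (q - 1) * ((p - 1) * q)) = p ^ q * ((p - 1) * q)"
      using q0 by (simp add: mult.assoc[symmetric] flip: power_Suc)
    finally have "[p ^ q * ((p - 1) * q) = 0] (mod M)" by (simp add: cong_0_iff)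
    moreover have "[p ^ q * ((p - 1) * q) = 1 * ((p - 1) * q)] (mod M)"
      by (intro cong_mult p_pow_M1 cong_refl) simp
    ultimately have "M dvd (p - 1) * q" using cong_trans cong_sym cong_0_iff by (metis mult_1)
    moreover have "(p - 1) * q > 0" using p1 q0 by simp
    ultimately show False using M_gt by (auto dest: dvd_imp_le)
  qed
  have "(k, \<one>, zero_fn) \<in> derived G (carrier G)"
  proof (rule commutator_in_derived[OF G_group GG.subgroup_self])
    show "(1, \<one>, zero_fn) \<in> carrier G" "(q, \<one>, zero_fn) \<in> carrier G" "(k, \<one>, zero_fn) \<in> carrier G"
      using basic_elements M1 qM1 km by auto
    let ?m = "(q + p ^ q * 1) mod M"
    have "[?m + p ^ ?m * k = (q + 1) + p ^ (q + 1) * (p ^ (q - 1) * ((p - 1) * q))] (mod M)"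
    proof (intro cong_add cong_mult p_pow_M)
      show "[?m = q + 1] (mod M)" using cong_add[OF cong_refl[of q] p_pow_M1[of q]] by (simp add: cong_def)
      show "[?m = q + 1] (mod q)" by (rule idx_mod_q)
    qed (simp add: k_def cong_def)
    also have "(q + 1) + p ^ (q + 1) * (p ^ (q - 1) * ((p - 1) * q)) = (q + 1) + p ^ (q + q) * ((p - 1) * q)"
      using q1 by (simp only: mult.assoc[symmetric] power_add[symmetric]) simp
    also have "[(q + 1) + p ^ (q + q) * ((p - 1) * q) = (q + 1) + 1 * ((p - 1) * q)] (mod M)"
      by (intro cong_add cong_mult p_pow_M1 cong_refl) simp
    also have "(q + 1) + 1 * ((p - 1) * q) = 1 + p ^ 1 * q" using p0 by (cases p) auto
    finally have "(1 + p ^ 1 * q) mod M = (?m + p ^ ?m * k) mod M" by (simp add: cong_def)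
    then show "(1, \<one>, zero_fn) \<otimes>\<^bsub>G\<^esub> (q, \<one>, zero_fn) = (q, \<one>, zero_fn) \<otimes>\<^bsub>G\<^esub> (1, \<one>, zero_fn) \<otimes>\<^bsub>G\<^esub> (k, \<one>, zero_fn)"
      by (simp only: G_mult) (simp add: mk_eq_iff)
  qed
  then show ?thesis using that k0 km by simp
qed

lemma separating_affine:
  assumes "x \<in> carrier U" "x \<noteq> \<one>"
  obtains f where "f \<in> aff" "f \<one> = 0" "f x \<noteq> 0"
proof -
  obtain \<phi> :: "'x \<Rightarrow> int" where \<phi>: "\<phi> x mod int p \<noteq> 0" "\<And>a b. a \<in> carrier U \<Longrightarrow> b \<in> carrier U \<Longrightarrow> eqp (\<phi> (a \<otimes> b)) (\<phi> a + \<phi> b)"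
    using separating[OF assms] by blast
  have "eqp (\<phi> \<one>) (\<phi> \<one> + \<phi> \<one>)" using \<phi>(2)[of \<one> \<one>] by simp
  then have "eqp (\<phi> \<one> - \<phi> \<one>) (\<phi> \<one> + \<phi> \<one> - \<phi> \<one>)" by (intro cong_diff cong_refl)
  then have one: "eqp (\<phi> \<one>) 0" by (simp add: cong_sym_eq)
  have "affine \<phi>" unfolding affine_def
  proof (intro ballI)
    fix a b assume "a \<in> carrier U" "b \<in> carrier U"
    then have "eqp (\<phi> (a \<otimes> b) + \<phi> \<one>) (\<phi> a + \<phi> b + 0)" by (intro cong_add \<phi>(2) one)
    then show "eqp (\<phi> (a \<otimes> b) + \<phi> \<one>) (\<phi> a + \<phi> b)" by simp
  qed
  then show ?thesis using that[of "mk \<phi>"] \<phi>(1) one assms by (simp add: cong_def)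
qed

text \<open>A functional that separates \<open>v\<close> need not vanish on \<open>D\<close>. Its
  increment along the rotation \<open>1\<close> does, since that rotation fixes \<open>D\<close>,
  and at \<open>b\<close> the increment is the value at \<open>v\<close>, where \<open>v\<close> is
  the difference of \<open>act 1 b\<close> and \<open>b\<close>.\<close>

lemma Ls_nontrivial:
  obtains u v where "u \<in> Ls" "v \<in> V" "u v \<noteq> 0"
proof -
  obtain v where v: "v \<in> V" "v \<noteq> \<one>" using V_nontrivial by blast
  obtain f where f: "f \<in> aff" "f \<one> = 0" "f v \<noteq> 0" using separating_affine[OF V_carrier[OF v(1)] v(2)] by blast
  have "\<not> [1 = 0] (mod M)" using M1 by (simp add: cong_def)
  then obtain b where b: "b \<in> V" "act 1 b \<otimes> inv b = v" using act_quotient_surj[OF _ v(1)] by blast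
  note bc = V_carrier[OF b(1)]
  let ?u = "mk (\<lambda>x. f (act 1 x) - f x)"
  have "?u \<in> Ls" unfolding Ls_def
    using f D_carrier by (auto simp: act_D aff_act_diff)
  moreover have "?u b \<noteq> 0"
  proof
    assume "?u b = 0"
    then have u0: "eqp (f (act 1 b) - f b) 0" using bc by (simp add: cong_def)
    have fone: "eqp (f \<one>) 0" using f by simp
    have "eqp (f v) (f (act 1 b) + f (inv b))"
      unfolding b(2)[symmetric] by (intro affine_hom aff_affine f fone) (use bc in auto)
    also have "eqp (f (act 1 b) + f (inv b)) (f (act 1 b) + (- f b))"
      by (intro cong_add cong_refl affine_hom_inv aff_affine f fone bc)
    also have "f (act 1 b) + (- f b) = f (act 1 b) - f b" by simp
    also note u0
    finally have "f v mod int p = 0" by (simp add: cong_def)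
    then show False using f(3) aff_less[OF f(1) V_carrier[OF v(1)]] by simp
  qed
  ultimately show ?thesis using that b(1) by blast
qed

text \<open>The commutator of a functional \<open>u\<close> and a translation by \<open>v\<close> is
  the constant \<open>u v\<close>.\<close>

lemma derived_rich_nontrivial:
  assumes K: "subgroup K G" "rich K"
  shows "\<exists>e\<in>derived G K. e \<noteq> \<one>\<^bsub>G\<^esub>"
proof -
  obtain u v where uv: "u \<in> Ls" "v \<in> V" "u v \<noteq> 0" by (rule Ls_nontrivial)
  note vc = V_carrier[OF uv(2)] note A = Ls_aff[OF uv(1)]
  let ?c = "mk (\<lambda>_. u v)"
  have "(0, \<one>, ?c) \<in> derived G K"
  proof (rule commutator_in_derived[OF G_group K(1)])
    show "(0, \<one>, u) \<in> K" "(0, v, zero_fn) \<in> K" using K(2) uv by (auto simp: rich_def)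
    show "(0, \<one>, ?c) \<in> carrier G" using basic_elements by simp
    have "mk (\<lambda>x. u (x \<otimes> v)) = mk (\<lambda>x. u v + u x)"
      unfolding mk_eq_iff using affine_hom[OF aff_affine[OF A(1)] _ _ vc] A(2) by (simp add: add.commute)
    then show "(0, \<one>, u) \<otimes>\<^bsub>G\<^esub> (0, v, zero_fn) = (0, v, zero_fn) \<otimes>\<^bsub>G\<^esub> (0, \<one>, u) \<otimes>\<^bsub>G\<^esub> (0, \<one>, ?c)"
      using vc by (simp add: P_mult mk_eq_iff cong_def mod_simps)
  qed
  moreover have "?c \<noteq> zero_fn" using uv(3) aff_less[OF A(1) vc] by (auto simp: mk_eq_iff cong_def intro!: bexI[of _ \<one>])
  ultimately show ?thesis by (intro bexI[of _ "(0, \<one>, ?c)"]) (simp_all add: G_one)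
qed

lemma rich_nontrivial: "rich K \<Longrightarrow> \<exists>e\<in>K. e \<noteq> \<one>\<^bsub>G\<^esub>"
proof -
  assume K: "rich K"
  obtain v where v: "v \<in> V" "v \<noteq> \<one>" using V_nontrivial by blast
  then show ?thesis using K by (intro bexI[of _ "(0, v, zero_fn)"]) (simp_all add: G_one rich_def)
qed

lemma commute_Zs: "commute_mod G Zs {\<one>\<^bsub>G\<^esub>}"
  unfolding commute_mod_def using Zs_central subsets subgroup.mem_carrier[OF subgroup_Zs] by (auto simp: subset_iff)

theorem derived_length_G: "derived_length G = 4" and solvable_G: "solvable G"
proof -
  let ?D = "\<lambda>n. (derived G ^^ n) (carrier G)"
  have D: "?D 1 = derived G (carrier G)" "?D 2 = derived G (?D 1)" "?D 3 = derived G (?D 2)" "?D 4 = derived G (?D 3)"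
    by (simp_all add: numeral_nat)
  have sg: "subgroup (?D n) G" for n
    by (rule GG.exp_of_derived_is_subgroup[OF GG.subgroup_self])
  obtain k where k: "0 < k" "k < M" "(k, \<one>, zero_fn) \<in> ?D 1" unfolding D by (rule derived_contains_rotation)
  have r1: "rich (?D 1)"
    unfolding D by (rule derived_rich[OF GG.subgroup_self rich_carrier, of 1]) (use M1 basic_elements in auto)
  \<comment> \<open>The rotation in the first derived subgroup saves \<open>V\<close> and its dual
    once more; their pairing then makes the third one nontrivial.\<close>
  have r2: "rich (?D 2)" unfolding D(2) by (rule derived_rich[OF sg r1 k])
  have n3: "\<exists>e\<in>?D 3. e \<noteq> \<one>\<^bsub>G\<^esub>" unfolding D(3) by (rule derived_rich_nontrivial[OF sg r2])
  \<comment> \<open>For the upper bound the series is caught successively in \<open>Cs\<close>,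
    \<open>Es\<close>, \<open>Zs\<close> and the trivial group.\<close>
  have "?D 1 \<subseteq> Cs" unfolding D by (rule derived_subset[OF G_group GG.subgroup_self subgroup_Cs commute_carrier])
  then have "?D 2 \<subseteq> derived G Cs" unfolding D(2) by (intro GG.mono_derived subgroup.subset[OF subgroup_Cs])
  also have "\<dots> \<subseteq> Es" by (rule derived_subset[OF G_group subgroup_Cs subgroup_Es commute_Cs])
  also have "\<dots> \<subseteq> Ps" by (rule subsets)
  finally have "?D 3 \<subseteq> derived G Ps" unfolding D(3) by (intro GG.mono_derived subgroup.subset[OF subgroup_Ps])
  also have "\<dots> \<subseteq> Zs" by (rule derived_subset[OF G_group subgroup_Ps subgroup_Zs commute_Ps])
  finally have "?D 4 \<subseteq> derived G Zs" unfolding D(4) by (intro GG.mono_derived subgroup.subset[OF subgroup_Zs])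
  also have "\<dots> \<subseteq> {\<one>\<^bsub>G\<^esub>}" by (rule derived_subset[OF G_group subgroup_Zs GG.triv_subgroup commute_Zs])
  finally have four: "?D 4 = {\<one>\<^bsub>G\<^esub>}" using subgroup.one_closed[OF sg[of 4]] by auto
  then show "solvable G" using GG.solvable_iff_trivial_derived_seq by blast
  show "derived_length G = 4" unfolding derived_length_def
  proof (rule Least_equality)
    fix n assume n: "?D n = {\<one>\<^bsub>G\<^esub>}"
    have "?D 0 \<noteq> {\<one>\<^bsub>G\<^esub>}" "?D 1 \<noteq> {\<one>\<^bsub>G\<^esub>}" "?D 2 \<noteq> {\<one>\<^bsub>G\<^esub>}" "?D 3 \<noteq> {\<one>\<^bsub>G\<^esub>}"
      using rich_nontrivial[OF rich_carrier] rich_nontrivial[OF r1] rich_nontrivial[OF r2] n3 by auto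
    then have "n \<noteq> 0" "n \<noteq> 1" "n \<noteq> 2" "n \<noteq> 3" using n by metis+
    then show "4 \<le> n" by simp
  qed (rule four)
qed

section \<open>Lower central series and Fitting height\<close>

lemma lower_central_translations:
  assumes K: "subgroup K G" and j: "0 < j" "j < M" "(j, \<one>, zero_fn) \<in> K"
    and tr: "\<And>v. v \<in> V \<Longrightarrow> (0, v, zero_fn) \<in> K" and v: "v \<in> V"
  shows "(0, v, zero_fn) \<in> lower_central (G\<lparr>carrier := K\<rparr>) c"
  using v
proof (induction c arbitrary: v)
  case 0
  then show ?case using tr by simp
next
  case (Suc c)
  have j0: "\<not> [j = 0] (mod M)" using j by (simp add: cong_def)
  \<comment> \<open>\<open>v\<close> is a commutator of some \<open>b\<close> in \<open>V\<close>
    with the rotation, and \<open>b\<close> lies in the previous term by induction. So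
    \<open>V\<close> stays in every term, and \<open>K\<close> cannot be nilpotent.\<close>
  have "inv v \<in> V" using Suc.prems subgroup.m_inv_closed[OF V] by simp
  then obtain b where b: "b \<in> V" "act j b \<otimes> inv b = inv v" using act_quotient_surj[OF j0] by blast
  note vc = V_carrier[OF Suc.prems] V_carrier[OF b(1)]
  have "act j b = inv v \<otimes> b" using b(2) vc by (simp add: inv_solve_right')
  then have e: "v \<otimes> act j b = b" using vc by (simp add: m_assoc[symmetric])
  show ?case
  proof (rule commutator_in_lower_central[OF G_group K Suc.IH[OF b(1)] j(3)])
    show "(0, v, zero_fn) \<in> carrier G" using basic_elements vc by simp
    show "(0, b, zero_fn) \<otimes>\<^bsub>G\<^esub> (j, \<one>, zero_fn) = (0, v, zero_fn) \<otimes>\<^bsub>G\<^esub> ((j, \<one>, zero_fn) \<otimes>\<^bsub>G\<^esub> (0, b, zero_fn))"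
      using vc e j by (simp add: G_mult act_0 mk_eq_iff)
  qed
qed

text \<open>Commuting a rotation \<open>t\<close> of C with the rotation \<open>1\<close> multiplies
  its index by -(p - 1). The prime \<open>r\<close> divides \<open>M\<close> but not
  \<open>p - 1\<close>, so an index not divisible by \<open>r\<close> keeps this property; the
  induction starts at the rotation \<open>q\<close>.\<close>

lemma lower_central_rotations:
  "\<exists>k. 0 < k \<and> k < M \<and> (k, \<one>, zero_fn) \<in> lower_central G c"
proof -
  obtain r where r: "Factorial_Ring.prime r" "r dvd M" "\<not> r dvd p - 1" "r \<noteq> q"
    using order_has_large_prime[OF q odd_q qp p1] unfolding M_def by blast
  have "\<exists>k. k < M \<and> q dvd k \<and> \<not> r dvd k \<and> (k, \<one>, zero_fn) \<in> lower_central G c"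
  proof (induction c)
    case 0
    have "(p - 1) * q < M" by (rule M_gt)
    moreover have "1 \<le> p - 1" using p1 by linarith
    from mult_le_mono1[OF this, of q] have "q \<le> (p - 1) * q" by simp
    ultimately have "q < M" by linarith
    moreover have "\<not> r dvd q" using r(1,4) q primes_dvd_imp_eq by blast
    ultimately show ?case using basic_elements(3)[of q] by (intro exI[of _ q]) simp
  next
    case (Suc c)
    then obtain t where t: "t < M" "q dvd t" "\<not> r dvd t" "(t, \<one>, zero_fn) \<in> lower_central G c" by blast
    \<comment> \<open>\<open>M - 1\<close> stands for -1: the index must be \<open>t + 1\<close>
      minus \<open>1 + p * t\<close>.\<close>
    define k where "k = ((M - 1) * ((p - 1) * t)) mod M"
    have kM: "k < M" using M1 by (simp add: k_def)
    have qk: "q dvd k" using t(2) by (simp add: k_def mod_M_dvd)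
    have "\<not> r dvd M - 1"
    proof
      assume "r dvd M - 1"
      with r(2) have "r dvd M - (M - 1)" by (rule dvd_diff_nat)
      moreover have "M - (M - 1) = 1" using M1 by simp
      ultimately have "r dvd 1" by (simp only:)
      then show False using r(1) not_prime_unit by blast
    qed
    then have "\<not> r dvd (M - 1) * ((p - 1) * t)" using r(1,3) t(3) by (simp add: prime_dvd_mult_iff)
    then have rk: "\<not> r dvd k" using r(2) by (simp add: k_def dvd_mod_iff)
    have "(k, \<one>, zero_fn) \<in> lower_central (G\<lparr>carrier := carrier G\<rparr>) (Suc c)"
    proof (rule commutator_in_lower_central[OF G_group GG.subgroup_self])
      show "(t, \<one>, zero_fn) \<in> lower_central (G\<lparr>carrier := carrier G\<rparr>) c" using t(4) by simp
      show "(1, \<one>, zero_fn) \<in> carrier G" "(k, \<one>, zero_fn) \<in> carrier G" using basic_elements M1 kM by auto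
      have "[k + (1 + p * t) mod M = (M - 1) * ((p - 1) * t) + (1 + p * t)] (mod M)"
        by (intro cong_add) (simp_all add: k_def cong_def)
      also have "(M - 1) * ((p - 1) * t) + (1 + p * t) = M * ((p - 1) * t) + (t + 1)"
      proof -
        have "p * t = (p - 1) * t + t" using p0 by (cases p) auto
        moreover have "(M - 1) * ((p - 1) * t) + (p - 1) * t = M * ((p - 1) * t)" using M1 by (cases M) auto
        ultimately show ?thesis by linarith
      qed
      also have "[\<dots> = t + 1] (mod M)" by (simp add: cong_def)
      finally have "(t + 1) mod M = (k + (1 + p ^ 1 * t) mod M) mod M" by (simp add: cong_def)
      then have "(t + p ^ t * 1) mod M = (k + p ^ k * ((1 + p ^ 1 * t) mod M)) mod M"
        by (simp only: idx_M[OF t(2)] idx_M[OF qk])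
      then show "(t, \<one>, zero_fn) \<otimes>\<^bsub>G\<^esub> (1, \<one>, zero_fn) = (k, \<one>, zero_fn) \<otimes>\<^bsub>G\<^esub> ((1, \<one>, zero_fn) \<otimes>\<^bsub>G\<^esub> (t, \<one>, zero_fn))"
        by (simp only: G_mult) (simp add: mk_eq_iff)
    qed
    then show ?case using kM qk rk by auto
  qed
  then show ?thesis by (metis dvd_0_right neq0_conv)
qed

text \<open>The chain \<open>Ps\<close>, \<open>Cs\<close>, \<open>G\<close> works because
  \<open>Ps\<close> has class 2 and the other two quotients are abelian. Shorter chains fail because
  \<open>V\<close> lies in every term of the lower central series of any subgroup that contains
  \<open>V\<close> and a nontrivial rotation.\<close>

theorem fitting_height_G: "fitting_height G = 3"
  unfolding fitting_height_eq[OF G_group]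
proof (rule Least_equality)
  let ?F = "\<lambda>i::nat. if i = 0 then {\<one>\<^bsub>G\<^esub>} else if i = 1 then Ps else if i = 2 then Cs else carrier G"
  have P: "lower_central (G\<lparr>carrier := Ps\<rparr>) 2 \<subseteq> {\<one>\<^bsub>G\<^esub>}"
  proof -
    have "lower_central (G\<lparr>carrier := Ps\<rparr>) 1 \<subseteq> Zs"
      using subsets by (intro lower_central_one_subset[OF G_group subgroup_Ps subgroup_Zs commute_Ps]) blast
    moreover interpret K: group "G\<lparr>carrier := Ps\<rparr>" by (rule GG.subgroup_imp_group[OF subgroup_Ps])
    have "x \<otimes>\<^bsub>G\<^esub> y \<otimes>\<^bsub>G\<^esub> inv\<^bsub>G\<lparr>carrier := Ps\<rparr>\<^esub> x \<otimes>\<^bsub>G\<^esub> inv\<^bsub>G\<lparr>carrier := Ps\<rparr>\<^esub> y = \<one>\<^bsub>G\<^esub>" if "x \<in> Zs" "y \<in> Ps" for x y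
    proof -
      have c: "x \<in> carrier (G\<lparr>carrier := Ps\<rparr>)" "y \<in> carrier (G\<lparr>carrier := Ps\<rparr>)" using that subsets by auto
      have "x \<otimes>\<^bsub>G\<lparr>carrier := Ps\<rparr>\<^esub> y = y \<otimes>\<^bsub>G\<lparr>carrier := Ps\<rparr>\<^esub> x" using Zs_central[OF that] by simp
      then have "x \<otimes>\<^bsub>G\<lparr>carrier := Ps\<rparr>\<^esub> y \<otimes>\<^bsub>G\<lparr>carrier := Ps\<rparr>\<^esub> inv\<^bsub>G\<lparr>carrier := Ps\<rparr>\<^esub> x \<otimes>\<^bsub>G\<lparr>carrier := Ps\<rparr>\<^esub> inv\<^bsub>G\<lparr>carrier := Ps\<rparr>\<^esub> y = \<one>\<^bsub>G\<lparr>carrier := Ps\<rparr>\<^esub>"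
        using c K.m_assoc K.r_inv K.r_one K.inv_closed by metis
      then show ?thesis by simp
    qed
    ultimately have "{x \<otimes>\<^bsub>G\<^esub> y \<otimes>\<^bsub>G\<^esub> inv\<^bsub>G\<lparr>carrier := Ps\<rparr>\<^esub> x \<otimes>\<^bsub>G\<^esub> inv\<^bsub>G\<lparr>carrier := Ps\<rparr>\<^esub> y | x y.
        x \<in> lower_central (G\<lparr>carrier := Ps\<rparr>) 1 \<and> y \<in> Ps} \<subseteq> {\<one>\<^bsub>G\<^esub>}" by blast
    moreover have "subgroup {\<one>\<^bsub>G\<^esub>} (G\<lparr>carrier := Ps\<rparr>)" using K.triv_subgroup by simp
    ultimately show ?thesis
      using K.generate_subgroup_incl[of _ "{\<one>\<^bsub>G\<^esub>}"] by (simp add: numeral_2_eq_2)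
  qed
  have C: "lower_central (G\<lparr>carrier := Cs\<rparr>) 1 \<subseteq> Ps"
    using lower_central_one_subset[OF G_group subgroup_Cs subgroup_Es commute_Cs] subsets by blast
  have W: "lower_central (G\<lparr>carrier := carrier G\<rparr>) 1 \<subseteq> Cs"
    using lower_central_one_subset[OF G_group GG.subgroup_self subgroup_Cs commute_carrier] subsets by blast
  have ex: "\<exists>c. lower_central (G\<lparr>carrier := Ps\<rparr>) c \<subseteq> {\<one>\<^bsub>G\<^esub>}"
    "\<exists>c. lower_central (G\<lparr>carrier := Cs\<rparr>) c \<subseteq> Ps" "\<exists>c. lower_central (G\<lparr>carrier := carrier G\<rparr>) c \<subseteq> Cs"
    using P C W by blast+
  have "fitting_chain G 3 ?F"
    unfolding fitting_chain_def
  proof (intro conjI allI impI)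
    fix i :: nat assume "i < 3"
    then have i: "i = 0 \<or> i = 1 \<or> i = 2" by auto
    show "?F i \<subseteq> ?F (Suc i)" using i subsets subgroup.one_closed[OF subgroup_Ps] by auto
    show "\<exists>c. lower_central (G\<lparr>carrier := ?F (Suc i)\<rparr>) c \<subseteq> ?F i"
      using i ex by (elim disjE) simp_all
  next
    fix i :: nat
    have "carrier G \<lhd> G" by (simp add: GG.normal_inv_iff GG.subgroup_self)
    then show "?F i \<lhd> G" using normal_Ps normal_Cs GG.one_is_normal by simp
  qed auto
  then show "\<exists>F. fitting_chain G 3 F" by blast
next
  fix h assume "\<exists>F. fitting_chain G h F"
  then obtain F where F: "fitting_chain G h F" by blast
  show "3 \<le> h"
  proof (rule ccontr)
    assume "\<not> 3 \<le> h"
    obtain v where v: "v \<in> V" "v \<noteq> \<one>" using V_nontrivial by blast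
    have tG: "(0, v, zero_fn) \<in> lower_central G c" if "v \<in> V" for v c
      using lower_central_translations[OF GG.subgroup_self, of 1 v c] M1 basic_elements V_carrier that by simp
    have ne: "(0, v, zero_fn) \<noteq> \<one>\<^bsub>G\<^esub>" using v by (simp add: G_one)
    from F have F0: "F 0 = {\<one>\<^bsub>G\<^esub>}" and Fh: "F h = carrier G" and FN: "\<And>i. i \<le> h \<Longrightarrow> F i \<lhd> G"
      and FL: "\<And>i. i < h \<Longrightarrow> \<exists>c. lower_central (G\<lparr>carrier := F (Suc i)\<rparr>) c \<subseteq> F i"
      by (auto simp: fitting_chain_def)
    from \<open>\<not> 3 \<le> h\<close> consider "h = 0" | "h = 1" | "h = 2" by linarith
    then show False
    proof cases
      case 1
      then show False using F0 Fh tG[OF v(1), of 0] ne by auto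
    next
      case 2
      then obtain c where "lower_central (G\<lparr>carrier := carrier G\<rparr>) c \<subseteq> {\<one>\<^bsub>G\<^esub>}" using FL[of 0] F0 Fh by auto
      then show False using tG[OF v(1), of c] ne by auto
    next
      case 3
      \<comment> \<open>Nilpotency of the top quotient puts a term of the lower central series of
        \<open>G\<close> into \<open>F 1\<close>. Then \<open>F 1\<close> contains \<open>V\<close>
        and a nontrivial rotation and is not nilpotent.\<close>
      then obtain c where c: "lower_central (G\<lparr>carrier := carrier G\<rparr>) c \<subseteq> F 1"
        using FL[of 1] Fh by (auto simp: numeral_2_eq_2)
      obtain k where k: "0 < k" "k < M" "(k, \<one>, zero_fn) \<in> lower_central G c" using lower_central_rotations by blast
      obtain c' where c': "lower_central (G\<lparr>carrier := F 1\<rparr>) c' \<subseteq> {\<one>\<^bsub>G\<^esub>}" using FL[of 0] F0 3 by auto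
      have "(0, v, zero_fn) \<in> lower_central (G\<lparr>carrier := F 1\<rparr>) c'"
      proof (rule lower_central_translations[OF _ k(1,2)])
        show "subgroup (F 1) G" using FN[of 1] 3 normal_imp_subgroup by auto
        show "(k, \<one>, zero_fn) \<in> F 1" using k(3) c by auto
        show "(0, v, zero_fn) \<in> F 1" if "v \<in> V" for v using tG[OF that, of c] c by auto
      qed (rule v)
      then show False using c' ne by auto
    qed
  qed
qed

end

section \<open>Character degrees\<close>

definition unity_root :: "nat \<Rightarrow> int \<Rightarrow> complex" where
  "unity_root N k = cis (2 * pi * (of_int k / of_nat N))"

lemma unity_root_add: "unity_root N (k + l) = unity_root N k * unity_root N l"
  by (simp add: unity_root_def cis_mult add_divide_distrib distrib_left)

lemma unity_root_eq_iff:
  assumes "N > 0"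
  shows "unity_root N k = unity_root N l \<longleftrightarrow> [k = l] (mod int N)"
proof
  assume "unity_root N k = unity_root N l"
  then have "sin (2 * pi * (of_int k / of_nat N)) = sin (2 * pi * (of_int l / of_nat N)) \<and>
     cos (2 * pi * (of_int k / of_nat N)) = cos (2 * pi * (of_int l / of_nat N))"
    by (simp add: unity_root_def complex_eq_iff)
  then obtain m where "2 * pi * (of_int k / of_nat N) = 2 * pi * (of_int l / of_nat N) + 2 * pi * of_int m"
    using sin_cos_eq_iff by blast
  then have "2 * pi * (of_int k / of_nat N) = 2 * pi * (of_int l / of_nat N + of_int m)" by (simp only: distrib_left)
  then have "(of_int k :: real) / of_nat N = of_int l / of_nat N + of_int m" by (simp only: mult_cancel_left) auto
  then have "(of_int k :: real) = of_int l + of_int m * of_nat N" using assms by (simp add: field_simps)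
  then have "(of_int k :: real) = of_int (l + m * int N)" by simp
  then have "k = l + m * int N" by (simp only: of_int_eq_iff)
  then show "[k = l] (mod int N)" by (simp add: cong_def)
next
  assume "[k = l] (mod int N)"
  then obtain m where m: "k = l + int N * m" by (metis cong_iff_lin cong_sym)
  have "unity_root N (int N * m) = cis (2 * pi * of_int m)" using assms by (simp add: unity_root_def)
  then have "unity_root N (int N * m) = 1" by (simp add: cis_multiple_2pi)
  then show "unity_root N k = unity_root N l" by (simp add: m unity_root_add)
qed

text \<open>Multiplying the sum by \<open>\<chi> s\<close> only permutes its terms.\<close>

lemma character_sum_zero:
  fixes \<chi> :: "'a \<Rightarrow> complex" and K (structure)
  assumes "group K" "\<And>x y. x \<in> carrier K \<Longrightarrow> y \<in> carrier K \<Longrightarrow> \<chi> (x \<otimes> y) = \<chi> x * \<chi> y"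
    and "s \<in> carrier K" "\<chi> s \<noteq> 1"
  shows "(\<Sum>x\<in>carrier K. \<chi> x) = 0"
proof -
  interpret group K by fact
  have "bij_betw (\<lambda>x. s \<otimes> x) (carrier K) (carrier K)"
    by (rule bij_betwI[where g = "\<lambda>x. inv s \<otimes> x"]) (use assms(3) in \<open>auto simp: m_assoc[symmetric]\<close>)
  then have "(\<Sum>x\<in>carrier K. \<chi> x) = (\<Sum>x\<in>carrier K. \<chi> (s \<otimes> x))"
    by (rule sum.reindex_bij_betw[symmetric])
  also have "\<dots> = \<chi> s * (\<Sum>x\<in>carrier K. \<chi> x)" using assms(2,3) by (simp add: sum_distrib_left)
  finally have "(1 - \<chi> s) * (\<Sum>x\<in>carrier K. \<chi> x) = 0" by (simp add: algebra_simps)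
  then show ?thesis using assms(4) by simp
qed

text \<open>The residues modulo \<open>p\<close> form a group of prime order: if
  \<open>\<kappa>\<close> were 1 at the invertible residue \<open>s - t\<close>, it would be 1 at
  all its multiples, among them \<open>c\<close>.\<close>

lemma prime_character_injective:
  fixes \<kappa> :: "int \<Rightarrow> complex"
  assumes "Factorial_Ring.prime p" and add: "\<And>s t. \<kappa> (s + t) = \<kappa> s * \<kappa> t" and k0: "\<kappa> 0 = 1"
    and cong: "\<And>s t. [s = t] (mod int p) \<Longrightarrow> \<kappa> s = \<kappa> t" and c: "\<kappa> c \<noteq> 1" and eq: "\<kappa> s = \<kappa> t"
  shows "[s = t] (mod int p)"
proof (rule ccontr)
  assume "\<not> [s = t] (mod int p)"
  then have "\<not> int p dvd s - t" by (simp add: cong_iff_dvd_diff)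
  then have "coprime (s - t) (int p)"
    using assms(1) prime_imp_coprime[of "int p" "s - t"] by (simp add: coprime_commute)
  then obtain x where x: "[(s - t) * x = 1] (mod int p)" using cong_solve_coprime_int by blast
  have p0: "int p > 0" using assms(1) prime_gt_0_nat by simp
  have "\<kappa> s * \<kappa> (- s) = 1" using add[of s "- s"] k0 by simp
  then have "\<kappa> s \<noteq> 0" by auto
  moreover have "\<kappa> s = \<kappa> (s - t) * \<kappa> s" using add[of "s - t" t] eq by simp
  ultimately have one: "\<kappa> (s - t) = 1" by simp
  have mult: "\<kappa> ((s - t) * int n) = 1" for n
  proof (induction n)
    case 0
    then show ?case by (simp add: k0)
  next
    case (Suc n)
    have "(s - t) * int (Suc n) = (s - t) * int n + (s - t)" by (simp add: algebra_simps)
    then show ?case using Suc one add by simp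
  qed
  have "[(s - t) * int (nat (x * c mod int p)) = (s - t) * (x * c)] (mod int p)"
    using p0 by (intro cong_mult cong_refl) (simp add: cong_def)
  also have "(s - t) * (x * c) = ((s - t) * x) * c" by simp
  also have "[((s - t) * x) * c = 1 * c] (mod int p)" by (intro cong_mult x cong_refl)
  finally have "\<kappa> c = 1" using cong mult by (metis mult_1)
  then show False using c by simp
qed

lemma smult_vec_cancel:
  fixes v :: "complex vec"
  assumes "v \<in> carrier_vec d" "v \<noteq> 0\<^sub>v d" "a \<cdot>\<^sub>v v = b \<cdot>\<^sub>v v"
  shows "a = b"
proof -
  obtain i where i: "i < d" "v $ i \<noteq> 0" using assms(1,2) by (auto simp: vec_eq_iff)
  have "(a \<cdot>\<^sub>v v) $ i = (b \<cdot>\<^sub>v v) $ i" using assms(3) by simp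
  then show ?thesis using i assms(1) by simp
qed

lemma weight_space_subspace:
  assumes rep: "is_rep G d \<rho>" and "S \<subseteq> carrier G"
  shows "is_subspace d {w \<in> carrier_vec d. \<forall>x\<in>S. \<rho> x *\<^sub>v w = \<mu> x \<cdot>\<^sub>v w}"
proof -
  have c: "\<rho> x \<in> carrier_mat d d" if "x \<in> S" for x using rep_carrier[OF rep] assms(2) that by auto
  show ?thesis unfolding is_subspace_def
  proof (intro conjI ballI allI)
    show "0\<^sub>v d \<in> {w \<in> carrier_vec d. \<forall>x\<in>S. \<rho> x *\<^sub>v w = \<mu> x \<cdot>\<^sub>v w}"
      using c by (auto intro!: eq_vecI)
  next
    fix v w assume "v \<in> {w \<in> carrier_vec d. \<forall>x\<in>S. \<rho> x *\<^sub>v w = \<mu> x \<cdot>\<^sub>v w}"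
      "w \<in> {w \<in> carrier_vec d. \<forall>x\<in>S. \<rho> x *\<^sub>v w = \<mu> x \<cdot>\<^sub>v w}"
    then show "v + w \<in> {w \<in> carrier_vec d. \<forall>x\<in>S. \<rho> x *\<^sub>v w = \<mu> x \<cdot>\<^sub>v w}"
      using c by (simp add: mult_add_distrib_mat_vec[of _ d d] smult_add_distrib_vec[of _ d])
  next
    fix a v assume "v \<in> {w \<in> carrier_vec d. \<forall>x\<in>S. \<rho> x *\<^sub>v w = \<mu> x \<cdot>\<^sub>v w}"
    then show "a \<cdot>\<^sub>v v \<in> {w \<in> carrier_vec d. \<forall>x\<in>S. \<rho> x *\<^sub>v w = \<mu> x \<cdot>\<^sub>v w}"
      using c by (simp add: mult_mat_vec[of _ d d] smult_smult_assoc mult.commute)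
  qed auto
qed

lemma weight_mult:
  assumes rep: "is_rep G d \<rho>" and v: "v \<in> carrier_vec d" "v \<noteq> 0\<^sub>v d"
    and "x \<in> carrier G" "y \<in> carrier G"
    and "\<rho> x *\<^sub>v v = a \<cdot>\<^sub>v v" "\<rho> y *\<^sub>v v = b \<cdot>\<^sub>v v" "\<rho> (x \<otimes>\<^bsub>G\<^esub> y) *\<^sub>v v = c \<cdot>\<^sub>v v"
  shows "c = a * b"
proof -
  have "c \<cdot>\<^sub>v v = \<rho> x *\<^sub>v (b \<cdot>\<^sub>v v)" using rep_mult[OF rep assms(4,5) v(1)] assms(7,8) by simp
  also have "\<dots> = (a * b) \<cdot>\<^sub>v v"
    using rep_smult[OF rep assms(4) v(1)] assms(6) by (simp add: smult_smult_assoc mult.commute)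
  finally show ?thesis by (rule smult_vec_cancel[OF v])
qed

lemma commute_mod_rep:
  fixes G (structure)
  assumes "group G" and rep: "is_rep G d \<rho>" and "K \<subseteq> carrier G" "L \<subseteq> carrier G" "commute_mod G K L"
    and triv: "\<And>e w. e \<in> L \<Longrightarrow> w \<in> carrier_vec d \<Longrightarrow> \<rho> e *\<^sub>v w = w"
    and "x \<in> K" "y \<in> K" and w: "w \<in> carrier_vec d"
  shows "\<rho> x *\<^sub>v (\<rho> y *\<^sub>v w) = \<rho> y *\<^sub>v (\<rho> x *\<^sub>v w)"
proof -
  interpret group G by fact
  obtain e where e: "e \<in> L" "x \<otimes> y = y \<otimes> x \<otimes> e" using assms(5,7,8) by (auto simp: commute_mod_def)
  have c: "x \<in> carrier G" "y \<in> carrier G" "e \<in> carrier G" using assms(3,4,7,8) e by auto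
  have "\<rho> x *\<^sub>v (\<rho> y *\<^sub>v w) = \<rho> (y \<otimes> x \<otimes> e) *\<^sub>v w" using rep_mult[OF rep c(1,2) w] e by simp
  also have "\<dots> = \<rho> (y \<otimes> x) *\<^sub>v w" using rep_mult[OF rep _ c(3) w, of "y \<otimes> x"] c triv[OF e(1) w] by simp
  also have "\<dots> = \<rho> y *\<^sub>v (\<rho> x *\<^sub>v w)" by (rule rep_mult[OF rep c(2,1) w])
  finally show ?thesis .
qed

lemma common_weight:
  assumes "group G" "finite (carrier G)" "is_rep G d \<rho>"
    and "S \<subseteq> carrier G" "is_subspace d W" "W \<noteq> {0\<^sub>v d}"
    and "\<And>s v. s \<in> S \<Longrightarrow> v \<in> W \<Longrightarrow> \<rho> s *\<^sub>v v \<in> W"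
    and "\<And>s t v. s \<in> S \<Longrightarrow> t \<in> S \<Longrightarrow> v \<in> W \<Longrightarrow> \<rho> s *\<^sub>v (\<rho> t *\<^sub>v v) = \<rho> t *\<^sub>v (\<rho> s *\<^sub>v v)"
  obtains v \<mu> where "v \<in> W" "v \<in> carrier_vec d" "v \<noteq> 0\<^sub>v d" "\<And>s. s \<in> S \<Longrightarrow> \<rho> s *\<^sub>v v = \<mu> s \<cdot>\<^sub>v v"
proof -
  have "finite S" using assms(2,4) finite_subset by blast
  from common_eigenvector[OF assms(1-3) this assms(4-8)]
  obtain v where v: "v \<in> W" "v \<noteq> 0\<^sub>v d" "\<forall>s\<in>S. \<exists>c. \<rho> s *\<^sub>v v = c \<cdot>\<^sub>v v" by blast
  from bchoice[OF v(3)] obtain \<mu> where "\<forall>s\<in>S. \<rho> s *\<^sub>v v = \<mu> s \<cdot>\<^sub>v v" by blast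
  then show ?thesis using that v is_subspaceD(1)[OF assms(5)] by blast
qed

section \<open>Coset representatives and separation of weights\<close>

context frobenius_module
begin

lemma q_less_M: "q < M"
proof -
  have "1 \<le> p - 1" using p1 by linarith
  from mult_le_mono1[OF this, of q] have "q \<le> (p - 1) * q" by simp
  then show ?thesis using M_gt by linarith
qed

text \<open>The components of the quotient are described by the equations that they solve; the
  membership criteria for \<open>Cs\<close>, \<open>As\<close> and \<open>Ps\<close> follow without
  a formula for the inverse.\<close>

lemma quotient_components:
  assumes "(i, b, w) \<in> carrier G" "(j, a, f) \<in> carrier G"
  obtains k c h where "inv\<^bsub>G\<^esub> (i, b, w) \<otimes>\<^bsub>G\<^esub> (j, a, f) = (k, c, h)" "k < M" "c \<in> carrier U" "h \<in> aff"
    "(i + p ^ i * k) mod M = j" "b \<otimes> act i c = a" "[i + k = j] (mod q)"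
proof -
  obtain k c h where e: "inv\<^bsub>G\<^esub> (i, b, w) \<otimes>\<^bsub>G\<^esub> (j, a, f) = (k, c, h)" by (metis prod_cases3)
  have "(k, c, h) \<in> carrier G" unfolding e[symmetric] using assms by simp
  moreover have "(i, b, w) \<otimes>\<^bsub>G\<^esub> (k, c, h) = (j, a, f)"
    unfolding e[symmetric] using assms by (simp add: GG.m_assoc[symmetric])
  ultimately show ?thesis using that[OF e] idx_mod_q[of i k] by (auto simp: G_carrier G_mult cong_sym_eq)
qed

lemma quotient_in_Cs:
  assumes "(i, b, w) \<in> carrier G" "(j, a, f) \<in> carrier G"
  shows "inv\<^bsub>G\<^esub> (i, b, w) \<otimes>\<^bsub>G\<^esub> (j, a, f) \<in> Cs \<longleftrightarrow> [i = j] (mod q)"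
proof -
  obtain k c h where e: "inv\<^bsub>G\<^esub> (i, b, w) \<otimes>\<^bsub>G\<^esub> (j, a, f) = (k, c, h)" "k < M" "c \<in> carrier U" "h \<in> aff" "[i + k = j] (mod q)"
    by (rule quotient_components[OF assms])
  have "q dvd k \<longleftrightarrow> [i + 0 = i + k] (mod q)" by (simp only: cong_add_lcancel_nat) (simp add: cong_0_iff cong_sym_eq[of 0])
  also have "\<dots> \<longleftrightarrow> [i = j] (mod q)" using e(5) cong_trans cong_sym by (metis add_0_right)
  finally show ?thesis using e by (simp add: Cs_iff G_carrier)
qed

lemma quotient_in_As:
  assumes "(i, b, w) \<in> carrier G" "(j, a, f) \<in> carrier G"
  shows "inv\<^bsub>G\<^esub> (i, b, w) \<otimes>\<^bsub>G\<^esub> (j, a, f) \<in> As \<longleftrightarrow> [i = j] (mod q) \<and> b = a"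
proof -
  obtain k c h where e: "inv\<^bsub>G\<^esub> (i, b, w) \<otimes>\<^bsub>G\<^esub> (j, a, f) = (k, c, h)" "k < M" "c \<in> carrier U" "h \<in> aff" "b \<otimes> act i c = a"
    by (rule quotient_components[OF assms])
  have ib: "i < M" "b \<in> carrier U" using assms(1) by (auto simp: G_carrier)
  have "b = a \<longleftrightarrow> act i c = act i \<one>" using e(3,5) ib by (metis act_closed act_one r_one r_cancel_one' l_cancel one_closed)
  then have "b = a \<longleftrightarrow> c = \<one>" using act_inj[OF ib(1) e(3) one_closed] by simp
  moreover have "(k, c, h) \<in> Cs \<longleftrightarrow> [i = j] (mod q)" using quotient_in_Cs[OF assms] e(1) by simp
  ultimately show ?thesis using e by (auto simp: As_def Cs_def G_carrier)
qed

lemma quotient_in_Ps: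
  assumes "(i, b, w) \<in> carrier G" "(j, a, f) \<in> carrier G"
  shows "inv\<^bsub>G\<^esub> (i, b, w) \<otimes>\<^bsub>G\<^esub> (j, a, f) \<in> Ps \<longleftrightarrow> i = j"
proof -
  obtain k c h where e: "inv\<^bsub>G\<^esub> (i, b, w) \<otimes>\<^bsub>G\<^esub> (j, a, f) = (k, c, h)" "k < M" "c \<in> carrier U" "h \<in> aff" "(i + p ^ i * k) mod M = j"
    by (rule quotient_components[OF assms])
  have i: "i < M" using assms(1) by (simp add: G_carrier)
  have "k = 0" if "i = j"
  proof -
    have "[i + p ^ i * k = i + 0] (mod M)" using e(5) that i by (simp add: cong_def)
    then have "[p ^ i * k = 0] (mod M)" by (simp only: cong_add_lcancel_nat)
    then have "[p ^ ((q - 1) * i) * (p ^ i * k) = p ^ ((q - 1) * i) * 0] (mod M)" by (intro cong_mult cong_refl)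
    moreover have "p ^ ((q - 1) * i) * (p ^ i * k) = p ^ (q * i) * k"
    proof -
      have "(q - 1) * i + i = q * i" using q0 by (cases q) auto
      then show ?thesis by (metis mult.assoc power_add)
    qed
    moreover have "[p ^ (q * i) * k = 1 * k] (mod M)" by (intro cong_mult p_pow_M1 cong_refl) simp
    ultimately have "[1 * k = 0] (mod M)" using cong_trans cong_sym by (metis mult_0_right)
    then show ?thesis using e(2) by (simp add: cong_def)
  qed
  then have "k = 0 \<longleftrightarrow> i = j" using e(5) i by auto
  then show ?thesis using e by (auto simp: Ps_def)
qed

lemma transversal_carrier: "transversal G (carrier G) {\<one>\<^bsub>G\<^esub>}"
  unfolding transversal_def
proof (intro conjI ballI)
  fix g assume "g \<in> carrier G"
  then show "\<exists>!r. r \<in> {\<one>\<^bsub>G\<^esub>} \<and> inv\<^bsub>G\<^esub> r \<otimes>\<^bsub>G\<^esub> g \<in> carrier G"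
    by (intro ex1I[of _ "\<one>\<^bsub>G\<^esub>"]) auto
qed simp

lemma transversal_Cs: "transversal G Cs ((\<lambda>j. (j, \<one>, zero_fn)) ` {..<q})" "card ((\<lambda>j. (j, \<one>, zero_fn)) ` {..<q}) = q"
proof -
  have R: "(i, \<one>, zero_fn) \<in> carrier G" if "i < q" for i using basic_elements(3)[of i] that q_less_M by simp
  show "transversal G Cs ((\<lambda>j. (j, \<one>, zero_fn)) ` {..<q})"
    unfolding transversal_def
  proof (intro conjI ballI)
    fix g assume g: "g \<in> carrier G"
    obtain j a f where e: "g = (j, a, f)" by (cases g)
    show "\<exists>!r. r \<in> (\<lambda>j. (j, \<one>, zero_fn)) ` {..<q} \<and> inv\<^bsub>G\<^esub> r \<otimes>\<^bsub>G\<^esub> g \<in> Cs"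
    proof (rule ex1I[of _ "(j mod q, \<one>, zero_fn)"])
      show "(j mod q, \<one>, zero_fn) \<in> (\<lambda>j. (j, \<one>, zero_fn)) ` {..<q} \<and> inv\<^bsub>G\<^esub> (j mod q, \<one>, zero_fn) \<otimes>\<^bsub>G\<^esub> g \<in> Cs"
        using quotient_in_Cs[OF R g[unfolded e], of "j mod q"] q0 unfolding e by (auto simp: cong_def)
      fix r assume r: "r \<in> (\<lambda>j. (j, \<one>, zero_fn)) ` {..<q} \<and> inv\<^bsub>G\<^esub> r \<otimes>\<^bsub>G\<^esub> g \<in> Cs"
      then obtain i where i: "i < q" "r = (i, \<one>, zero_fn)" by auto
      then have "[i = j] (mod q)" using quotient_in_Cs[OF R[OF i(1)] g[unfolded e]] r unfolding e by simp
      then show "r = (j mod q, \<one>, zero_fn)" using i by (simp add: cong_def)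
    qed
  qed (use R in auto)
  show "card ((\<lambda>j. (j, \<one>, zero_fn)) ` {..<q}) = q" by (subst card_image) (auto simp: inj_on_def)
qed

lemma transversal_Ps: "transversal G Ps ((\<lambda>j. (j, \<one>, zero_fn)) ` {..<M})" "card ((\<lambda>j. (j, \<one>, zero_fn)) ` {..<M}) = M"
proof -
  have R: "(i, \<one>, zero_fn) \<in> carrier G" if "i < M" for i using basic_elements(3)[of i] that by simp
  show "transversal G Ps ((\<lambda>j. (j, \<one>, zero_fn)) ` {..<M})"
    unfolding transversal_def
  proof (intro conjI ballI)
    fix g assume g: "g \<in> carrier G"
    obtain j a f where e: "g = (j, a, f)" by (cases g)
    have j: "j < M" using g by (simp add: e G_carrier)
    show "\<exists>!r. r \<in> (\<lambda>j. (j, \<one>, zero_fn)) ` {..<M} \<and> inv\<^bsub>G\<^esub> r \<otimes>\<^bsub>G\<^esub> g \<in> Ps"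
    proof (rule ex1I[of _ "(j, \<one>, zero_fn)"])
      show "(j, \<one>, zero_fn) \<in> (\<lambda>j. (j, \<one>, zero_fn)) ` {..<M} \<and> inv\<^bsub>G\<^esub> (j, \<one>, zero_fn) \<otimes>\<^bsub>G\<^esub> g \<in> Ps"
        using quotient_in_Ps[OF R[OF j] g[unfolded e]] j unfolding e by auto
      fix r assume r: "r \<in> (\<lambda>j. (j, \<one>, zero_fn)) ` {..<M} \<and> inv\<^bsub>G\<^esub> r \<otimes>\<^bsub>G\<^esub> g \<in> Ps"
      then obtain i where i: "i < M" "r = (i, \<one>, zero_fn)" by auto
      then show "r = (j, \<one>, zero_fn)" using quotient_in_Ps[OF R[OF i(1)] g[unfolded e]] r unfolding e by simp
    qed
  qed (use R in auto)
  show "card ((\<lambda>j. (j, \<one>, zero_fn)) ` {..<M}) = M" by (subst card_image) (auto simp: inj_on_def)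
qed

lemma transversal_As: "transversal G As ((\<lambda>(j, a). (j, a, zero_fn)) ` ({..<q} \<times> carrier U))"
  "card ((\<lambda>(j, a). (j, a, zero_fn)) ` ({..<q} \<times> carrier U)) = card (carrier U) * q"
proof -
  have R: "(i, b, zero_fn) \<in> carrier G" if "i < q" "b \<in> carrier U" for i b using that q_less_M by (simp add: G_carrier)
  show "transversal G As ((\<lambda>(j, a). (j, a, zero_fn)) ` ({..<q} \<times> carrier U))"
    unfolding transversal_def
  proof (intro conjI ballI)
    fix g assume g: "g \<in> carrier G"
    obtain j a f where e: "g = (j, a, f)" by (cases g)
    have a: "a \<in> carrier U" using g by (simp add: e G_carrier)
    show "\<exists>!r. r \<in> (\<lambda>(j, a). (j, a, zero_fn)) ` ({..<q} \<times> carrier U) \<and> inv\<^bsub>G\<^esub> r \<otimes>\<^bsub>G\<^esub> g \<in> As"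
    proof (rule ex1I[of _ "(j mod q, a, zero_fn)"])
      show "(j mod q, a, zero_fn) \<in> (\<lambda>(j, a). (j, a, zero_fn)) ` ({..<q} \<times> carrier U) \<and> inv\<^bsub>G\<^esub> (j mod q, a, zero_fn) \<otimes>\<^bsub>G\<^esub> g \<in> As"
        using quotient_in_As[OF R g[unfolded e], of "j mod q" a] q0 a unfolding e by (auto simp: cong_def)
      fix r assume r: "r \<in> (\<lambda>(j, a). (j, a, zero_fn)) ` ({..<q} \<times> carrier U) \<and> inv\<^bsub>G\<^esub> r \<otimes>\<^bsub>G\<^esub> g \<in> As"
      then obtain i b where i: "i < q" "b \<in> carrier U" "r = (i, b, zero_fn)" by auto
      then have "[i = j] (mod q) \<and> b = a" using quotient_in_As[OF R[OF i(1,2)] g[unfolded e]] r unfolding e by simp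
      then show "r = (j mod q, a, zero_fn)" using i by (simp add: cong_def)
    qed
  qed (use R in auto)
  have "inj_on (\<lambda>(j, a). (j, a, zero_fn)) ({..<q} \<times> carrier U)" by (auto simp: inj_on_def)
  then show "card ((\<lambda>(j, a). (j, a, zero_fn)) ` ({..<q} \<times> carrier U)) = card (carrier U) * q"
    by (simp add: card_image card_cartesian_product mult.commute)
qed

lemma conj_closed:
  assumes "K \<lhd> G" "g \<in> carrier G" "y \<in> K"
  shows "\<exists>x\<in>K. x \<otimes>\<^bsub>G\<^esub> g = g \<otimes>\<^bsub>G\<^esub> y" "\<exists>x\<in>K. y \<otimes>\<^bsub>G\<^esub> g = g \<otimes>\<^bsub>G\<^esub> x"
proof -
  have yc: "y \<in> carrier G" using assms(1,3) normal_imp_subgroup subgroup.mem_carrier by metis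
  have "g \<otimes>\<^bsub>G\<^esub> y \<otimes>\<^bsub>G\<^esub> inv\<^bsub>G\<^esub> g \<in> K" by (rule normal.inv_op_closed2[OF assms])
  moreover have "g \<otimes>\<^bsub>G\<^esub> y \<otimes>\<^bsub>G\<^esub> inv\<^bsub>G\<^esub> g \<otimes>\<^bsub>G\<^esub> g = g \<otimes>\<^bsub>G\<^esub> y" using yc assms(2) by (simp add: GG.m_assoc)
  ultimately show "\<exists>x\<in>K. x \<otimes>\<^bsub>G\<^esub> g = g \<otimes>\<^bsub>G\<^esub> y" by blast
  have "inv\<^bsub>G\<^esub> g \<otimes>\<^bsub>G\<^esub> y \<otimes>\<^bsub>G\<^esub> g \<in> K" by (rule normal.inv_op_closed1[OF assms])
  moreover have "g \<otimes>\<^bsub>G\<^esub> (inv\<^bsub>G\<^esub> g \<otimes>\<^bsub>G\<^esub> y \<otimes>\<^bsub>G\<^esub> g) = y \<otimes>\<^bsub>G\<^esub> g" using yc assms(2) by (simp add: GG.m_assoc[symmetric])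
  ultimately show "\<exists>x\<in>K. y \<otimes>\<^bsub>G\<^esub> g = g \<otimes>\<^bsub>G\<^esub> x" by metis
qed

text \<open>Conjugation by an element of index \<open>i\<close> multiplies indices in C by
  \<open>p ^ i\<close>. The test element is the rotation \<open>q\<close>: the number
  \<open>p ^ (i mod q) * q\<close> is at most p^q - p^(q-1), hence below \<open>M\<close>, so it is
  congruent to \<open>q\<close> only if \<open>q\<close> divides \<open>i\<close>.\<close>

lemma separated_Cs: "separated G Cs Cs (\<lambda>x. unity_root M (int (fst x)))"
  unfolding separated_def
proof
  fix g assume g: "g \<in> carrier G - Cs"
  then have gc: "g \<in> carrier G" "\<not> q dvd fst g" by (auto simp: Cs_iff)
  obtain i a f where e: "g = (i, a, f)" by (cases g)
  note qM' = q_less_M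
  let ?y = "(q, \<one>, zero_fn)"
  have y: "?y \<in> Cs" using basic_elements(3)[OF qM'] by (simp add: Cs_iff)
  obtain x where x: "x \<in> Cs" "x \<otimes>\<^bsub>G\<^esub> g = g \<otimes>\<^bsub>G\<^esub> ?y" using conj_closed(1)[OF normal_Cs gc(1) y] by blast
  obtain k b h where k: "x = (k, b, h)" by (cases x)
  have qk: "q dvd k" using x by (simp add: Cs_iff k)
  have "\<not> [k = q] (mod M)"
  proof
    assume c: "[k = q] (mod M)"
    have "(k + p ^ k * i) mod M = (i + p ^ i * q) mod M" using x(2) by (simp add: e k G_mult)
    then have "[i + k = i + p ^ i * q] (mod M)" unfolding idx_M[OF qk] by (simp add: cong_def add.commute)
    then have "[k = p ^ i * q] (mod M)" by (simp only: cong_add_lcancel_nat)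
    also have "[p ^ i * q = p ^ (i mod q) * q] (mod M)" by (intro cong_mult p_pow_M cong_refl) (simp add: cong_def)
    finally have "[q = p ^ (i mod q) * q] (mod M)" using c cong_trans cong_sym by metis
    moreover have "p ^ (i mod q) * q < M"
    proof -
      have "q \<le> p - 1" using qp p1 by (intro dvd_imp_le) auto
      moreover have "p ^ (i mod q) \<le> p ^ (q - 1)"
        using q0 p0 pos_mod_bound mod_less_divisor[OF q0, of i] by (intro power_increasing) auto
      ultimately have "p ^ (i mod q) * q \<le> p ^ (q - 1) * (p - 1)" by (rule mult_le_mono[rotated])
      also have "\<dots> = p ^ q - p ^ (q - 1)"
        using power_minus_mult[OF q0, of p] by (simp add: diff_mult_distrib2)
      also have "\<dots> < M"
      proof -
        have "p ^ (q - 1) > 1" using p1 q1 by (intro one_less_power) auto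
        moreover have "p ^ (q - 1) \<le> p ^ q" using p0 by (intro power_increasing) auto
        ultimately show ?thesis unfolding M_def by linarith
      qed
      finally show ?thesis .
    qed
    ultimately have "q = p ^ (i mod q) * q" using qM' by (simp add: cong_def)
    then have "p ^ (i mod q) = 1" using q0 by simp
    then have "i mod q = 0" using p1 by simp
    then show False using gc(2) by (auto simp: e)
  qed
  then have "\<not> [int k = int q] (mod int M)" by (simp add: cong_int_iff)
  then have "unity_root M (int k) \<noteq> unity_root M (int q)" using unity_root_eq_iff[of M] M1 by simp
  then show "\<exists>x\<in>Cs. \<exists>y\<in>Cs. x \<otimes>\<^bsub>G\<^esub> g = g \<otimes>\<^bsub>G\<^esub> y \<and> unity_root M (int (fst x)) \<noteq> unity_root M (int (fst y))"
    using x y unfolding k by (intro bexI[of _ "(k, b, h)"] bexI[of _ ?y]) auto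
qed

text \<open>On \<open>Ns\<close> the weight depends on the value at \<open>\<one>\<close>. If
  \<open>q\<close> does not divide the index of \<open>g\<close>, conjugation changes the constant 1
  by a nontrivial power of \<open>z\<close>. Otherwise \<open>g\<close> has a translation part
  \<open>a\<close> other than \<open>\<one>\<close>, and a functional that is nonzero at
  \<open>a\<close> gets a new value at \<open>\<one>\<close>.\<close>

lemma separated_As:
  assumes \<mu>: "\<And>f. f \<in> aff \<Longrightarrow> \<mu> (0, \<one>, f) = \<kappa> (f \<one>)"
    and inj: "\<And>s t. \<kappa> s = \<kappa> t \<Longrightarrow> eqp s t"
  shows "separated G As Ns \<mu>"
  unfolding separated_def
proof
  fix g assume g: "g \<in> carrier G - As"
  obtain j a f where e: "g = (j, a, f)" by (cases g)
  have C: "j < M" "a \<in> carrier U" "f \<in> aff" using g by (auto simp: e G_carrier)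
  have rel: "eqp (int z ^ j * u' \<one>) (u a)"
    if "(0, \<one>, u) \<otimes>\<^bsub>G\<^esub> g = g \<otimes>\<^bsub>G\<^esub> (0, \<one>, u')" for u u'
  proof -
    have "mk (\<lambda>x. f x + u (act j x \<otimes> a)) = mk (\<lambda>x. int z ^ j * u' x + f (act 0 x \<otimes> \<one>))"
      using that by (simp add: e G_mult)
    from mk_mod[OF this one_closed] have "eqp (f \<one> + u a) (int z ^ j * u' \<one> + f \<one>)" using C by simp
    then have "eqp (f \<one> + u a - f \<one>) (int z ^ j * u' \<one> + f \<one> - f \<one>)" by (intro cong_diff cong_refl)
    then show ?thesis by (simp add: cong_sym_eq)
  qed
  show "\<exists>x\<in>Ns. \<exists>y\<in>Ns. x \<otimes>\<^bsub>G\<^esub> g = g \<otimes>\<^bsub>G\<^esub> y \<and> \<mu> x \<noteq> \<mu> y"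
  proof (cases "q dvd j")
    case False
    let ?y = "(0, \<one>, mk (\<lambda>_. 1))"
    have y: "?y \<in> Zs" by (auto simp: Zs_def)
    obtain x where x: "x \<in> Zs" "x \<otimes>\<^bsub>G\<^esub> g = g \<otimes>\<^bsub>G\<^esub> ?y" using conj_closed(1)[OF normal_Zs _ y] g by blast
    obtain c where c: "x = (0, \<one>, mk (\<lambda>_. c))" using x by (auto simp: Zs_def)
    have "eqp (int z ^ j * mk (\<lambda>_. 1) \<one>) (mk (\<lambda>_. c) a)" by (rule rel[OF x(2)[unfolded c]])
    then have r: "eqp (int z ^ j) c" using C by (simp add: cong_def mod_simps)
    have "\<mu> x \<noteq> \<mu> ?y"
    proof
      assume "\<mu> x = \<mu> ?y"
      then have "\<kappa> (mk (\<lambda>_. c) \<one>) = \<kappa> (mk (\<lambda>_. 1) \<one>)" using \<mu> by (simp add: c)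
      then have "eqp (mk (\<lambda>_. c) \<one>) (mk (\<lambda>_. 1) \<one>)" by (rule inj)
      then have "eqp c 1" by (simp add: cong_def)
      then show False using cong_trans[OF r] z_one_iff False by blast
    qed
    then show ?thesis using x y subsets(1) by blast
  next
    case True
    have "a \<noteq> \<one>" using g True by (auto simp: e As_def)
    then obtain u where u: "u \<in> aff" "u \<one> = 0" "u a \<noteq> 0" using separating_affine[OF C(2)] by blast
    have xN: "(0, \<one>, u) \<in> Ns" using u by (simp add: Ns_def)
    obtain y where y: "y \<in> Ns" "(0, \<one>, u) \<otimes>\<^bsub>G\<^esub> g = g \<otimes>\<^bsub>G\<^esub> y" using conj_closed(2)[OF normal_Ns _ xN] g by blast
    obtain u' where u': "y = (0, \<one>, u')" "u' \<in> aff" using y by (auto simp: Ns_def)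
    have "eqp (u' \<one>) (u a)"
      using cong_trans[OF cong_sym[OF cong_mult[OF z_one[OF True] cong_refl[of "u' \<one>"]]] rel[OF y(2)[unfolded u']]] by simp
    have "\<mu> (0, \<one>, u) \<noteq> \<mu> y"
    proof
      assume "\<mu> (0, \<one>, u) = \<mu> y"
      then have "\<kappa> (u \<one>) = \<kappa> (u' \<one>)" using \<mu> u u' by simp
      then have "eqp (u \<one>) (u' \<one>)" by (rule inj)
      then have "eqp 0 (u a)" using cong_trans[OF _ \<open>eqp (u' \<one>) (u a)\<close>] u(2) by simp
      then show False using u(3) aff_less[OF u(1) C(2)] by (simp add: cong_def)
    qed
    then show ?thesis using xN y by blast
  qed
qed

text \<open>If some \<open>g\<close> outside \<open>Ps\<close> fixed \<open>\<mu>\<close>, then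
  \<open>\<mu>\<close> would be 1 on commutators with \<open>g\<close>. Its rotation part has no
  fixed points on \<open>V\<close> and its dual, so up to \<open>Zs\<close> these commutators are
  all of both, and together with \<open>Zs\<close> they make up \<open>Es\<close>.\<close>

lemma separated_Ps:
  assumes mult: "\<And>x y. x \<in> Ps \<Longrightarrow> y \<in> Ps \<Longrightarrow> \<mu> (x \<otimes>\<^bsub>G\<^esub> y) = \<mu> x * \<mu> y"
    and triv: "\<And>x. x \<in> Zs \<Longrightarrow> \<mu> x = 1" and nontriv: "e \<in> Es" "\<mu> e \<noteq> 1"
  shows "separated G Ps Ps \<mu>"
proof (rule ccontr)
  assume "\<not> separated G Ps Ps \<mu>"
  then obtain g where g: "g \<in> carrier G" "g \<notin> Ps"
    and inv: "\<And>x y. x \<in> Ps \<Longrightarrow> y \<in> Ps \<Longrightarrow> x \<otimes>\<^bsub>G\<^esub> g = g \<otimes>\<^bsub>G\<^esub> y \<Longrightarrow> \<mu> x = \<mu> y"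
    unfolding separated_def by blast
  obtain j a f where e: "g = (j, a, f)" by (cases g)
  have C: "j < M" "a \<in> carrier U" "f \<in> aff" using g by (auto simp: e G_carrier)
  have "j \<noteq> 0" using g(2) C by (auto simp: e Ps_def)
  then have j0: "\<not> [j = 0] (mod M)" using C by (simp add: cong_def)
  have PsI: "(0, b, u) \<in> Ps" if "b \<in> carrier U" "u \<in> aff" for b u using that by (simp add: Ps_def)
  have const: "\<mu> (0, \<one>, mk (\<lambda>_. c)) = 1" for c by (rule triv) (auto simp: Zs_def)
  have nz: "\<mu> x \<noteq> 0" if x: "x \<in> Ps" for x
  proof
    assume "\<mu> x = 0"
    then have "\<mu> (x \<otimes>\<^bsub>G\<^esub> inv\<^bsub>G\<^esub> x) = 0"
      using mult[OF x subgroup.m_inv_closed[OF subgroup_Ps x]] by simp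
    then show False using triv[OF subgroup.one_closed[OF subgroup_Zs]] x subgroup.mem_carrier[OF subgroup_Ps] by simp
  qed
  have tau: "\<mu> (0, v, zero_fn) = 1" if v: "v \<in> V" for v
  proof -
    obtain b where b: "b \<in> V" "act j b \<otimes> inv b = v" using act_quotient_surj[OF j0 v] by blast
    note c = V_carrier[OF v] V_carrier[OF b(1)]
    have y: "(0, b, zero_fn) \<in> Ps" using c PsI by simp
    obtain x where x: "x \<in> Ps" "x \<otimes>\<^bsub>G\<^esub> g = g \<otimes>\<^bsub>G\<^esub> (0, b, zero_fn)" using conj_closed(1)[OF normal_Ps g(1) y] by blast
    obtain c' u where xe: "x = (0, c', u)" "c' \<in> carrier U" "u \<in> aff" using x by (auto simp: Ps_def)
    have eq: "c' \<otimes> a = a \<otimes> act j b"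
      "mk (\<lambda>t. f t + u (act j t \<otimes> a)) = mk (\<lambda>t. int z ^ j * zero_fn t + f (act 0 t \<otimes> b))"
      using x(2) C by (simp_all add: e xe G_mult act_0)
    have c': "c' = act j b" using eq(1) C c xe by (simp add: m_comm)
    have "eqp (u t) (f b - f \<one>)" if t: "t \<in> carrier U" for t
    proof -
      \<comment> \<open>The argument that \<open>g\<close> moves to \<open>t\<close>: there the
        function equation shows that \<open>u\<close> is constant, so \<open>x\<close> is a
        translation up to \<open>Zs\<close>.\<close>
      let ?t = "act (idx_inv j) (t \<otimes> inv a)"
      have tt: "act j ?t \<otimes> a = t" using t C by (simp only: act_surj[OF C(1)] m_closed inv_closed) (simp add: m_assoc)
      have tc: "?t \<in> carrier U" using t C by simp
      from mk_mod[OF eq(2) tc] have "eqp (f ?t + u t) (f (?t \<otimes> b))"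
        unfolding tt using tc c by (simp add: act_0)
      also have "eqp (f (?t \<otimes> b)) (f ?t + (f b - f \<one>))" by (intro affine_trans aff_affine C tc c)
      finally have "eqp (f ?t + u t - f ?t) (f ?t + (f b - f \<one>) - f ?t)" by (intro cong_diff cong_refl)
      then show ?thesis by simp
    qed
    then have "u = mk (\<lambda>_. f b - f \<one>)" using mk_id[OF xe(3)] mk_eq_iff[of u "\<lambda>_. f b - f \<one>"] by simp
    then have "x = (0, act j b, zero_fn) \<otimes>\<^bsub>G\<^esub> (0, \<one>, mk (\<lambda>_. f b - f \<one>))"
      using c by (simp add: xe c' P_mult mk_eq_iff cong_def)
    then have "\<mu> x = \<mu> (0, act j b, zero_fn)" using mult PsI c const by simp
    moreover have "\<mu> x = \<mu> (0, b, zero_fn)" by (rule inv[OF x(1) y x(2)])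
    moreover have "(0, act j b, zero_fn) = (0, v, zero_fn) \<otimes>\<^bsub>G\<^esub> (0, b, zero_fn)"
    proof -
      have "act j b = v \<otimes> b" unfolding b(2)[symmetric] using c by (simp add: m_assoc)
      then show ?thesis using c by (simp add: P_mult mk_eq_iff)
    qed
    ultimately have "\<mu> (0, v, zero_fn) * \<mu> (0, b, zero_fn) = \<mu> (0, b, zero_fn)" using mult PsI c by simp
    then show ?thesis using nz[OF y] by simp
  qed
  have nu: "\<mu> (0, \<one>, w) = 1" if w: "w \<in> Ls" for w
  proof -
    obtain u where u: "u \<in> Ls" "w = mk (\<lambda>x. twist j u x - u x)" using twist_surj[OF j0 w] by blast
    note A = Ls_aff[OF u(1)] note T = Ls_aff[OF twist_Ls[OF u(1), of j]] note B = Ls_aff[OF w]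
    let ?c = "int z ^ ((q - 1) * j) * u a"
    let ?w = "mk (\<lambda>x. int z ^ ((q - 1) * j) * ((f x - f (x \<otimes> act (idx_inv j) \<one>)) + u (act j x \<otimes> a)))"
    have y: "(0, \<one>, u) \<otimes>\<^bsub>G\<^esub> g = g \<otimes>\<^bsub>G\<^esub> (0, \<one>, ?w)" "?w \<in> aff"
      using conj_P[OF g(1)[unfolded e] one_closed A(1)] unfolding e by simp_all
    have "(0, \<one>, ?w) = (0, \<one>, twist j u) \<otimes>\<^bsub>G\<^esub> (0, \<one>, mk (\<lambda>_. ?c))"
    proof -
      have "?w = mk (\<lambda>x. mk (\<lambda>_. ?c) x + twist j u (x \<otimes> \<one>))"
        unfolding mk_eq_iff
      proof
        fix x assume x: "x \<in> carrier U"
        have "eqp (int z ^ ((q - 1) * j) * u (act j x \<otimes> a)) (int z ^ ((q - 1) * j) * (u (act j x) + u a))"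
          by (intro cong_mult cong_refl affine_hom aff_affine A) (use A x C in auto)
        also have "int z ^ ((q - 1) * j) * (u (act j x) + u a) = ?c + int z ^ ((q - 1) * j) * u (act j x)"
          by (simp add: distrib_left)
        also have "eqp (?c + int z ^ ((q - 1) * j) * u (act j x)) (mk (\<lambda>_. ?c) x + twist j u (x \<otimes> \<one>))"
          using x by (intro cong_add) (simp_all add: twist_def cong_def)
        finally show "eqp (int z ^ ((q - 1) * j) * ((f x - f (x \<otimes> act (idx_inv j) \<one>)) + u (act j x \<otimes> a)))
           (mk (\<lambda>_. ?c) x + twist j u (x \<otimes> \<one>))" using x by simp
      qed
      then show ?thesis by (simp add: P_mult)
    qed
    then have "\<mu> (0, \<one>, ?w) = \<mu> (0, \<one>, twist j u)" using mult PsI T const by simp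
    moreover have "\<mu> (0, \<one>, u) = \<mu> (0, \<one>, ?w)" by (rule inv[OF _ _ y(1)]) (use PsI A y(2) in auto)
    moreover have "(0, \<one>, twist j u) = (0, \<one>, w) \<otimes>\<^bsub>G\<^esub> (0, \<one>, u)"
    proof -
      have "twist j u = mk (\<lambda>x. u x + w (x \<otimes> \<one>))"
        using mk_id[OF T(1)] mk_eq_iff[of "twist j u" "\<lambda>x. u x + w (x \<otimes> \<one>)"]
        by (simp add: u(2) cong_def mod_simps)
      then show ?thesis by (simp add: P_mult)
    qed
    ultimately have "\<mu> (0, \<one>, w) * \<mu> (0, \<one>, u) = \<mu> (0, \<one>, u)" using mult PsI A B by simp
    then show ?thesis using nz[of "(0, \<one>, u)"] PsI A by simp
  qed
  obtain v h where vh: "e = (0, v, h)" "v \<in> V" "h \<in> aff" "\<forall>d\<in>D. h d = h \<one>"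
    using nontriv(1) unfolding Es_def by blast
  note vc = V_carrier[OF vh(2)]
  \<comment> \<open>In the product below, the factor \<open>(0, v, zero_fn)\<close> on the right
    shifts the argument by \<open>v\<close>; the \<open>inv v\<close> compensates for this.\<close>
  let ?l = "\<lambda>t. h (t \<otimes> inv v) - h (inv v)"
  have affl: "affine ?l" 
    using vc by (intro affine_diff[OF affine_translate[OF aff_affine[OF vh(3)]] affine_const]) simp
  have "eqp (?l d) 0" if d: "d \<in> D" for d
    using affine_trans'[OF aff_affine[OF vh(3)] D_carrier[OF d], of "inv v"] vh(4) d vc by simp
  then have lL: "mk ?l \<in> Ls" using affl D_carrier vc by (simp add: Ls_def cong_def)
  have "e = (0, \<one>, mk ?l) \<otimes>\<^bsub>G\<^esub> (0, \<one>, mk (\<lambda>_. h (inv v))) \<otimes>\<^bsub>G\<^esub> (0, v, zero_fn)"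
  proof -
    have "h = mk (\<lambda>x. zero_fn x + mk (\<lambda>x. mk (\<lambda>_. h (inv v)) x + mk ?l (x \<otimes> \<one>)) (x \<otimes> v))"
      using mk_id[OF vh(3)] mk_eq_iff[of h "\<lambda>x. zero_fn x + mk (\<lambda>x. mk (\<lambda>_. h (inv v)) x + mk ?l (x \<otimes> \<one>)) (x \<otimes> v)"] vc
      by (simp add: cong_def mod_simps m_assoc)
    then show ?thesis using vc by (simp add: vh(1) P_mult)
  qed
  moreover have "(0, \<one>, mk ?l) \<in> Ps" "(0, \<one>, mk (\<lambda>_. h (inv v))) \<in> Ps" "(0, v, zero_fn) \<in> Ps"
    using PsI affl vc by auto
  ultimately have "\<mu> e = 1"
    using mult subgroup.m_closed[OF subgroup_Ps] nu[OF lL] const tau[OF vh(2)] by simp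
  then show False using nontriv(2) by simp
qed

end

section \<open>The character degrees of \<open>G\<close>\<close>

context frobenius_module
begin

text \<open>The inducing linear characters are the trivial one of \<open>G\<close>, the rotation
  index on \<open>Cs\<close>, a functional of the translation part on \<open>Ps\<close>, and the
  value at \<open>\<one>\<close> of the function part on \<open>As\<close>. The last is
  multiplicative because \<open>z ^ i\<close> is 1 on \<open>As\<close>.\<close>

lemma degrees_attained: "1 \<in> cd G" "q \<in> cd G" "M \<in> cd G" "card (carrier U) * q \<in> cd G"
proof -
  have ur0: "unity_root N 0 = 1" for N by (simp add: unity_root_def)
  have "\<exists>\<rho>. irr_rep G (card {\<one>\<^bsub>G\<^esub>}) \<rho>"
    by (rule induced_irr_rep[OF G_group G_finite GG.subgroup_self transversal_carrier GG.one_is_normal,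
          where \<mu> = "\<lambda>_. 1"]) (auto simp: separated_def)
  then show "1 \<in> cd G" by (simp add: cd_def)
  have "\<exists>\<rho>. irr_rep G (card ((\<lambda>j. (j, \<one>, zero_fn)) ` {..<q})) \<rho>"
  proof (rule induced_irr_rep[OF G_group G_finite subgroup_Cs transversal_Cs(1) normal_Cs subset_refl separated_Cs])
    show "unity_root M (int (fst \<one>\<^bsub>G\<^esub>)) = 1" by (simp add: G_one ur0)
    fix x y assume xy: "x \<in> Cs" "y \<in> Cs"
    have "fst (x \<otimes>\<^bsub>G\<^esub> y) = (fst x + fst y) mod M"
      using xy by (cases x; cases y) (simp add: G_mult Cs_iff idx_M)
    then have "[int (fst (x \<otimes>\<^bsub>G\<^esub> y)) = int (fst x) + int (fst y)] (mod int M)" by (simp add: cong_def of_nat_mod)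
    then have "unity_root M (int (fst (x \<otimes>\<^bsub>G\<^esub> y))) = unity_root M (int (fst x) + int (fst y))"
      using unity_root_eq_iff[of M] M1 by simp
    then show "unity_root M (int (fst (x \<otimes>\<^bsub>G\<^esub> y))) = unity_root M (int (fst x)) * unity_root M (int (fst y))"
      by (simp add: unity_root_add)
  qed
  then show "q \<in> cd G" unfolding transversal_Cs(2) by (simp add: cd_def)
  obtain v where v: "v \<in> V" "v \<noteq> \<one>" using V_nontrivial by blast
  note vc = V_carrier[OF v(1)]
  obtain f where f: "f \<in> aff" "f \<one> = 0" "f v \<noteq> 0" using separating_affine[OF vc v(2)] by blast
  let ?\<mu> = "\<lambda>x :: nat \<times> 'x \<times> ('x \<Rightarrow> int). unity_root p (f (fst (snd x)))"
  have mult: "?\<mu> (x \<otimes>\<^bsub>G\<^esub> y) = ?\<mu> x * ?\<mu> y" if xP: "x \<in> Ps" "y \<in> Ps" for x y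
  proof -
    obtain a u b w where xy: "x = (0, a, u)" "a \<in> carrier U" "y = (0, b, w)" "b \<in> carrier U"
      using xP by (auto simp: Ps_def)
    have "eqp (f (a \<otimes> b)) (f a + f b)" by (intro affine_hom aff_affine f xy) (simp add: f)
    then have "unity_root p (f (a \<otimes> b)) = unity_root p (f a + f b)" using unity_root_eq_iff[OF p0] by simp
    then show ?thesis using xy by (simp add: P_mult unity_root_add)
  qed
  have "separated G Ps Ps ?\<mu>"
  proof (rule separated_Ps[OF mult])
    show "?\<mu> x = 1" if "x \<in> Zs" for x using that f(2) by (auto simp: Zs_def ur0)
    show "(0, v, zero_fn) \<in> Es" using v D_carrier by (simp add: Es_def)
    have "\<not> eqp (f v) 0" using f(3) aff_less[OF f(1) vc] by (simp add: cong_def)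
    then show "?\<mu> (0, v, zero_fn) \<noteq> 1" using unity_root_eq_iff[OF p0, of "f v" 0] by (simp add: ur0)
  qed
  then have "\<exists>\<rho>. irr_rep G (card ((\<lambda>j. (j, \<one>, zero_fn)) ` {..<M})) \<rho>"
    by (rule induced_irr_rep[OF G_group G_finite subgroup_Ps transversal_Ps(1) normal_Ps subset_refl _ _ mult])
       (simp_all add: G_one f(2) ur0)
  then show "M \<in> cd G" unfolding transversal_Ps(2) by (simp add: cd_def)
  let ?\<nu> = "\<lambda>x :: nat \<times> 'x \<times> ('x \<Rightarrow> int). unity_root p ((snd (snd x)) \<one>)"
  have "separated G As Ns ?\<nu>"
    by (rule separated_As[where \<kappa> = "unity_root p"]) (simp_all add: unity_root_eq_iff[OF p0])
  then have "\<exists>\<rho>. irr_rep G (card ((\<lambda>(j, a). (j, a, zero_fn)) ` ({..<q} \<times> carrier U))) \<rho>"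
  proof (rule induced_irr_rep[OF G_group G_finite subgroup_As transversal_As(1) normal_Ns subsets(6)])
    show "?\<nu> \<one>\<^bsub>G\<^esub> = 1" by (simp add: G_one ur0)
    fix x y assume "x \<in> As" "y \<in> As"
    then obtain i u j w where xy: "x = (i, \<one>, u)" "q dvd i" "y = (j, \<one>, w)" by (auto simp: As_def)
    have "eqp (mk (\<lambda>t. int z ^ i * w t + u (act j t \<otimes> \<one>)) \<one>) (int z ^ i * w \<one> + u \<one>)"
      by (simp add: cong_def)
    also have "eqp (int z ^ i * w \<one> + u \<one>) (1 * w \<one> + u \<one>)" by (intro cong_add cong_mult z_one xy cong_refl)
    finally have "?\<nu> (x \<otimes>\<^bsub>G\<^esub> y) = unity_root p (u \<one> + w \<one>)"
      using unity_root_eq_iff[OF p0] by (simp add: xy G_mult add.commute)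
    then show "?\<nu> (x \<otimes>\<^bsub>G\<^esub> y) = ?\<nu> x * ?\<nu> y" by (simp add: xy unity_root_add)
  qed
  then show "card (carrier U) * q \<in> cd G" unfolding transversal_As(2) by (simp add: cd_def)
qed

text \<open>If the centre of \<open>P\<close> acts nontrivially, then \<open>X\<close> permutes the extensions of a central character
  to \<open>N\<close> transitively. The extension that is trivial on the linear functionals is found by averaging:
  the double sum over \<open>X\<close> and the linear functionals does not vanish.\<close>
lemma translate_to_central_weight:
  assumes rep: "is_rep G d \<rho>" and v: "v \<in> carrier_vec d" "v \<noteq> 0\<^sub>v d"
    and wt: "\<And>x. x \<in> Ns \<Longrightarrow> \<rho> x *\<^sub>v v = \<mu> x \<cdot>\<^sub>v v" and nontriv: "\<mu> (0, \<one>, mk (\<lambda>_. c0)) \<noteq> 1"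
  obtains w \<kappa> where "w \<in> carrier_vec d" "w \<noteq> 0\<^sub>v d" "\<And>f. f \<in> aff \<Longrightarrow> \<rho> (0, \<one>, f) *\<^sub>v w = \<kappa> (f \<one>) \<cdot>\<^sub>v w"
    "\<And>s t. \<kappa> s = \<kappa> t \<longleftrightarrow> eqp s t"
proof -
  have Nc: "x \<in> carrier G" if "x \<in> Ns" for x using that subgroup.mem_carrier[OF subgroup_Ns] by blast
  have NsI: "(0, \<one>, f) \<in> Ns" if "f \<in> aff" for f using that by (simp add: Ns_def)
  have mult: "\<mu> (x \<otimes>\<^bsub>G\<^esub> y) = \<mu> x * \<mu> y" if "x \<in> Ns" "y \<in> Ns" for x y
    by (rule weight_mult[OF rep v Nc[OF that(1)] Nc[OF that(2)] wt[OF that(1)] wt[OF that(2)]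
          wt[OF subgroup.m_closed[OF subgroup_Ns that]]])
  have one: "\<mu> \<one>\<^bsub>G\<^esub> = 1"
  proof -
    have "\<mu> \<one>\<^bsub>G\<^esub> \<cdot>\<^sub>v v = 1 \<cdot>\<^sub>v v"
      using wt[OF subgroup.one_closed[OF subgroup_Ns]] rep_one[OF rep v(1)] v by simp
    then show ?thesis by (rule smult_vec_cancel[OF v])
  qed
  define \<kappa> where "\<kappa> c = \<mu> (0, \<one>, mk (\<lambda>_. c))" for c
  have mk_add: "(0, \<one>, f) \<otimes>\<^bsub>G\<^esub> (0, \<one>, g) = (0, \<one>, mk (\<lambda>x. g x + f x))" for f g
    by (simp add: P_mult mk_eq_iff)
  have \<kappa>_add: "\<kappa> (s + t) = \<kappa> s * \<kappa> t" for s t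
  proof -
    have "(0, \<one>, mk (\<lambda>_. s + t)) = (0, \<one>, mk (\<lambda>_. s)) \<otimes>\<^bsub>G\<^esub> (0, \<one>, mk (\<lambda>_. t))"
      by (simp add: mk_add mk_eq_iff cong_def mod_simps add.commute)
    then show ?thesis using mult NsI by (simp add: \<kappa>_def)
  qed
  have \<kappa>_cong: "\<kappa> s = \<kappa> t" if "eqp s t" for s t
  proof -
    have "mk (\<lambda>_. s) = mk (\<lambda>_. t)" using that by (simp add: mk_eq_iff)
    then show ?thesis by (simp add: \<kappa>_def)
  qed
  have \<kappa>0: "\<kappa> 0 = 1" using one by (simp add: \<kappa>_def G_one)
  have \<kappa>_iff: "\<kappa> s = \<kappa> t \<longleftrightarrow> eqp s t" for s t
    using prime_character_injective[of p \<kappa> c0 s t] p \<kappa>_add \<kappa>0 \<kappa>_cong nontriv by (auto simp: \<kappa>_def)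
  define L where "L = {(0::nat, \<one>, f) | f. f \<in> aff \<and> f \<one> = 0}"
  have LN: "L \<subseteq> Ns" by (auto simp: L_def Ns_def)
  have L: "subgroup L G"
  proof (rule finite_subgroupI[OF G_group G_finite])
    show "L \<subseteq> carrier G" using LN Nc by blast
    show "\<one>\<^bsub>G\<^esub> \<in> L" by (simp add: L_def G_one)
    show "x \<otimes>\<^bsub>G\<^esub> y \<in> L" if xL: "x \<in> L" "y \<in> L" for x y
    proof -
      obtain f g where fg: "x = (0, \<one>, f)" "f \<in> aff" "f \<one> = 0" "y = (0, \<one>, g)" "g \<in> aff" "g \<one> = 0"
        using xL by (auto simp: L_def)
      have "affine (\<lambda>x. g x + f x)" by (intro affine_add aff_affine fg)
      then show ?thesis using fg by (simp add: mk_add L_def)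
    qed
  qed
  have finL: "finite L" using L G_finite subgroup.subset finite_subset by blast
  \<comment> \<open>The weight on \<open>L\<close> of the vector translated by \<open>x\<close>:
    conjugation by the translation changes a linear functional \<open>f\<close> by the constant
    \<open>f x\<close>.\<close>
  define \<chi> where "\<chi> x y = \<mu> y * \<kappa> ((snd (snd y)) x)" for x and y :: "nat \<times> 'x \<times> ('x \<Rightarrow> int)"
  have \<chi>_mult: "\<chi> x (y \<otimes>\<^bsub>G\<^esub> y') = \<chi> x y * \<chi> x y'" if x: "x \<in> carrier U" and y: "y \<in> L" "y' \<in> L" for x y y'
  proof -
    obtain f g where fg: "y = (0, \<one>, f)" "y' = (0, \<one>, g)" using y by (auto simp: L_def)
    have "\<kappa> (mk (\<lambda>x. g x + f x) x) = \<kappa> (f x + g x)" using x by (intro \<kappa>_cong) (simp add: cong_def add.commute)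
    moreover have "\<mu> (y \<otimes>\<^bsub>G\<^esub> y') = \<mu> y * \<mu> y'" using y LN by (intro mult) auto
    ultimately show ?thesis unfolding \<chi>_def by (simp add: fg mk_add \<kappa>_add)
  qed
  \<comment> \<open>For a nonzero functional \<open>f\<close> the map from \<open>x\<close> to
    \<open>\<kappa> (f x)\<close> is a nontrivial character of \<open>U\<close>, because
    \<open>\<kappa>\<close> is injective modulo \<open>p\<close>.\<close>
  have inner: "(\<Sum>x\<in>carrier U. \<chi> x y) = (if y = \<one>\<^bsub>G\<^esub> then of_nat (card (carrier U)) else 0)" if y: "y \<in> L" for y
  proof (cases "y = \<one>\<^bsub>G\<^esub>")
    case True
    have "\<chi> x y = 1" if "x \<in> carrier U" for x using that one \<kappa>0 unfolding \<chi>_def True by (simp add: G_one)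
    then show ?thesis using True by simp
  next
    case False
    obtain f where f: "y = (0, \<one>, f)" "f \<in> aff" "f \<one> = 0" using y unfolding L_def by blast
    have "f \<noteq> zero_fn" using False f by (simp add: G_one)
    then obtain x where x: "x \<in> carrier U" "\<not> eqp (f x) 0" using mk_id[OF f(2)] mk_eq_iff[of f "\<lambda>_. 0"] by auto
    have "(\<Sum>x\<in>carrier U. \<kappa> (f x)) = 0"
    proof (rule character_sum_zero[OF is_group _ x(1)])
      show "\<kappa> (f (a \<otimes> b)) = \<kappa> (f a) * \<kappa> (f b)" if "a \<in> carrier U" "b \<in> carrier U" for a b
      proof -
        have "eqp (f (a \<otimes> b)) (f a + f b)" by (intro affine_hom aff_affine f that) (simp add: f)
        then show ?thesis using \<kappa>_cong \<kappa>_add by metis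
      qed
      show "\<kappa> (f x) \<noteq> 1" using x(2) \<kappa>_iff[of "f x" 0] \<kappa>0 by simp
    qed
    then show ?thesis using False by (simp add: \<chi>_def f(1) flip: sum_distrib_left)
  qed
  \<comment> \<open>Since the double sum is nonzero, some \<open>\<chi> x\<close> has a nonzero sum
    over \<open>L\<close>, and only the trivial character has that. This \<open>x\<close> gives the
    translation sought.\<close>
  have "(\<Sum>x\<in>carrier U. \<Sum>y\<in>L. \<chi> x y) = (\<Sum>y\<in>L. \<Sum>x\<in>carrier U. \<chi> x y)" by (rule sum.swap)
  also have "\<dots> = (\<Sum>y\<in>L. if y = \<one>\<^bsub>G\<^esub> then of_nat (card (carrier U)) else 0)" by (intro sum.cong inner refl)
  also have "\<dots> = of_nat (card (carrier U))" using finL subgroup.one_closed[OF L] by simp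
  finally have "(\<Sum>x\<in>carrier U. \<Sum>y\<in>L. \<chi> x y) \<noteq> 0" using finU by (auto simp: card_eq_0_iff)
  then obtain x where x: "x \<in> carrier U" "(\<Sum>y\<in>L. \<chi> x y) \<noteq> 0" by (meson sum.neutral)
  have \<chi>1: "\<chi> x y = 1" if y: "y \<in> L" for y
  proof (rule ccontr)
    assume ne: "\<chi> x y \<noteq> 1"
    have "(\<Sum>y\<in>carrier (G\<lparr>carrier := L\<rparr>). \<chi> x y) = 0"
      by (rule character_sum_zero[OF GG.subgroup_imp_group[OF L], of _ y]) (use \<chi>_mult x(1) y ne in auto)
    then show False using x(2) by simp
  qed
  define w where "w = \<rho> (0, x, zero_fn) *\<^sub>v v"
  have tG: "(0, x, zero_fn) \<in> carrier G" "(0, inv x, zero_fn) \<in> carrier G" using basic_elements x by auto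
  show ?thesis
  proof (rule that[of w \<kappa>])
    show "w \<in> carrier_vec d" using rep tG v by (simp add: w_def)
    show "w \<noteq> 0\<^sub>v d"
    proof
      assume "w = 0\<^sub>v d"
      have "(0, inv x, zero_fn) \<otimes>\<^bsub>G\<^esub> (0, x, zero_fn) = \<one>\<^bsub>G\<^esub>" using x by (simp add: P_mult G_one mk_eq_iff)
      then have "v = \<rho> (0, inv x, zero_fn) *\<^sub>v w"
        unfolding w_def using rep_mult[OF rep tG(2,1) v(1)] rep_one[OF rep v(1)] by simp
      also have "\<dots> = 0\<^sub>v d" using rep_carrier[OF rep tG(2)] \<open>w = 0\<^sub>v d\<close> by simp
      finally show False using v by simp
    qed
    fix f assume f: "f \<in> aff"
    \<comment> \<open>Translation turns \<open>f\<close> into \<open>?g\<close>, a sum of the linear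
      part \<open>?l\<close> and a constant. \<open>?c\<close> is not simplified to
      \<open>f x\<close>, so that additivity of \<open>\<kappa>\<close> splits off
      \<open>\<kappa> (f \<one>)\<close>.\<close>
    let ?g = "mk (\<lambda>t. f (t \<otimes> x))" and ?l = "mk (\<lambda>t. f t - f \<one>)" and ?c = "f x - f \<one> + f \<one>"
    have g: "?g \<in> aff" using affine_translate[OF aff_affine[OF f] x(1)] by simp
    have "affine (\<lambda>t. f t - f \<one>)" by (rule affine_diff[OF aff_affine[OF f] affine_const])
    then have l: "(0, \<one>, ?l) \<in> L" by (simp add: L_def)
    have "?g = mk (\<lambda>t. mk (\<lambda>_. ?c) t + ?l t)"
      unfolding mk_eq_iff
    proof
      fix t assume t: "t \<in> carrier U"
      have "eqp (f (t \<otimes> x)) (f t + (f x - f \<one>))" by (rule affine_trans[OF aff_affine[OF f] t x(1)])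
      also have "f t + (f x - f \<one>) = ?c + (f t - f \<one>)" by simp
      also have "eqp (?c + (f t - f \<one>)) (mk (\<lambda>_. ?c) t + ?l t)"
        using t by (intro cong_add) (simp_all add: cong_def)
      finally show "eqp (f (t \<otimes> x)) (mk (\<lambda>_. ?c) t + ?l t)" .
    qed
    then have "(0, \<one>, ?g) = (0, \<one>, ?l) \<otimes>\<^bsub>G\<^esub> (0, \<one>, mk (\<lambda>_. ?c))" by (simp only: mk_add)
    then have "\<mu> (0, \<one>, ?g) = \<mu> (0, \<one>, ?l) * \<kappa> ?c" using mult l LN NsI by (auto simp: \<kappa>_def)
    also have "\<kappa> ?c = \<kappa> (?l x) * \<kappa> (f \<one>)"
    proof -
      have "\<kappa> (f x - f \<one>) = \<kappa> (?l x)" using x by (intro \<kappa>_cong) (simp add: cong_def)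
      then show ?thesis by (simp only: \<kappa>_add)
    qed
    also have "\<mu> (0, \<one>, ?l) * (\<kappa> (?l x) * \<kappa> (f \<one>)) = \<chi> x (0, \<one>, ?l) * \<kappa> (f \<one>)" by (simp add: \<chi>_def)
    finally have \<mu>g: "\<mu> (0, \<one>, ?g) = \<kappa> (f \<one>)" using \<chi>1[OF l] by simp
    have swap: "(0, \<one>, f) \<otimes>\<^bsub>G\<^esub> (0, x, zero_fn) = (0, x, zero_fn) \<otimes>\<^bsub>G\<^esub> (0, \<one>, ?g)"
      using x by (simp add: P_mult mk_eq_iff)
    have "\<rho> (0, \<one>, f) *\<^sub>v w = \<rho> (0, x, zero_fn) *\<^sub>v (\<rho> (0, \<one>, ?g) *\<^sub>v v)"
      unfolding w_def using rep_mult[OF rep Nc[OF NsI[OF f]] tG(1) v(1)] rep_mult[OF rep tG(1) Nc[OF NsI[OF g]] v(1)] swap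
      by simp
    also have "\<dots> = \<kappa> (f \<one>) \<cdot>\<^sub>v w"
      unfolding wt[OF NsI[OF g]] \<mu>g w_def by (rule rep_smult[OF rep tG(1) v(1)])
    finally show "\<rho> (0, \<one>, f) *\<^sub>v w = \<kappa> (f \<one>) \<cdot>\<^sub>v w" .
  qed (rule \<kappa>_iff)
qed

text \<open>A weight of \<open>Ns\<close> is moved by a translation to one that depends on
  \<open>f \<one>\<close> alone. The rotations of C preserve its weight space and commute, so they
  have a common eigenvector there; it is a weight vector for all of \<open>As\<close>.\<close>

lemma degree_central_nontrivial:
  assumes irr: "irr_rep G d \<rho>" and z0: "x0 \<in> Zs" "u0 \<in> carrier_vec d" "\<rho> x0 *\<^sub>v u0 \<noteq> u0"
  shows "d = card (carrier U) * q"
proof -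
  note rep = irr_repD(1)[OF irr] and d0 = irr_repD(2)[OF irr]
  have Nc: "Ns \<subseteq> carrier G" by (rule subgroup.subset[OF subgroup_Ns])
  obtain v \<mu> where v: "v \<in> carrier_vec d" "v \<noteq> 0\<^sub>v d" "\<And>x. x \<in> Ns \<Longrightarrow> \<rho> x *\<^sub>v v = \<mu> x \<cdot>\<^sub>v v"
  proof (rule common_weight[OF G_group G_finite rep Nc whole_subspace whole_nonzero[OF d0]])
    show "\<rho> s *\<^sub>v v \<in> carrier_vec d" if "s \<in> Ns" "v \<in> carrier_vec d" for s v using that rep Nc by auto
    show "\<rho> s *\<^sub>v (\<rho> t *\<^sub>v v) = \<rho> t *\<^sub>v (\<rho> s *\<^sub>v v)" if "s \<in> Ns" "t \<in> Ns" "v \<in> carrier_vec d" for s t v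
    proof -
      have c: "s \<in> carrier G" "t \<in> carrier G" using that Nc by auto
      show ?thesis using rep_mult[OF rep c that(3)] rep_mult[OF rep c(2,1) that(3)] Ns_commute[OF that(1,2)] by simp
    qed
  qed blast
  have "\<exists>c. \<mu> (0, \<one>, mk (\<lambda>_. c)) \<noteq> 1"
  proof (rule ccontr)
    assume H: "\<nexists>c. \<mu> (0, \<one>, mk (\<lambda>_. c)) \<noteq> 1"
    have "\<rho> x *\<^sub>v v = v" if x: "x \<in> Zs" for x
    proof -
      obtain c where c: "x = (0, \<one>, mk (\<lambda>_. c))" using x unfolding Zs_def by blast
      have "\<mu> x = 1" using H c by blast
      then show ?thesis using v(1) v(3)[of x] x subsets(1) by auto
    qed
    then have "v = 0\<^sub>v d" using irr_rep_no_fixed_vector[OF G_group irr normal_Zs z0 v(1)] by blast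
    then show False using v(2) by simp
  qed
  then obtain c0 where c0: "\<mu> (0, \<one>, mk (\<lambda>_. c0)) \<noteq> 1" by blast
  obtain w \<kappa> where w: "w \<in> carrier_vec d" "w \<noteq> 0\<^sub>v d" "\<And>f. f \<in> aff \<Longrightarrow> \<rho> (0, \<one>, f) *\<^sub>v w = \<kappa> (f \<one>) \<cdot>\<^sub>v w"
    and \<kappa>: "\<And>s t. \<kappa> s = \<kappa> t \<longleftrightarrow> eqp s t"
  proof (rule translate_to_central_weight[OF rep v c0])
    fix w \<kappa> assume A: "w \<in> carrier_vec d" "w \<noteq> 0\<^sub>v d"
      "\<And>f. f \<in> aff \<Longrightarrow> \<rho> (0, \<one>, f) *\<^sub>v w = \<kappa> (f \<one>) \<cdot>\<^sub>v w" "\<And>s t. \<kappa> s = \<kappa> t \<longleftrightarrow> eqp s t"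
    show thesis by (rule that[OF A])
  qed simp_all
  define W where "W = {w \<in> carrier_vec d. \<forall>x\<in>Ns. \<rho> x *\<^sub>v w = \<kappa> ((snd (snd x)) \<one>) \<cdot>\<^sub>v w}"
  have W: "is_subspace d W" unfolding W_def by (rule weight_space_subspace[OF rep Nc])
  have "w \<in> W" using w by (auto simp: W_def Ns_def)
  then have W0: "W \<noteq> {0\<^sub>v d}" using w by blast
  \<comment> \<open>The rotations of C. For \<open>q dvd j\<close> the twist by \<open>z ^ j\<close>
    is trivial, so they do not change the value of a function at \<open>\<one>\<close> and preserve
    \<open>W\<close>.\<close>
  define S where "S = {(j, \<one>, zero_fn) | j. j < M \<and> q dvd j}"
  have Sc: "S \<subseteq> carrier G" using basic_elements(3) by (auto simp: S_def)
  obtain w' \<sigma> where w': "w' \<in> W" "w' \<in> carrier_vec d" "w' \<noteq> 0\<^sub>v d" "\<And>s. s \<in> S \<Longrightarrow> \<rho> s *\<^sub>v w' = \<sigma> s \<cdot>\<^sub>v w'"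
  proof (rule common_weight[OF G_group G_finite rep Sc W W0])
    fix s u assume s: "s \<in> S" and u: "u \<in> W"
    then obtain j where j: "s = (j, \<one>, zero_fn)" "j < M" "q dvd j" unfolding S_def by blast
    have uc: "u \<in> carrier_vec d" using u by (simp add: W_def)
    have sc: "s \<in> carrier G" using s Sc by auto
    have "\<rho> x *\<^sub>v (\<rho> s *\<^sub>v u) = \<kappa> ((snd (snd x)) \<one>) \<cdot>\<^sub>v (\<rho> s *\<^sub>v u)" if x: "x \<in> Ns" for x
    proof -
      obtain f where f: "x = (0, \<one>, f)" "f \<in> aff" using x unfolding Ns_def by blast
      let ?f' = "mk (\<lambda>x. int z ^ ((q - 1) * j) * ((zero_fn x - zero_fn (x \<otimes> act (idx_inv j) \<one>)) + f (act j x \<otimes> \<one>)))"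
      have xc: "x \<in> carrier G" using x Nc by auto
      have y: "x \<otimes>\<^bsub>G\<^esub> s = s \<otimes>\<^bsub>G\<^esub> (0, \<one>, ?f')" "?f' \<in> aff"
        using conj_P[OF sc[unfolded j(1)] one_closed f(2)] unfolding f(1) j(1) by simp_all
      have yN: "(0, \<one>, ?f') \<in> Ns" using y(2) by (simp add: Ns_def)
      have "eqp (?f' \<one>) (int z ^ ((q - 1) * j) * f \<one>)" by (simp add: cong_def)
      also have "eqp (int z ^ ((q - 1) * j) * f \<one>) (1 * f \<one>)" using j(3) by (intro cong_mult z_one cong_refl) simp
      finally have k: "\<kappa> (?f' \<one>) = \<kappa> (f \<one>)" using \<kappa> by simp
      have "\<rho> x *\<^sub>v (\<rho> s *\<^sub>v u) = \<rho> s *\<^sub>v (\<rho> (0, \<one>, ?f') *\<^sub>v u)"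
        using rep_mult[OF rep xc sc uc] rep_mult[OF rep sc _ uc, of "(0, \<one>, ?f')"] yN Nc y(1) by auto
      also have "\<rho> (0, \<one>, ?f') *\<^sub>v u = \<kappa> (?f' \<one>) \<cdot>\<^sub>v u" using u yN unfolding W_def by (metis (mono_tags, lifting) mem_Collect_eq snd_conv)
      also have "\<rho> s *\<^sub>v (\<kappa> (?f' \<one>) \<cdot>\<^sub>v u) = \<kappa> (f \<one>) \<cdot>\<^sub>v (\<rho> s *\<^sub>v u)" unfolding k by (rule rep_smult[OF rep sc uc])
      finally show ?thesis by (simp add: f(1))
    qed
    then show "\<rho> s *\<^sub>v u \<in> W" using rep sc uc by (simp add: W_def)
  next
    fix s t u assume st: "s \<in> S" "t \<in> S" and u: "u \<in> W"
    then obtain i j where ij: "s = (i, \<one>, zero_fn)" "q dvd i" "t = (j, \<one>, zero_fn)" "q dvd j" by (auto simp: S_def)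
    have uc: "u \<in> carrier_vec d" using u by (simp add: W_def)
    have c: "s \<in> carrier G" "t \<in> carrier G" using st Sc by auto
    have "s \<otimes>\<^bsub>G\<^esub> t = t \<otimes>\<^bsub>G\<^esub> s" using ij by (simp add: G_mult idx_M add.commute mk_eq_iff)
    then show "\<rho> s *\<^sub>v (\<rho> t *\<^sub>v u) = \<rho> t *\<^sub>v (\<rho> s *\<^sub>v u)"
      using rep_mult[OF rep c uc] rep_mult[OF rep c(2,1) uc] by simp
  qed blast
  have "\<exists>c. \<rho> a *\<^sub>v w' = c \<cdot>\<^sub>v w'" if a: "a \<in> As" for a
  proof -
    obtain j f where jf: "a = (j, \<one>, f)" "j < M" "q dvd j" "f \<in> aff" using a unfolding As_def by (auto simp: G_carrier)
    have s: "(j, \<one>, zero_fn) \<in> S" "(j, \<one>, zero_fn) \<in> carrier G" using jf Sc by (auto simp: S_def)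
    have n: "(0, \<one>, f) \<in> Ns" "(0, \<one>, f) \<in> carrier G" using jf Nc by (auto simp: Ns_def)
    \<comment> \<open>Because \<open>z ^ j\<close> is 1 modulo \<open>p\<close>, \<open>a\<close> is
      the product of a rotation in \<open>S\<close> and an element of \<open>Ns\<close>.\<close>
    have "f = mk (\<lambda>t. int z ^ j * f t + zero_fn (act 0 t \<otimes> \<one>))"
    proof (rule aff_eqI[OF jf(4)])
      show "mk (\<lambda>t. int z ^ j * f t + zero_fn (act 0 t \<otimes> \<one>)) \<in> aff"
        using jf(4) by (simp add: affine_mult)
      fix t assume t: "t \<in> carrier U"
      have "eqp (int z ^ j * f t) (1 * f t)" by (intro cong_mult z_one jf cong_refl)
      then show "eqp (f t) (mk (\<lambda>t. int z ^ j * f t + zero_fn (act 0 t \<otimes> \<one>)) t)"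
        using t by (simp add: cong_def act_0)
    qed
    then have "a = (j, \<one>, zero_fn) \<otimes>\<^bsub>G\<^esub> (0, \<one>, f)" using jf by (simp add: G_mult)
    then have "\<rho> a *\<^sub>v w' = \<rho> (j, \<one>, zero_fn) *\<^sub>v (\<rho> (0, \<one>, f) *\<^sub>v w')"
      using rep_mult[OF rep s(2) n(2) w'(2)] by simp
    also have "\<rho> (0, \<one>, f) *\<^sub>v w' = \<kappa> (f \<one>) \<cdot>\<^sub>v w'" using w'(1) n(1) unfolding W_def by auto
    also have "\<rho> (j, \<one>, zero_fn) *\<^sub>v (\<kappa> (f \<one>) \<cdot>\<^sub>v w') = (\<kappa> (f \<one>) * \<sigma> (j, \<one>, zero_fn)) \<cdot>\<^sub>v w'"
      using rep_smult[OF rep s(2) w'(2)] w'(4)[OF s(1)] by (simp add: smult_smult_assoc)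
    finally show ?thesis by blast
  qed
  then have "\<forall>a\<in>As. \<exists>c. \<rho> a *\<^sub>v w' = c \<cdot>\<^sub>v w'" by blast
  from bchoice[OF this] obtain \<theta> where \<theta>: "\<And>a. a \<in> As \<Longrightarrow> \<rho> a *\<^sub>v w' = \<theta> a \<cdot>\<^sub>v w'" by blast
  have "separated G As Ns \<theta>"
  proof (rule separated_As[where \<kappa> = \<kappa>])
    fix f assume f: "f \<in> aff"
    have n: "(0, \<one>, f) \<in> Ns" using f by (simp add: Ns_def)
    have "\<theta> (0, \<one>, f) \<cdot>\<^sub>v w' = \<kappa> (f \<one>) \<cdot>\<^sub>v w'"
      using \<theta>[of "(0, \<one>, f)"] n subsets(6) w'(1) unfolding W_def by auto
    then show "\<theta> (0, \<one>, f) = \<kappa> (f \<one>)" by (rule smult_vec_cancel[OF w'(2,3)])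
  qed (simp add: \<kappa>)
  from irr_rep_dim_eq_index[OF G_group G_finite irr subgroup_As transversal_As(1) normal_Ns subsets(6) this w'(2,3) \<theta>]
  show ?thesis using transversal_As(2) by simp
qed

text \<open>With \<open>Zs\<close> acting trivially, \<open>Ps\<close> acts by commuting matrices
  and so has a weight. That weight is nontrivial on \<open>Es\<close>, as otherwise
  \<open>Es\<close> would fix a nonzero vector.\<close>

lemma degree_central_trivial:
  assumes irr: "irr_rep G d \<rho>" and triv: "\<And>x w. x \<in> Zs \<Longrightarrow> w \<in> carrier_vec d \<Longrightarrow> \<rho> x *\<^sub>v w = w"
    and e0: "x0 \<in> Es" "u0 \<in> carrier_vec d" "\<rho> x0 *\<^sub>v u0 \<noteq> u0"
  shows "d = M"
proof -
  note rep = irr_repD(1)[OF irr] and d0 = irr_repD(2)[OF irr]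
  have Pc: "Ps \<subseteq> carrier G" by (rule subgroup.subset[OF subgroup_Ps])
  have Zc: "Zs \<subseteq> carrier G" by (rule subgroup.subset[OF subgroup_Zs])
  obtain v \<mu> where v: "v \<in> carrier_vec d" "v \<noteq> 0\<^sub>v d" "\<And>x. x \<in> Ps \<Longrightarrow> \<rho> x *\<^sub>v v = \<mu> x \<cdot>\<^sub>v v"
  proof (rule common_weight[OF G_group G_finite rep Pc whole_subspace whole_nonzero[OF d0]])
    show "\<rho> s *\<^sub>v v \<in> carrier_vec d" if "s \<in> Ps" "v \<in> carrier_vec d" for s v using that rep Pc by auto
    show "\<rho> s *\<^sub>v (\<rho> t *\<^sub>v v) = \<rho> t *\<^sub>v (\<rho> s *\<^sub>v v)" if "s \<in> Ps" "t \<in> Ps" "v \<in> carrier_vec d" for s t v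
      by (rule commute_mod_rep[OF G_group rep Pc Zc commute_Ps triv that])
  qed blast
  have mult: "\<mu> (x \<otimes>\<^bsub>G\<^esub> y) = \<mu> x * \<mu> y" if "x \<in> Ps" "y \<in> Ps" for x y
    by (rule weight_mult[OF rep v(1,2) _ _ v(3)[OF that(1)] v(3)[OF that(2)]
          v(3)[OF subgroup.m_closed[OF subgroup_Ps that]]]) (use that Pc in auto)
  have ZP: "Zs \<subseteq> Ps" using subsets(1,2) by blast
  have Z1: "\<mu> x = 1" if x: "x \<in> Zs" for x
  proof -
    have "\<mu> x \<cdot>\<^sub>v v = 1 \<cdot>\<^sub>v v" using v(3)[of x] triv[OF x v(1)] x ZP by auto
    then show ?thesis by (rule smult_vec_cancel[OF v(1,2)])
  qed
  have "\<exists>e\<in>Es. \<mu> e \<noteq> 1"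
  proof (rule ccontr)
    assume H: "\<not> (\<exists>e\<in>Es. \<mu> e \<noteq> 1)"
    have "\<rho> x *\<^sub>v v = v" if x: "x \<in> Es" for x
    proof -
      have "\<mu> x = 1" using H x by blast
      moreover have "x \<in> Ps" using x subsets(4) by blast
      ultimately show ?thesis using v(3)[of x] by simp
    qed
    then have "v = 0\<^sub>v d" using irr_rep_no_fixed_vector[OF G_group irr normal_Es e0 v(1)] by blast
    then show False using v(2) by simp
  qed
  then obtain e where e: "e \<in> Es" "\<mu> e \<noteq> 1" by blast
  have "separated G Ps Ps \<mu>" by (rule separated_Ps[OF mult Z1 e])
  from irr_rep_dim_eq_index[OF G_group G_finite irr subgroup_Ps transversal_Ps(1) normal_Ps subset_refl this v]
  show ?thesis using transversal_Ps(2) by simp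
qed

text \<open>Now \<open>Cs\<close> acts by commuting matrices. If its weight is separated, the degree
  is the index \<open>q\<close>. Otherwise some \<open>g\<close> outside \<open>Cs\<close> preserves
  the weight space. As \<open>q\<close> is prime, \<open>g\<close> and \<open>Cs\<close> generate
  \<open>G\<close>, so an eigenvector of \<open>g\<close> in that space spans an invariant
  line.\<close>

lemma degree_Es_trivial:
  assumes irr: "irr_rep G d \<rho>" and triv: "\<And>x w. x \<in> Es \<Longrightarrow> w \<in> carrier_vec d \<Longrightarrow> \<rho> x *\<^sub>v w = w"
  shows "d = 1 \<or> d = q"
proof -
  note rep = irr_repD(1)[OF irr] and d0 = irr_repD(2)[OF irr]
  have Cc: "Cs \<subseteq> carrier G" and Ec: "Es \<subseteq> carrier G"
    using subgroup.subset[OF subgroup_Cs] subgroup.subset[OF subgroup_Es] .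
  obtain v \<mu> where v: "v \<in> carrier_vec d" "v \<noteq> 0\<^sub>v d" "\<And>x. x \<in> Cs \<Longrightarrow> \<rho> x *\<^sub>v v = \<mu> x \<cdot>\<^sub>v v"
  proof (rule common_weight[OF G_group G_finite rep Cc whole_subspace whole_nonzero[OF d0]])
    show "\<rho> s *\<^sub>v v \<in> carrier_vec d" if "s \<in> Cs" "v \<in> carrier_vec d" for s v using that rep Cc by auto
    show "\<rho> s *\<^sub>v (\<rho> t *\<^sub>v v) = \<rho> t *\<^sub>v (\<rho> s *\<^sub>v v)" if "s \<in> Cs" "t \<in> Cs" "v \<in> carrier_vec d" for s t v
      by (rule commute_mod_rep[OF G_group rep Cc Ec commute_Cs triv that])
  qed blast
  show ?thesis
  proof (cases "separated G Cs Cs \<mu>")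
    case True
    from irr_rep_dim_eq_index[OF G_group G_finite irr subgroup_Cs transversal_Cs(1) normal_Cs subset_refl True v]
    show ?thesis using transversal_Cs(2) by simp
  next
    case False
    then obtain g where g: "g \<in> carrier G" "g \<notin> Cs"
      and inv: "\<And>x y. x \<in> Cs \<Longrightarrow> y \<in> Cs \<Longrightarrow> x \<otimes>\<^bsub>G\<^esub> g = g \<otimes>\<^bsub>G\<^esub> y \<Longrightarrow> \<mu> x = \<mu> y"
      unfolding separated_def by blast
    define W where "W = {w \<in> carrier_vec d. \<forall>x\<in>Cs. \<rho> x *\<^sub>v w = \<mu> x \<cdot>\<^sub>v w}"
    have W: "is_subspace d W" unfolding W_def by (rule weight_space_subspace[OF rep Cc])
    have "v \<in> W" using v by (simp add: W_def)
    then have W0: "W \<noteq> {0\<^sub>v d}" using v by blast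
    have gW: "\<rho> g *\<^sub>v w \<in> W" if w: "w \<in> W" for w
    proof -
      have wc: "w \<in> carrier_vec d" using w by (simp add: W_def)
      have "\<rho> x *\<^sub>v (\<rho> g *\<^sub>v w) = \<mu> x \<cdot>\<^sub>v (\<rho> g *\<^sub>v w)" if x: "x \<in> Cs" for x
      proof -
        obtain y where y: "y \<in> Cs" "x \<otimes>\<^bsub>G\<^esub> g = g \<otimes>\<^bsub>G\<^esub> y" using conj_closed(2)[OF normal_Cs g(1) x] by blast
        have c: "x \<in> carrier G" "y \<in> carrier G" using x y Cc by auto
        have "\<rho> x *\<^sub>v (\<rho> g *\<^sub>v w) = \<rho> g *\<^sub>v (\<rho> y *\<^sub>v w)"
          using rep_mult[OF rep c(1) g(1) wc] rep_mult[OF rep g(1) c(2) wc] y(2) by simp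
        also have "\<dots> = \<mu> y \<cdot>\<^sub>v (\<rho> g *\<^sub>v w)" using w y(1) rep_smult[OF rep g(1) wc] by (simp add: W_def)
        finally show ?thesis using inv[OF x y] by simp
      qed
      then show ?thesis using rep g wc by (simp add: W_def)
    qed
    obtain c w where w: "w \<in> W" "w \<noteq> 0\<^sub>v d" "\<rho> g *\<^sub>v w = c \<cdot>\<^sub>v w"
      by (rule rep_eigenvector[OF G_group G_finite rep g(1) W W0 gW])
    have wc: "w \<in> carrier_vec d" using w by (simp add: W_def)
    have pow: "\<exists>c. \<rho> (g [^]\<^bsub>G\<^esub> m) *\<^sub>v w = c \<cdot>\<^sub>v w" for m :: nat
    proof (induction m)
      case 0
      then show ?case using rep_one[OF rep wc] by (intro exI[of _ 1]) simp
    next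
      case (Suc m)
      then obtain b where b: "\<rho> (g [^]\<^bsub>G\<^esub> m) *\<^sub>v w = b \<cdot>\<^sub>v w" by blast
      have "\<rho> (g [^]\<^bsub>G\<^esub> m \<otimes>\<^bsub>G\<^esub> g) *\<^sub>v w = (c * b) \<cdot>\<^sub>v w"
        using rep_mult[OF rep GG.nat_pow_closed[OF g(1)] g(1) wc, of m] rep_smult[OF rep GG.nat_pow_closed[OF g(1)] wc] b w(3)
        by (simp add: smult_smult_assoc)
      then show ?case by auto
    qed
    have fpow: "[fst (g [^]\<^bsub>G\<^esub> m) = m * fst g] (mod q)" for m :: nat
    proof (induction m)
      case 0
      then show ?case by (simp add: G_one)
    next
      case (Suc m)
      have "[fst (g [^]\<^bsub>G\<^esub> m \<otimes>\<^bsub>G\<^esub> g) = fst (g [^]\<^bsub>G\<^esub> m) + fst g] (mod q)"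
        by (intro fst_mult_mod_q GG.nat_pow_closed g)
      also have "[fst (g [^]\<^bsub>G\<^esub> m) + fst g = m * fst g + fst g] (mod q)" by (intro cong_add Suc cong_refl)
      finally show ?case by (simp add: add.commute)
    qed
    have "\<not> q dvd fst g" using g by (simp add: Cs_iff)
    then have "coprime q (fst g)" by (rule prime_imp_coprime[OF q])
    then have "coprime (fst g) q" by (rule coprime_commute[THEN iffD1])
    \<comment> \<open>The power of \<open>g\<close> with exponent \<open>t * fst a\<close> has the
      same index modulo \<open>q\<close> as \<open>a\<close>, hence lies in the same coset of
      \<open>Cs\<close>.\<close>
    then obtain t where t: "[fst g * t = 1] (mod q)" using cong_solve_coprime_nat by auto
    have "\<exists>c. \<rho> a *\<^sub>v w = c \<cdot>\<^sub>v w" if a: "a \<in> carrier G" for a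
    proof -
      define m where "m = t * fst a"
      let ?h = "g [^]\<^bsub>G\<^esub> m"
      have hc: "?h \<in> carrier G" using g by simp
      have "[fst ?h = m * fst g] (mod q)" by (rule fpow)
      also have "m * fst g = (fst g * t) * fst a" by (simp add: m_def)
      also have "[(fst g * t) * fst a = 1 * fst a] (mod q)" by (intro cong_mult t cong_refl)
      finally have "[fst ?h = fst a] (mod q)" by simp
      then have x: "inv\<^bsub>G\<^esub> ?h \<otimes>\<^bsub>G\<^esub> a \<in> Cs" using quotient_in_Cs hc a by (metis prod.collapse)
      have "\<rho> a *\<^sub>v w = \<rho> (?h \<otimes>\<^bsub>G\<^esub> (inv\<^bsub>G\<^esub> ?h \<otimes>\<^bsub>G\<^esub> a)) *\<^sub>v w" using hc a by (simp add: GG.m_assoc[symmetric])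
      also have "\<dots> = \<rho> ?h *\<^sub>v (\<rho> (inv\<^bsub>G\<^esub> ?h \<otimes>\<^bsub>G\<^esub> a) *\<^sub>v w)" using hc a by (intro rep_mult[OF rep _ _ wc]) auto
      also have "\<dots> = \<rho> ?h *\<^sub>v (\<mu> (inv\<^bsub>G\<^esub> ?h \<otimes>\<^bsub>G\<^esub> a) \<cdot>\<^sub>v w)" using w(1) x by (simp add: W_def)
      finally show ?thesis using pow[of m] rep_smult[OF rep hc wc] by (auto simp: smult_smult_assoc)
    qed
    then have "\<forall>a\<in>carrier G. \<exists>c. \<rho> a *\<^sub>v w = c \<cdot>\<^sub>v w" by blast
    from bchoice[OF this] obtain \<theta> where \<theta>: "\<And>a. a \<in> carrier G \<Longrightarrow> \<rho> a *\<^sub>v w = \<theta> a \<cdot>\<^sub>v w" by blast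
    \<comment> \<open>With all of \<open>G\<close> as the subgroup the separation is vacuous, and
      the degree is the index 1.\<close>
    have "separated G (carrier G) {\<one>\<^bsub>G\<^esub>} \<theta>" by (simp add: separated_def)
    from irr_rep_dim_eq_index[OF G_group G_finite irr GG.subgroup_self transversal_carrier GG.one_is_normal _ this wc w(2) \<theta>]
    show ?thesis by simp
  qed
qed

theorem cd_G: "cd G = {1, q, M, card (carrier U) * q}"
proof
  show "{1, q, M, card (carrier U) * q} \<subseteq> cd G" using degrees_attained by simp
  show "cd G \<subseteq> {1, q, M, card (carrier U) * q}"
  proof
    fix d assume "d \<in> cd G"
    then obtain \<rho> where irr: "irr_rep G d \<rho>" by (auto simp: cd_def)
    show "d \<in> {1, q, M, card (carrier U) * q}"
    proof (cases "\<exists>x\<in>Zs. \<exists>w\<in>carrier_vec d. \<rho> x *\<^sub>v w \<noteq> w")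
      case True
      then show ?thesis using degree_central_nontrivial[OF irr] by blast
    next
      case False
      show ?thesis
      proof (cases "\<exists>x\<in>Es. \<exists>w\<in>carrier_vec d. \<rho> x *\<^sub>v w \<noteq> w")
        case True
        then show ?thesis using degree_central_trivial[OF irr] False by blast
      next
        case False
        then show ?thesis using degree_Es_trivial[OF irr] by blast
      qed
    qed
  qed
qed

end

theorem theorem3p5:
  fixes p q n :: nat
  assumes "Factorial_Ring.prime p" and "Factorial_Ring.prime q" and "odd q" and "q dvd p - 1" and "n > q"
  shows "\<exists>G :: nat monoid. group G \<and> finite (carrier G) \<and> solvable G \<and>
           derived_length G = 4 \<and> fitting_height G = 3 \<and>
           cd G = {1, q, pprime_part q (p ^ q - 1) * ppart q (p - 1) * q, p ^ n * q}"
proof -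
  have p1: "p > 1" using assms(1) prime_gt_1_nat by blast
  obtain a where a: "\<not> [a ^ ((p - 1) div q) = 1] (mod p)" "\<not> p dvd a"
    by (rule nonresidue_exists[OF assms(1,2,4)])
  interpret K: kummer p q a using assms a by unfold_locales
  \<comment> \<open>The trivial summand is given p^(n - q) elements, so that \<open>U\<close> has
    order p^n.\<close>
  obtain U :: "(int poly \<times> int poly) monoid" and act V D
    where U: "frobenius_module U p q act K.z V D" "card (carrier U) = p ^ (q + (n - q))"
    using K.frobenius_module_exists[OF assms(3), of "n - q"] by blast
  interpret F: frobenius_module U p q act K.z V D by (rule U(1))
  obtain H :: "nat monoid" and f where H: "group H" "f \<in> iso F.G H"
    using finite_group_iso_nat[OF F.G_group F.G_finite] by (elim exE conjE) (rule that)
  note T = iso_transfer[OF F.G_group H]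
  have "bij_betw f (carrier F.G) (carrier H)" using H(2) by (simp add: Group.iso_def)
  then have "finite (carrier H)" using F.G_finite by (simp add: bij_betw_finite)
  moreover have "cd H = {1, q, pprime_part q (p ^ q - 1) * ppart q (p - 1) * q, p ^ n * q}"
    using T(4) F.cd_G U(2) assms(5) index_formula[OF assms(2,3,4) p1] by (simp add: F.M_def)
  ultimately show ?thesis
    using H(1) T F.solvable_G F.derived_length_G F.fitting_height_G by (intro exI[of _ H]) simp
qed

end
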